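(* For all $\eta\in(0,1)$ and $c\in\mathbb N$ there is $n_0\in\mathbb N$ such that for all $n\ge n_0$ and all $k\ge \eta n$, every oriented graph $D$ on $n$ vertices with $\bar\delta^0(D)>(1+\eta)k/2$ contains (as a subgraph) every balanced antidirected tree $T$ with $k$ edges and with maximum total degree at most $(\log n)^c$.
   Context: An oriented graph is a digraph with no loops and at most one directed edge between any pair of vertices (an orientation of a simple graph). For a vertex $v$, $d^+(v)$ and $d^-(v)$ denote its outdegree and indegree. The minimum pseudo-semidegree $\bar\delta^0(D)$ of a digraph $D$ with at least one edge is the maximum $d$ such that for every vertex $v\in V(D)$ we have $d^+(v)\in\{0\}\cup[d,\infty)$ and $d^-(v)\in\{0\}\cup[d,\infty)$ (i.e. every vertex has outdegree $0$ or at least $d$, and indegree $0$ or at least $d$); for an edgeless digraph it is $0$. An oriented graph is antidirected if no vertex has both positive outdegree and positive indegree; for an antidirected tree this means all edges go from one bipartition class of the underlying tree to the other. An (oriented) tree is balanced if the two bipartition classes of its underlying tree have the same size. The total degree of a vertex is the sum of its indegree and outdegree, and the maximum total degree of $T$ is the maximum degree of its underlying undirected tree. *)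

theory Defs
  imports Complex_Main "Graph_Theory.Digraph_Isomorphism"
begin

text \<open>
  Digraphs are finite and have no parallel arcs; they are represented by
  \<^typ>\<open>'a pair_pre_digraph\<close>, whose arcs are ordered pairs of vertices.
\<close>

locale oriented_graph = pair_digraph +
  assumes no_antiparallel: "(u, v) \<in> parcs G \<Longrightarrow> (v, u) \<notin> parcs G"

text \<open>
  The predicate \<^const>\<open>Digraph_Component.tree\<close> only forbids directed cycles, so it
  holds, for example, for an antidirected orientation of a 4-cycle. A tree has to be free of
  cycles of the underlying graph. In \<^const>\<open>mk_symmetric\<close> every edge also yields a closed
  walk of length 2, which the bound on the length discards.
\<close>

definition underlying_acyclic :: "'a pair_pre_digraph \<Rightarrow> bool" where
  "underlying_acyclic G \<longleftrightarrow>
     \<not> (\<exists>p. pre_digraph.cycle (with_proj (mk_symmetric (with_proj G))) p \<and> 3 \<le> length p)"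

locale oriented_tree = oriented_graph +
  assumes tree_connected: "Digraph_Component.connected (with_proj G)"
    and tree_acyclic: "underlying_acyclic G"

definition antidirected :: "'a pair_pre_digraph \<Rightarrow> bool" where
  "antidirected G \<longleftrightarrow>
     (\<forall>v \<in> pverts G. \<not> (0 < out_degree (with_proj G) v \<and> 0 < in_degree (with_proj G) v))"

definition bipartition :: "'a pair_pre_digraph \<Rightarrow> 'a set \<Rightarrow> 'a set \<Rightarrow> bool" where
  "bipartition G A B \<longleftrightarrow>
     A \<union> B = pverts G \<and> A \<inter> B = {} \<and> parcs G \<subseteq> A \<times> B \<union> B \<times> A"

text \<open>
  Only meant for connected digraphs, whose bipartition is unique up to exchanging the classes.
\<close>

definition balanced :: "'a pair_pre_digraph \<Rightarrow> bool" where
  "balanced G \<longleftrightarrow> (\<exists>A B. bipartition G A B \<and> card A = card B)"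

definition total_degree :: "'a pair_pre_digraph \<Rightarrow> 'a \<Rightarrow> nat" where
  "total_degree G v = in_degree (with_proj G) v + out_degree (with_proj G) v"

definition max_total_degree :: "'a pair_pre_digraph \<Rightarrow> nat" where
  "max_total_degree G = Max (total_degree G ` pverts G)"

text \<open>
  For a finite digraph with an arc, the set below contains 0 and is bounded by any positive
  outdegree, so its maximum exists.
\<close>

definition min_pseudo_semidegree :: "'a pair_pre_digraph \<Rightarrow> nat" where
  "min_pseudo_semidegree G =
     (if parcs G = {} then 0
      else Max {d. \<forall>v \<in> pverts G.
             out_degree (with_proj G) v \<in> {0} \<union> {d..} \<and>
             in_degree (with_proj G) v \<in> {0} \<union> {d..}})"

definition contains_copy :: "'a pair_pre_digraph \<Rightarrow> 'b pair_pre_digraph \<Rightarrow> bool" where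
  "contains_copy G H \<longleftrightarrow>
     (\<exists>H' :: 'a pair_pre_digraph.
        subgraph (with_proj H') (with_proj G) \<and> digraph_iso (with_proj H) (with_proj H'))"

end

theory Submission imports Defs "HOL-Analysis.Convex" "HOL-Library.Disjoint_Sets" "HOL-Real_Asymp.Real_Asymp"
begin

text \<open>
  In the bipartite double cover of \<open>D\<close> every vertex has an out-copy and an in-copy, and an arc
  \<open>(u, w)\<close> joins the out-copy of \<open>u\<close> to the in-copy of \<open>w\<close>. A copy of \<open>T\<close> in \<open>D\<close> is an embedding of
  \<open>T\<close> into this bipartite graph that respects the sides and uses at most one of the two copies of
  each vertex.

  Among the sets of at least \<open>d/4\<close> copies of nonzero degree, one that minimises the number of leaving
  edges plus a small multiple of its size is a core \<open>C\<close>: few edges leave it, and every cut inside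
  \<open>C\<close> has linearly many edges per vertex. As \<open>D\<close> has no antiparallel arcs, every fractional vertex
  cover of the edges inside \<open>C\<close> has total weight at least about \<open>d\<close>. For a weighting
  of smaller total weight the uncovered edges contain a regular pair of linear size, so Blackwell's
  approachability argument yields a fractional matching of weight about \<open>d\<close> by regular pairs.
  Splitting the pairs makes it integral: there are disjoint pairs of total size at least \<open>d\<close> up to
  a small error, which leaves room for both classes of \<open>T\<close>.

  The tree is cut into about \<open>sqrt n\<close> small pieces that are distributed in a balanced way over the
  pairs. A piece is embedded greedily: its first few levels lead through a small reservoir along the
  expansion of \<open>C\<close> to a set of linking vertices of its pair, and all other levels remain in the pair.
  Since the degrees are polylogarithmic and the number of levels is bounded, the reservoir suffices.
\<close>

section \<open>Robust cores and expansion\<close>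

text \<open>All arcs of the tree run from one class to the other, so in the double cover the
  orientation becomes a mere side condition. The price is that the two copies of a vertex exclude
  each other: the regular pairs must be disjoint in \<open>D\<close> itself, and a total size of
  \<open>d\<close> occupies about \<open>2d\<close> vertices. Antiparallel arcs would make this
  impossible: in the complete digraph on \<open>d + 1\<close> vertices all semidegrees are
  \<open>d\<close>, but a tree with nearly \<open>2d\<close> edges has too many vertices. The factor
  \<open>1 + \<eta>\<close> lets \<open>d\<close> exceed the class size by a linear amount, which
  pays for every approximation. Pieces are assigned to pairs by load alone, so the pair of a piece
  may be far from the image of its parent. Expansion makes every pair reachable from every core
  vertex in a number of steps that depends on \<open>\<eta>\<close> only. The size
  \<open>sqrt n\<close> balances two costs. Each piece spends polylogarithmically many vertices
  outside its pair, which asks for few pieces; and a piece must fit into whatever is still free and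
  disturbs the balance of the loads, which asks for small ones.\<close>

definition ecount :: "('v \<Rightarrow> 'v set) \<Rightarrow> 'v set \<Rightarrow> 'v set \<Rightarrow> real" where
  "ecount N S T = (\<Sum>v\<in>S. real (card (N v \<inter> T)))"

lemma real_card_Int_eq_sum:
  "finite T \<Longrightarrow> real (card (A \<inter> T)) = (\<Sum>w\<in>T. of_bool (w \<in> A))"
  by (simp add: sum_of_bool_eq Int_commute Collect_mem_eq)

lemma ecount_commute:
  assumes "finite S" "finite T" "\<And>v w. w \<in> N v \<longleftrightarrow> v \<in> N w"
  shows "ecount N S T = ecount N T S"
proof -
  have "ecount N S T = (\<Sum>v\<in>S. \<Sum>w\<in>T. of_bool (w \<in> N v))"
    unfolding ecount_def by (intro sum.cong refl real_card_Int_eq_sum assms)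
  also have "\<dots> = (\<Sum>w\<in>T. \<Sum>v\<in>S. of_bool (v \<in> N w))"
    by (subst sum.swap) (simp add: assms(3))
  also have "\<dots> = ecount N T S"
    unfolding ecount_def by (intro sum.cong refl real_card_Int_eq_sum[symmetric] assms)
  finally show ?thesis .
qed

lemma ecount_Un_right:
  assumes "finite T" "finite U" "T \<inter> U = {}"
  shows "ecount N S (T \<union> U) = ecount N S T + ecount N S U"
proof -
  have "real (card (N v \<inter> (T \<union> U))) = card (N v \<inter> T) + card (N v \<inter> U)" for v
    by (subst Int_Un_distrib, subst card_Un_disjoint) (use assms in auto)
  then show ?thesis unfolding ecount_def by (simp add: sum.distrib)
qed

lemma ecount_Un_left:
  assumes "finite S" "finite T" "S \<inter> T = {}"
  shows "ecount N (S \<union> T) U = ecount N S U + ecount N T U"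
  unfolding ecount_def using assms by (rule sum.union_disjoint)

lemma ecount_mono_left: "finite T \<Longrightarrow> S \<subseteq> T \<Longrightarrow> ecount N S U \<le> ecount N T U"
  unfolding ecount_def by (intro sum_mono2) auto

lemma finite_ex_minimiser:
  assumes "finite A" "A \<noteq> {}"
  shows "\<exists>x\<in>A. \<forall>y\<in>A. f x \<le> (f y :: real)"
proof -
  have "Min (f ` A) \<in> f ` A" using assms by (intro Min_in) auto
  then obtain x where "x \<in> A" "f x = Min (f ` A)" by auto
  then show ?thesis using assms by (intro bexI[of _ x]) auto
qed

text \<open>The competition is among sets of size at least \<open>d/4\<close>, but a set of size
  between \<open>d/4\<close> and \<open>d/2\<close> has too many edges leaving it. So the minimiser
  has size at least \<open>d/2\<close> and stays admissible when a vertex is removed. Comparison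
  with smaller sets yields the inner degrees and the expansion, comparison with
  \<open>\<Omega>\<close> the bound on the leaving edges.\<close>

lemma robust_core:
  fixes N :: "'v \<Rightarrow> 'v set" and d \<nu> :: real
  assumes fin: "finite \<Omega>" and ne: "\<Omega> \<noteq> {}"
    and sym: "\<And>v w. w \<in> N v \<longleftrightarrow> v \<in> N w"
    and closed: "\<And>v. v \<in> \<Omega> \<Longrightarrow> N v \<subseteq> \<Omega>"
    and deg: "\<And>v. v \<in> \<Omega> \<Longrightarrow> d \<le> real (card (N v))"
    and d: "4 \<le> d" and \<nu>: "0 \<le> \<nu>" "\<nu> * real (card \<Omega>) < 3/16 * d\<^sup>2"
  obtains C where "C \<subseteq> \<Omega>" "d / 2 \<le> real (card C)"
    "ecount N C (\<Omega> - C) \<le> \<nu> * real (card \<Omega>)"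
    "\<And>v. v \<in> C \<Longrightarrow> d / 2 \<le> real (card (N v \<inter> C))"
    "\<And>S. S \<subseteq> C \<Longrightarrow> \<nu> * min (real (card S)) (real (card (C - S))) \<le> ecount N S (C - S)"
proof -
  define F where "F C = ecount N C (\<Omega> - C) + \<nu> * real (card C)" for C
  define \<C> where "\<C> = {C. C \<subseteq> \<Omega> \<and> d / 4 \<le> real (card C)}"
  obtain v0 where v0: "v0 \<in> \<Omega>" using ne by auto
  have "d \<le> real (card \<Omega>)"
    using deg[OF v0] card_mono[OF fin closed[OF v0]] by linarith
  then have \<Omega>C: "\<Omega> \<in> \<C>" unfolding \<C>_def using d by auto
  have "finite \<C>" unfolding \<C>_def using fin by auto
  then obtain C where C: "C \<in> \<C>" and minC: "\<And>C'. C' \<in> \<C> \<Longrightarrow> F C \<le> F C'"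
    using finite_ex_minimiser[of \<C> F] \<Omega>C by auto
  have C\<Omega>: "C \<subseteq> \<Omega>" and C4: "d / 4 \<le> real (card C)" using C unfolding \<C>_def by auto
  have finC: "finite C" using C\<Omega> fin finite_subset by auto
  have F\<Omega>: "F \<Omega> = \<nu> * real (card \<Omega>)" unfolding F_def ecount_def by simp
  have split: "real (card (N v)) = card (N v \<inter> C) + card (N v \<inter> (\<Omega> - C))" if "v \<in> C" for v
  proof -
    have "card (N v \<inter> C \<union> N v \<inter> (\<Omega> - C)) = card (N v \<inter> C) + card (N v \<inter> (\<Omega> - C))"
      by (rule card_Un_disjoint) (use finC fin in auto)
    moreover have "N v \<inter> C \<union> N v \<inter> (\<Omega> - C) = N v" using closed[of v] C\<Omega> that by blast
    ultimately show ?thesis by simp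
  qed
  have leave: "ecount N C (\<Omega> - C) \<le> \<nu> * real (card \<Omega>)"
    using minC[OF \<Omega>C] mult_nonneg_nonneg[OF \<nu>(1) of_nat_0_le_iff[of "card C"]] F\<Omega> F_def[of C] by linarith
  \<comment> \<open>On \<open>[d/4, d/2]\<close> the parabola \<open>x * (d - x)\<close> is smallest
    at \<open>d/4\<close>, where it equals \<open>3/16 * d\<^sup>2\<close>; this is the origin of
    the upper bound on \<open>\<nu>\<close>.\<close>
  have C2: "d / 2 \<le> real (card C)"
  proof (rule ccontr)
    assume "\<not> ?thesis"
    then have lt: "real (card C) < d / 2" by simp
    have "real (card C) * (d - real (card C)) = (\<Sum>v\<in>C. d - real (card C))" by simp
    also have "\<dots> \<le> ecount N C (\<Omega> - C)"
      unfolding ecount_def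
    proof (rule sum_mono)
      fix v assume v: "v \<in> C"
      have "card (N v \<inter> C) \<le> card C" using finC by (intro card_mono) auto
      then show "d - real (card C) \<le> real (card (N v \<inter> (\<Omega> - C)))"
        using split[OF v] deg[of v] v C\<Omega> by auto
    qed
    finally have "real (card C) * (d - real (card C)) < 3/16 * d\<^sup>2" using leave \<nu> by linarith
    moreover have "0 \<le> (real (card C) - d/4) * (3*d/4 - real (card C))"
      using lt C4 d by (intro mult_nonneg_nonneg) auto
    moreover have "real (card C) * (d - real (card C)) = 3/16 * d\<^sup>2 + (real (card C) - d/4) * (3*d/4 - real (card C))"
      by (simp add: field_simps power2_eq_square)
    ultimately show False by linarith
  qed
  \<comment> \<open>If \<open>v\<close> had more neighbours outside than inside, moving it out would
    lower \<open>F\<close>; so at least half of its degree stays inside.\<close>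
  have inner: "d / 2 \<le> real (card (N v \<inter> C))" if v: "v \<in> C" for v
  proof -
    define C' where "C' = C - {v}"
    have "card C' = card C - 1" unfolding C'_def using v finC by simp
    moreover have "card C > 0" using v finC card_gt_0_iff by blast
    ultimately have cC': "real (card C') = real (card C) - 1" by simp
    then have "C' \<in> \<C>" unfolding \<C>_def using C\<Omega> C2 d C'_def by auto
    then have le: "F C \<le> F C'" by (rule minC)
    have eqC: "C = C' \<union> {v}" unfolding C'_def using v by auto
    have eqD: "\<Omega> - C' = (\<Omega> - C) \<union> {v}" unfolding C'_def using v C\<Omega> by auto
    have 1: "ecount N C (\<Omega> - C) = ecount N C' (\<Omega> - C) + real (card (N v \<inter> (\<Omega> - C)))"
      by (subst (1) eqC, subst ecount_Un_left) (use finC in \<open>auto simp: C'_def ecount_def\<close>)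
    have 2: "ecount N C' (\<Omega> - C') = ecount N C' (\<Omega> - C) + ecount N C' {v}"
      unfolding eqD by (rule ecount_Un_right) (use fin v in auto)
    have "ecount N C' {v} = ecount N {v} C'"
      by (rule ecount_commute) (use finC sym in \<open>auto simp: C'_def\<close>)
    also have "\<dots> \<le> real (card (N v \<inter> C))"
      unfolding ecount_def C'_def using finC by (auto intro!: card_mono)
    finally have "real (card (N v \<inter> (\<Omega> - C))) \<le> real (card (N v \<inter> C))"
      using le 1 2 \<nu> unfolding F_def cC' by (simp add: algebra_simps)
    then show ?thesis using split[OF v] deg[of v] v C\<Omega> by auto
  qed
  \<comment> \<open>Passing from \<open>C\<close> to \<open>S\<close> turns the edges between
    \<open>S\<close> and \<open>C - S\<close> into leaving ones and saves \<open>\<nu>\<close> for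
    each vertex of \<open>C - S\<close>. A set too small for this comparison is replaced by its
    complement in \<open>C\<close> below.\<close>
  have big: "\<nu> * real (card (C - S)) \<le> ecount N S (C - S)"
    if S: "S \<subseteq> C" "d / 4 \<le> real (card S)" for S
  proof -
    have finS: "finite S" using S finC finite_subset by auto
    have "S \<in> \<C>" unfolding \<C>_def using S C\<Omega> by auto
    then have "F C \<le> F S" by (rule minC)
    moreover have "\<Omega> - S = (C - S) \<union> (\<Omega> - C)" using S C\<Omega> by auto
    then have "ecount N S (\<Omega> - S) = ecount N S (C - S) + ecount N S (\<Omega> - C)"
      by (simp, subst ecount_Un_right) (use fin finC in auto)
    moreover have "ecount N S (\<Omega> - C) \<le> ecount N C (\<Omega> - C)"
      by (rule ecount_mono_left[OF finC S(1)])
    moreover have "real (card C) = real (card S) + real (card (C - S))"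
      using S finC finS by (simp add: card_Diff_subset card_mono of_nat_diff)
    ultimately show ?thesis unfolding F_def by (simp add: algebra_simps)
  qed
  have expand: "\<nu> * min (real (card S)) (real (card (C - S))) \<le> ecount N S (C - S)"
    if S: "S \<subseteq> C" for S
  proof (cases "d / 4 \<le> real (card S)")
    case True
    have "\<nu> * min (real (card S)) (real (card (C - S))) \<le> \<nu> * real (card (C - S))"
      using \<nu> by (intro mult_left_mono) auto
    then show ?thesis using big[OF S True] by linarith
  next
    case False
    have finS: "finite S" using S finC finite_subset by auto
    have "real (card C) = real (card S) + real (card (C - S))"
      using S finC finS by (simp add: card_Diff_subset card_mono of_nat_diff)
    then have "d / 4 \<le> real (card (C - S))" using False C2 by auto
    then have "\<nu> * real (card (C - (C - S))) \<le> ecount N (C - S) (C - (C - S))"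
      by (intro big) auto
    also have "C - (C - S) = S" using S by auto
    also have "ecount N (C - S) S = ecount N S (C - S)"
      by (rule ecount_commute) (use finC finS sym in auto)
    finally have "\<nu> * real (card S) \<le> ecount N S (C - S)" .
    moreover have "\<nu> * min (real (card S)) (real (card (C - S))) \<le> \<nu> * real (card S)"
      using \<nu> by (intro mult_left_mono) auto
    ultimately show ?thesis by linarith
  qed
  show ?thesis by (rule that[OF C\<Omega> C2 leave inner expand])
qed

section \<open>Layers around a set in an expanding core\<close>

primrec layer :: "('v \<Rightarrow> 'v set) \<Rightarrow> 'v set \<Rightarrow> real \<Rightarrow> 'v set \<Rightarrow> nat \<Rightarrow> 'v set" where
  "layer N C t A 0 = A"
| "layer N C t A (Suc l) = layer N C t A l \<union> {v \<in> C. t \<le> real (card (N v \<inter> layer N C t A l))}"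

lemma layer_subset: "A \<subseteq> C \<Longrightarrow> layer N C t A l \<subseteq> C"
  by (induction l) auto

lemma layer_mono: "l \<le> l' \<Longrightarrow> layer N C t A l \<subseteq> layer N C t A l'"
  by (induction l' rule: nat_induct) (auto simp: le_Suc_eq)

text \<open>Each step gains at least \<open>t\<close> vertices until \<open>C\<close> is exhausted.
  With fewer than \<open>d/4\<close> vertices missing, the inner degree \<open>d/2\<close> puts all
  of them into the next layer. Otherwise expansion sends at least \<open>2 * t * card C\<close>
  edges to the missing vertices; those with fewer than \<open>t\<close> of them receive at most
  half, and every other one at most \<open>card C\<close>. For \<open>t\<close> linear in
  \<open>card C\<close> the number of layers is bounded.\<close>

lemma layer_reaches:
  fixes N :: "'v \<Rightarrow> 'v set" and d \<nu> s t :: real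
  assumes fin: "finite C"
    and sym: "\<And>v w. w \<in> N v \<longleftrightarrow> v \<in> N w"
    and deg: "\<And>v. v \<in> C \<Longrightarrow> d / 2 \<le> real (card (N v \<inter> C))"
    and expand: "\<And>S. S \<subseteq> C \<Longrightarrow> \<nu> * min (real (card S)) (real (card (C - S))) \<le> ecount N S (C - S)"
    and \<nu>: "0 \<le> \<nu>"
    and A: "A \<subseteq> C" "s \<le> real (card A)"
    and t: "0 < t" "t \<le> d / 4" "2 * t * real (card C) \<le> \<nu> * min s (d / 4)"
    and l: "real (card C) < real l * t"
  shows "layer N C t A l = C"
proof -
  let ?R = "layer N C t A"
  have Rsub: "?R l \<subseteq> C" for l using layer_subset[OF A(1)] .
  have finR: "finite (?R l)" for l using Rsub fin finite_subset by blast
  have step: "?R (Suc l) = C \<or> real (card (?R l)) + t \<le> real (card (?R (Suc l)))" for l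
  proof (cases "real (card (C - ?R l)) < d / 4")
    case True
    have "v \<in> ?R (Suc l)" if v: "v \<in> C" for v
    proof -
      have "N v \<inter> C \<subseteq> (N v \<inter> ?R l) \<union> (C - ?R l)" by auto
      then have "card (N v \<inter> C) \<le> card ((N v \<inter> ?R l) \<union> (C - ?R l))"
        using fin finR by (intro card_mono) auto
      also have "\<dots> \<le> card (N v \<inter> ?R l) + card (C - ?R l)" by (rule card_Un_le)
      finally have "t \<le> real (card (N v \<inter> ?R l))" using True deg[OF v] t by linarith
      then show ?thesis using v by simp
    qed
    then show ?thesis using Rsub[of "Suc l"] by blast
  next
    case False
    let ?B = "C - ?R l"
    define X where "X = {v \<in> ?B. t \<le> real (card (N v \<inter> ?R l))}"
    have finX: "finite X" unfolding X_def using fin by auto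
    have Xsub: "X \<subseteq> C" unfolding X_def by auto
    have cC: "real (card ?B) \<le> real (card C)" using fin by (auto intro!: card_mono)
    have "s \<le> real (card (?R l))"
      using A(2) card_mono[OF finR[of l], of "?R 0"] layer_mono[of 0 l N C t A] by auto
    then have "\<nu> * min s (d / 4) \<le> \<nu> * min (real (card (?R l))) (real (card ?B))"
      using \<nu> False by (intro mult_left_mono) auto
    also have "\<dots> \<le> ecount N (?R l) ?B" by (rule expand[OF Rsub])
    also have "\<dots> = ecount N ?B (?R l)"
      by (rule ecount_commute) (use fin finR sym in auto)
    also have "\<dots> \<le> (\<Sum>v\<in>?B. t + (if v \<in> X then real (card C) else 0))"
      unfolding ecount_def
    proof (rule sum_mono)
      fix v assume "v \<in> ?B"
      have "card (N v \<inter> ?R l) \<le> card C" using Rsub fin by (intro card_mono) auto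
      then show "real (card (N v \<inter> ?R l)) \<le> t + (if v \<in> X then real (card C) else 0)"
        using \<open>v \<in> ?B\<close> t(1) unfolding X_def by auto
    qed
    also have "\<dots> = real (card ?B) * t + real (card X) * real (card C)"
    proof -
      have "?B \<inter> {v. v \<in> X} = X" unfolding X_def by auto
      then show ?thesis using fin by (simp add: sum.distrib sum.If_cases)
    qed
    finally have 1: "2 * t * real (card C) \<le> real (card ?B) * t + real (card X) * real (card C)"
      using t by linarith
    have "real (card ?B) * t \<le> real (card C) * t" using cC t(1) by (intro mult_right_mono) auto
    then have "t * real (card C) \<le> real (card X) * real (card C)" using 1 by (simp add: algebra_simps)
    moreover have "0 < real (card C)" using False t cC by linarith
    ultimately have "t \<le> real (card X)" by simp
    moreover have "card (?R l \<union> X) = card (?R l) + card X"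
      by (rule card_Un_disjoint) (use finR finX in \<open>auto simp: X_def\<close>)
    moreover have "card (?R l \<union> X) \<le> card (?R (Suc l))"
      using finR[of "Suc l"] by (intro card_mono) (auto simp: X_def)
    ultimately show ?thesis by linarith
  qed
  have grow: "?R (Suc l) = C \<or> real (Suc l) * t \<le> real (card (?R (Suc l)))" for l
  proof (induction l)
    case 0
    have "0 \<le> real (card (?R 0))" by simp
    then show ?case using step[of 0] by (simp del: layer.simps) linarith
  next
    case (Suc l)
    then show ?case
    proof
      assume "?R (Suc l) = C"
      then have "?R (Suc (Suc l)) = C"
        by (simp only: layer.simps(2)[of _ _ _ _ "Suc l"]) blast
      then show ?thesis by simp
    next
      assume "real (Suc l) * t \<le> real (card (?R (Suc l)))"
      then show ?thesis using step[of "Suc l"] by (simp add: algebra_simps del: layer.simps) linarith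
    qed
  qed
  have "l \<noteq> 0" using l by (cases l) auto
  then obtain l' where l': "l = Suc l'" by (cases l) auto
  have "card (?R l) \<le> card C" using fin Rsub by (intro card_mono)
  then show ?thesis using grow[of l'] l unfolding l' by auto
qed

section \<open>Dense and regular pairs\<close>

definition acount :: "('a \<times> 'b) set \<Rightarrow> 'a set \<Rightarrow> 'b set \<Rightarrow> real" where
  "acount E A B = real (card (E \<inter> A \<times> B))"

lemma acount_nonneg [simp]: "0 \<le> acount E A B"
  by (simp add: acount_def)

lemma acount_mono:
  "finite A' \<Longrightarrow> finite B' \<Longrightarrow> A \<subseteq> A' \<Longrightarrow> B \<subseteq> B' \<Longrightarrow> acount E A B \<le> acount E A' B'"
  unfolding acount_def by (intro of_nat_mono card_mono) auto

lemma acount_Un_left: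
  assumes "finite A" "finite A'" "finite B" "A \<inter> A' = {}"
  shows "acount E (A \<union> A') B = acount E A B + acount E A' B"
proof -
  have "E \<inter> (A \<union> A') \<times> B = E \<inter> A \<times> B \<union> E \<inter> A' \<times> B" by auto
  moreover have "card (E \<inter> A \<times> B \<union> E \<inter> A' \<times> B) = card (E \<inter> A \<times> B) + card (E \<inter> A' \<times> B)"
    by (rule card_Un_disjoint) (use assms in auto)
  ultimately show ?thesis by (simp add: acount_def)
qed

lemma acount_converse: "acount (E\<inverse>) B A = acount E A B"
proof -
  have "(E\<inverse> \<inter> B \<times> A) = prod.swap ` (E \<inter> A \<times> B)" by auto
  then show ?thesis by (simp add: acount_def card_image)
qed

lemma acount_Un_right:
  assumes "finite A" "finite B'" "finite B" "B \<inter> B' = {}"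
  shows "acount E A (B \<union> B') = acount E A B + acount E A B'"
  using acount_Un_left[of B B' A "E\<inverse>"] assms by (simp add: acount_converse)

lemma acount_eq_sum:
  assumes "finite A" "finite B"
  shows "acount E A B = (\<Sum>b\<in>B. real (card {a\<in>A. (a, b) \<in> E}))"
proof -
  have "E \<inter> A \<times> B = (\<Union>b\<in>B. (\<lambda>a. (a, b)) ` {a\<in>A. (a, b) \<in> E})" by auto
  then have "card (E \<inter> A \<times> B) = (\<Sum>b\<in>B. card ((\<lambda>a. (a, b)) ` {a\<in>A. (a, b) \<in> E}))"
    by (simp only:) (subst card_UN_disjoint, use assms in auto)
  also have "\<dots> = (\<Sum>b\<in>B. card {a\<in>A. (a, b) \<in> E})"
    by (intro sum.cong refl card_image) (auto simp: inj_on_def)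
  finally show ?thesis by (simp add: acount_def)
qed

lemma acount_le_mult:
  assumes "finite A" "finite B"
  shows "acount E A B \<le> real (card A) * real (card B)"
proof -
  have "card (E \<inter> A \<times> B) \<le> card (A \<times> B)" using assms by (intro card_mono) auto
  then show ?thesis by (simp add: acount_def card_cartesian_product flip: of_nat_mult)
qed

text \<open>Deleting an element of least value never lowers the average. The averages are compared
  after multiplying out, so that \<open>a = 0\<close> is covered.\<close>

lemma exists_heavy_subset:
  fixes g :: "'a \<Rightarrow> real"
  assumes "finite S" "a \<le> card S"
  shows "\<exists>B\<subseteq>S. card B = a \<and> real a * sum g S \<le> real (card S) * sum g B"
  using assms
proof (induction "card S" arbitrary: S)
  case 0
  then show ?case by auto
next
  case (Suc c)
  show ?case
  proof (cases "a = Suc c")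
    case True
    then show ?thesis using Suc by (intro exI[of _ S]) auto
  next
    case False
    then have ac: "a \<le> c" using Suc by auto
    have ne: "S \<noteq> {}" using Suc by auto
    then have "Min (g ` S) \<in> g ` S" using Suc.prems by (intro Min_in) auto
    then obtain x where x: "x \<in> S" "g x = Min (g ` S)" by auto
    then have min: "g x \<le> g y" if "y \<in> S" for y using that Suc.prems by auto
    have cS: "card (S - {x}) = c" using Suc x by auto
    have "real (card S) * g x = (\<Sum>y\<in>S. g x)" by simp
    also have "\<dots> \<le> sum g S" by (intro sum_mono min)
    finally have gx: "real (Suc c) * g x \<le> sum g S" using Suc.hyps(2) by simp
    have split: "sum g S = g x + sum g (S - {x})"
      using x Suc.prems by (simp add: sum.remove)
    obtain B where B: "B \<subseteq> S - {x}" "card B = a"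
      "real a * sum g (S - {x}) \<le> real c * sum g B"
      using Suc.hyps(1)[of "S - {x}"] cS ac Suc.prems by auto
    show ?thesis
    proof (cases "a = 0")
      case True
      then show ?thesis by (intro exI[of _ "{}"]) auto
    next
      case False
      then have c0: "0 < real c" using ac by auto
      have "real c * sum g S \<le> real (Suc c) * sum g (S - {x})"
        using gx split by (simp add: algebra_simps)
      then have "real a * (real c * sum g S) \<le> real a * (real (Suc c) * sum g (S - {x}))"
        by (intro mult_left_mono) auto
      also have "\<dots> = real (Suc c) * (real a * sum g (S - {x}))" by simp
      also have "\<dots> \<le> real (Suc c) * (real c * sum g B)"
        using B(3) by (intro mult_left_mono) auto
      finally have "real c * (real a * sum g S) \<le> real c * (real (Suc c) * sum g B)"
        by (simp add: algebra_simps)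
      then have "real a * sum g S \<le> real (Suc c) * sum g B" using c0 by simp
      then show ?thesis using B Suc.hyps(2) by (intro exI[of _ B]) auto
    qed
  qed
qed

lemma exists_heavy_right:
  assumes "finite A" "finite B" "a \<le> card B"
  shows "\<exists>B'\<subseteq>B. card B' = a \<and> real a * acount E A B \<le> real (card B) * acount E A B'"
proof -
  obtain B' where "B' \<subseteq> B" "card B' = a"
    "real a * (\<Sum>b\<in>B. real (card {a\<in>A. (a, b) \<in> E}))
       \<le> real (card B) * (\<Sum>b\<in>B'. real (card {a\<in>A. (a, b) \<in> E}))"
    using exists_heavy_subset[OF assms(2,3), of "\<lambda>b. real (card {a\<in>A. (a, b) \<in> E})"] by blast
  then show ?thesis using assms finite_subset[of B' B]
    by (intro exI[of _ B']) (simp add: acount_eq_sum)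
qed

lemma exists_heavy_left:
  assumes "finite A" "finite B" "a \<le> card A"
  shows "\<exists>A'\<subseteq>A. card A' = a \<and> real a * acount E A B \<le> real (card A) * acount E A' B"
  using exists_heavy_right[of B A a "E\<inverse>"] assms by (simp add: acount_converse)

text \<open>
  Splitting \<^term>\<open>P \<times> Q\<close> along \<^term>\<open>A\<close> and \<^term>\<open>B\<close>, the extremality of \<^term>\<open>(P, Q)\<close> bounds
  the three parts other than \<^term>\<open>A \<times> B\<close>; without the factor \<^term>\<open>w\<close> they would contain
  at most a proportion \<open>1 - \<epsilon>\<^sup>2\<close> of the arcs.
\<close>

lemma extremal_pair_regular:
  fixes w :: "nat \<Rightarrow> real"
  assumes fin: "finite P" "finite Q" and PQ: "card P = p" "card Q = p"
    and \<epsilon>: "0 < \<epsilon>" "\<epsilon> \<le> 1/4" "1 \<le> \<epsilon> * real p"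
    and w: "\<And>q. \<epsilon> * real p \<le> real q \<Longrightarrow> 0 < w q \<and> w q \<le> (1 + \<epsilon>\<^sup>2/4) * w p"
    and \<phi>: "0 \<le> \<phi>" "acount E P Q = \<phi> * (real p)\<^sup>2 * w p"
    and max: "\<And>P' Q' q. P' \<subseteq> P \<Longrightarrow> Q' \<subseteq> Q \<Longrightarrow> card P' = q \<Longrightarrow> card Q' = q \<Longrightarrow>
       acount E P' Q' \<le> \<phi> * (real q)\<^sup>2 * w q"
    and AB: "A \<subseteq> P" "B \<subseteq> Q" "\<epsilon> * real p \<le> real (card A)" "\<epsilon> * real p \<le> real (card B)"
  shows "\<epsilon>\<^sup>2/2 * acount E P Q \<le> acount E A B"
proof -
  \<comment> \<open>Extremality only speaks about pairs of equal size, so \<open>A\<close> and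
    \<open>B\<close> are cut down to the least admissible size \<open>a\<close>.\<close>
  define a where "a = nat \<lceil>\<epsilon> * real p\<rceil>"
  have a1: "\<epsilon> * real p \<le> real a" "real a \<le> \<epsilon> * real p + 1"
    unfolding a_def using \<epsilon> by linarith+
  have p4: "4 \<le> real p" using \<epsilon> mult_right_mono[of \<epsilon> "1/4" "real p"] by auto
  have ap: "2 * real a \<le> real p"
    using a1 \<epsilon>(3) mult_right_mono[of \<epsilon> "1/4" "real p"] \<epsilon>(2) by auto
  have a0: "0 < real a" using a1 \<epsilon> by linarith
  have "a \<le> card A" "a \<le> card B" unfolding a_def using AB by linarith+
  then obtain A1 B1 where A1: "A1 \<subseteq> A" "card A1 = a" and B1: "B1 \<subseteq> B" "card B1 = a"
    by (meson obtain_subset_with_card_n)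
  have A1P: "A1 \<subseteq> P" and B1Q: "B1 \<subseteq> Q" using A1 B1 AB by auto
  have finA1: "finite A1" "finite B1" using A1P B1Q fin finite_subset by blast+
  define r where "r = p - a"
  have r: "real r = real p - real a" unfolding r_def using ap by (simp add: of_nat_diff)
  have cr: "card (P - A1) = r" "card (Q - B1) = r"
    unfolding r_def using A1 B1 A1P B1Q PQ finA1 by (auto simp: card_Diff_subset)
  have ar: "a \<le> r" using ap r by linarith
  have wp: "0 < w p" using w[of p] \<epsilon> p4 by (auto intro: mult_left_le_one_le)
  define M where "M = 1 + \<epsilon>\<^sup>2/4"
  have wa: "w a \<le> M * w p" and wr: "w r \<le> M * w p"
    unfolding M_def using w a1 ar by (auto simp: order_trans)
  have split: "acount E P Q = acount E A1 B1 + acount E A1 (Q - B1)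
      + acount E (P - A1) B1 + acount E (P - A1) (Q - B1)"
  proof -
    have "P = A1 \<union> (P - A1)" "Q = B1 \<union> (Q - B1)" using A1P B1Q by auto
    then have "acount E P Q = acount E (A1 \<union> (P - A1)) (B1 \<union> (Q - B1))" by simp
    also have "\<dots> = acount E A1 (B1 \<union> (Q - B1)) + acount E (P - A1) (B1 \<union> (Q - B1))"
      by (rule acount_Un_left) (use fin finA1 in auto)
    also have "acount E A1 (B1 \<union> (Q - B1)) = acount E A1 B1 + acount E A1 (Q - B1)"
      by (rule acount_Un_right) (use fin finA1 in auto)
    also have "acount E (P - A1) (B1 \<union> (Q - B1)) = acount E (P - A1) B1 + acount E (P - A1) (Q - B1)"
      by (rule acount_Un_right) (use fin finA1 in auto)
    finally show ?thesis by simp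
  qed
  have bound_a: "\<phi> * (real a)\<^sup>2 * w a \<le> \<phi> * (real a)\<^sup>2 * (M * w p)"
    using wa \<phi> by (intro mult_left_mono) auto
  \<comment> \<open>The mixed parts are rectangles of sides \<open>a\<close> and \<open>r\<close>: a
    subset of size \<open>a\<close> of the longer side, heavy on average, gives a square to which
    extremality applies, and the bound scales back by \<open>r / a\<close>.\<close>
  obtain B' where B': "B' \<subseteq> Q - B1" "card B' = a"
    "real a * acount E A1 (Q - B1) \<le> real (card (Q - B1)) * acount E A1 B'"
    using exists_heavy_right[of A1 "Q - B1" a E] fin finA1 cr ar by auto
  have "acount E A1 B' \<le> \<phi> * (real a)\<^sup>2 * w a"
    by (rule max) (use B' A1 A1P in auto)
  then have "real a * acount E A1 (Q - B1) \<le> real r * (\<phi> * (real a)\<^sup>2 * (M * w p))"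
    using B'(3) bound_a cr mult_left_mono[of "acount E A1 B'" "\<phi> * (real a)\<^sup>2 * (M * w p)" "real r"]
    by auto
  also have "\<dots> = real a * (\<phi> * M * w p * (real r * real a))" by (simp add: power2_eq_square)
  finally have e2: "acount E A1 (Q - B1) \<le> \<phi> * M * w p * (real r * real a)" using a0 by simp
  obtain A' where A': "A' \<subseteq> P - A1" "card A' = a"
    "real a * acount E (P - A1) B1 \<le> real (card (P - A1)) * acount E A' B1"
    using exists_heavy_left[of "P - A1" B1 a E] fin finA1 cr ar by auto
  have "acount E A' B1 \<le> \<phi> * (real a)\<^sup>2 * w a"
    by (rule max) (use A' B1 B1Q in auto)
  then have "real a * acount E (P - A1) B1 \<le> real r * (\<phi> * (real a)\<^sup>2 * (M * w p))"
    using A'(3) bound_a cr mult_left_mono[of "acount E A' B1" "\<phi> * (real a)\<^sup>2 * (M * w p)" "real r"]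
    by auto
  also have "\<dots> = real a * (\<phi> * M * w p * (real r * real a))" by (simp add: power2_eq_square)
  finally have e3: "acount E (P - A1) B1 \<le> \<phi> * M * w p * (real r * real a)" using a0 by simp
  have "acount E (P - A1) (Q - B1) \<le> \<phi> * (real r)\<^sup>2 * w r"
    by (rule max) (use cr in auto)
  also have "\<dots> \<le> \<phi> * (real r)\<^sup>2 * (M * w p)" using wr \<phi> by (intro mult_left_mono) auto
  finally have e4: "acount E (P - A1) (Q - B1) \<le> \<phi> * M * w p * (real r)\<^sup>2" by (simp add: algebra_simps)
  have "\<phi> * M * w p * (real r * real a) + \<phi> * M * w p * (real r * real a) + \<phi> * M * w p * (real r)\<^sup>2
      = \<phi> * w p * (M * ((real p)\<^sup>2 - (real a)\<^sup>2))"
    unfolding r by (simp add: algebra_simps power2_eq_square)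
  also have "\<dots> \<le> \<phi> * w p * ((1 - \<epsilon>\<^sup>2/2) * (real p)\<^sup>2)"
  proof (intro mult_left_mono mult_nonneg_nonneg)
    have "(\<epsilon> * real p)\<^sup>2 \<le> (real a)\<^sup>2" using a1 \<epsilon> by (intro power_mono) auto
    then have "M * ((real p)\<^sup>2 - (real a)\<^sup>2) \<le> M * ((real p)\<^sup>2 - (\<epsilon> * real p)\<^sup>2)"
      unfolding M_def by (intro mult_left_mono) (auto intro: add_nonneg_nonneg)
    also have "\<dots> = (M * (1 - \<epsilon>\<^sup>2)) * (real p)\<^sup>2" by (simp add: algebra_simps power2_eq_square)
    also have "\<dots> \<le> (1 - \<epsilon>\<^sup>2/2) * (real p)\<^sup>2"
    proof (rule mult_right_mono)
      have "M * (1 - \<epsilon>\<^sup>2) = 1 - \<epsilon>\<^sup>2/2 - (\<epsilon>\<^sup>2/4 + \<epsilon>\<^sup>2 * \<epsilon>\<^sup>2 / 4)"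
        unfolding M_def by (simp add: field_simps)
      then show "M * (1 - \<epsilon>\<^sup>2) \<le> 1 - \<epsilon>\<^sup>2/2"
        using zero_le_power2[of \<epsilon>] zero_le_square[of "\<epsilon>\<^sup>2"] by linarith
    qed auto
    finally show "M * ((real p)\<^sup>2 - (real a)\<^sup>2) \<le> (1 - \<epsilon>\<^sup>2/2) * (real p)\<^sup>2" .
  qed (use \<phi> wp in auto)
  also have "\<dots> = (1 - \<epsilon>\<^sup>2/2) * acount E P Q" unfolding \<phi>(2) by simp
  finally have "acount E A1 B1 \<ge> acount E P Q - (1 - \<epsilon>\<^sup>2/2) * acount E P Q"
    using split e2 e3 e4 by linarith
  moreover have "acount E A1 B1 \<le> acount E A B"
    using AB A1 B1 fin finite_subset[of A P] finite_subset[of B Q] by (intro acount_mono) auto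
  ultimately show ?thesis by (simp add: algebra_simps)
qed

text \<open>Only the longer side is cut, to the length \<open>q\<close> of the shorter one. Density
  forces \<open>\<delta> * n \<le> q\<close>, so a proportion of at least \<open>\<delta>\<close> of
  the arcs survives; hence the square of \<open>\<delta>\<close>.\<close>

lemma exists_equal_dense:
  assumes fin: "finite P0" "finite Q0" "card P0 \<le> n" "card Q0 \<le> n" and n: "0 < n"
    and dense: "\<delta> * (real n)\<^sup>2 \<le> acount E P0 Q0" and \<delta>: "0 < \<delta>"
  shows "\<exists>P\<subseteq>P0. \<exists>Q\<subseteq>Q0. card P = card Q \<and> 0 < card P \<and> \<delta>\<^sup>2 * (real n)\<^sup>2 \<le> acount E P Q"
proof -
  define q where "q = min (card P0) (card Q0)"
  have le: "acount E P0 Q0 \<le> real (card P0) * real (card Q0)" using fin by (intro acount_le_mult)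
  have "real (card P0) * real (card Q0) \<le> real q * real n"
  proof (cases "card P0 \<le> card Q0")
    case True
    then show ?thesis unfolding q_def using fin by (auto intro!: mult_left_mono)
  next
    case False
    then have "real (card P0) * real (card Q0) \<le> real n * real (card Q0)"
      using fin by (intro mult_right_mono) auto
    then show ?thesis unfolding q_def using False by (simp add: mult.commute)
  qed
  then have "\<delta> * real n * real n \<le> real q * real n" using le dense by (simp add: power2_eq_square)
  then have qn: "\<delta> * real n \<le> real q" using n by simp
  have q0: "0 < q" using qn \<delta> n by (metis mult_pos_pos not_le of_nat_0_less_iff order_less_le_trans)
  have fin_bound: "\<delta>\<^sup>2 * (real n)\<^sup>2 \<le> x"
    if "real q * acount E P0 Q0 \<le> real c * x" "c \<le> n" "0 \<le> x" for c and x :: real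
  proof -
    have "real n * (\<delta>\<^sup>2 * (real n)\<^sup>2) = (\<delta> * real n) * (\<delta> * (real n)\<^sup>2)" by (simp add: power2_eq_square)
    also have "\<dots> \<le> real q * acount E P0 Q0" using qn dense \<delta> by (intro mult_mono) auto
    also have "\<dots> \<le> real n * x"
      using that mult_right_mono[of "real c" "real n" x] by auto
    finally show ?thesis using n by simp
  qed
  show ?thesis
  proof (cases "card P0 \<le> card Q0")
    case True
    then have qP: "q = card P0" unfolding q_def by auto
    obtain Q where Q: "Q \<subseteq> Q0" "card Q = q" "real q * acount E P0 Q0 \<le> real (card Q0) * acount E P0 Q"
      using exists_heavy_right[of P0 Q0 q E] fin True qP by auto
    then show ?thesis using fin_bound[OF Q(3)] fin qP q0 by (intro exI[of _ P0] exI[of _ Q] conjI) auto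
  next
    case False
    then have qP: "q = card Q0" unfolding q_def by auto
    obtain P where P: "P \<subseteq> P0" "card P = q" "real q * acount E P0 Q0 \<le> real (card P0) * acount E P Q0"
      using exists_heavy_left[of P0 Q0 q E] fin False qP by auto
    then show ?thesis using fin_bound[OF P(3)] fin qP q0 by (intro exI[of _ P] exI[of _ Q0] conjI) auto
  qed
qed

text \<open>A density increment in one stroke: among pairs of equal size \<open>p\<close>, the
  density times \<open>p powr \<kappa>\<close> is maximised. A subpair of relative size
  \<open>\<epsilon>\<close> pays at most a factor \<open>1 + \<epsilon>\<^sup>2/4\<close> for being
  smaller, so it cannot be much denser, and \<open>extremal_pair_regular\<close> applies. As
  densities are at most 1, the maximiser cannot be smaller than a constant fraction of
  \<open>n\<close>.\<close>

lemma regular_pair: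
  fixes \<delta> \<epsilon> :: real
  assumes \<delta>: "0 < \<delta>" "\<delta> \<le> 1" and \<epsilon>: "0 < \<epsilon>" "\<epsilon> \<le> 1/4"
  shows "\<exists>\<sigma>>0. \<sigma> \<le> 1 \<and> (\<forall>(E :: ('a \<times> 'a) set) P0 Q0 n. finite P0 \<and> finite Q0 \<and> card P0 \<le> n \<and> card Q0 \<le> n \<and>
     1 \<le> \<epsilon> * \<sigma> * real n \<and> \<delta> * (real n)\<^sup>2 \<le> acount E P0 Q0 \<longrightarrow>
     (\<exists>P\<subseteq>P0. \<exists>Q\<subseteq>Q0. card P = card Q \<and> \<sigma> * real n \<le> real (card P) \<and>
        (\<forall>A\<subseteq>P. \<forall>B\<subseteq>Q. \<epsilon> * real (card P) \<le> real (card A) \<and> \<epsilon> * real (card P) \<le> real (card B) \<longrightarrow>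
            \<delta>\<^sup>2 * \<epsilon>\<^sup>2 / 2 * (real (card P))\<^sup>2 \<le> acount E A B)))"
proof -
  \<comment> \<open>Solves \<open>\<epsilon> powr (-\<kappa>) = 1 + \<epsilon>\<^sup>2/4\<close>,
    capped at 1 so that \<open>2 - \<kappa>\<close> is nonnegative.\<close>
  define \<kappa> where "\<kappa> = min 1 (ln (1 + \<epsilon>\<^sup>2/4) / ln (1/\<epsilon>))"
  have ln1: "0 < ln (1/\<epsilon>)" using \<epsilon> by (simp add: ln_div)
  have ln2: "0 < ln (1 + \<epsilon>\<^sup>2/4)" using \<epsilon> by (intro ln_gt_zero) simp
  have \<kappa>0: "0 < \<kappa>" "\<kappa> \<le> 1" unfolding \<kappa>_def using ln1 ln2 by auto
  have "\<kappa> * ln (1/\<epsilon>) \<le> ln (1 + \<epsilon>\<^sup>2/4)"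
    unfolding \<kappa>_def using ln1 by (simp add: pos_le_divide_eq[symmetric])
  then have "exp (\<kappa> * ln (1/\<epsilon>)) \<le> exp (ln (1 + \<epsilon>\<^sup>2/4))" by simp
  moreover have "0 < 1 + \<epsilon>\<^sup>2/4" using \<epsilon> by (simp add: add_pos_nonneg)
  ultimately have \<kappa>: "\<epsilon> powr (-\<kappa>) \<le> 1 + \<epsilon>\<^sup>2/4"
    using \<epsilon> by (simp add: powr_def ln_div)
  \<comment> \<open>Comes from \<open>\<delta>\<^sup>2 * (n / p) powr \<kappa> \<le> 1\<close>,
    which holds because the density of the maximiser is at most 1.\<close>
  define \<sigma> where "\<sigma> = (\<delta>\<^sup>2) powr (1/\<kappa>)"
  have \<sigma>0: "0 < \<sigma>" unfolding \<sigma>_def using \<delta> by simp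
  have \<sigma>1: "\<sigma> \<le> 1" unfolding \<sigma>_def using \<delta> \<kappa>0 by (intro powr_le1) (auto intro: power_le_one)
  show ?thesis
  proof (intro exI[of _ \<sigma>] conjI \<sigma>0 \<sigma>1 allI impI, elim conjE)
    fix E :: "('a \<times> 'a) set" and P0 Q0 :: "'a set" and n :: nat
    assume fin: "finite P0" "finite Q0" "card P0 \<le> n" "card Q0 \<le> n"
      and n: "1 \<le> \<epsilon> * \<sigma> * real n" and dense: "\<delta> * (real n)\<^sup>2 \<le> acount E P0 Q0"
    have n0: "0 < n" using n by (cases n) auto
    obtain P1 Q1 where PQ1: "P1 \<subseteq> P0" "Q1 \<subseteq> Q0" "card P1 = card Q1" "0 < card P1"
      "\<delta>\<^sup>2 * (real n)\<^sup>2 \<le> acount E P1 Q1"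
      using exists_equal_dense[OF fin n0 dense \<delta>(1)] by blast
    define w where "w q = real q powr (-\<kappa>)" for q :: nat
    define f where "f PQ = acount E (fst PQ) (snd PQ) / ((real (card (fst PQ)))\<^sup>2 * w (card (fst PQ)))"
      for PQ :: "'a set \<times> 'a set"
    define \<F> where "\<F> = {PQ. fst PQ \<subseteq> P0 \<and> snd PQ \<subseteq> Q0 \<and> card (fst PQ) = card (snd PQ) \<and> 0 < card (fst PQ)}"
    have "\<F> \<subseteq> Pow P0 \<times> Pow Q0" unfolding \<F>_def by auto
    then have fin\<F>: "finite \<F>" using fin finite_subset[of \<F> "Pow P0 \<times> Pow Q0"] by simp
    have mem1: "(P1, Q1) \<in> \<F>" unfolding \<F>_def using PQ1 by auto
    have "Max (f ` \<F>) \<in> f ` \<F>" using fin\<F> mem1 by (intro Max_in) auto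
    then obtain P Q where PQ: "(P, Q) \<in> \<F>" "f (P, Q) = Max (f ` \<F>)" by auto
    have max: "f x \<le> f (P, Q)" if "x \<in> \<F>" for x using that fin\<F> PQ(2) by auto
    define p where "p = card P"
    have PQs: "P \<subseteq> P0" "Q \<subseteq> Q0" "card Q = p" "0 < p" using PQ(1) unfolding \<F>_def p_def by auto
    have finPQ: "finite P" "finite Q" using PQs fin finite_subset by blast+
    define \<phi> where "\<phi> = f (P, Q)"
    have wpos: "0 < w q" if "0 < q" for q using that unfolding w_def by simp
    have ePQ: "acount E P Q = \<phi> * (real p)\<^sup>2 * w p"
      unfolding \<phi>_def f_def p_def[symmetric] fst_conv snd_conv using PQs wpos[of p] by simp
    have \<phi>0: "0 \<le> \<phi>" unfolding \<phi>_def f_def w_def by simp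
    have ww: "(real q)\<^sup>2 * w q = real q powr (2 - \<kappa>)" if "0 < q" for q
      using that unfolding w_def by (simp add: powr_diff powr_minus_divide powr_numeral)
    have \<phi>n: "\<delta>\<^sup>2 * real n powr \<kappa> \<le> \<phi>"
    proof -
      define q where "q = card P1"
      have q: "0 < q" "q \<le> n" unfolding q_def using PQ1 fin card_mono[OF fin(1) PQ1(1)] by auto
      have "\<delta>\<^sup>2 * real n powr \<kappa> * ((real q)\<^sup>2 * w q) \<le> \<delta>\<^sup>2 * real n powr \<kappa> * (real n powr (2 - \<kappa>))"
        unfolding ww[OF q(1)] using q \<kappa>0 by (intro mult_left_mono powr_mono2) auto
      also have "\<dots> = \<delta>\<^sup>2 * (real n)\<^sup>2" using n0 by (simp add: powr_diff powr_numeral)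
      also have "\<dots> \<le> acount E P1 Q1" by (rule PQ1)
      finally have "\<delta>\<^sup>2 * real n powr \<kappa> \<le> f (P1, Q1)"
        unfolding f_def fst_conv snd_conv q_def[symmetric] using q wpos[of q] by (simp add: field_simps)
      then show ?thesis using max[OF mem1] unfolding \<phi>_def by linarith
    qed
    have pn: "p \<le> n" using PQs(1) fin card_mono[OF fin(1) PQs(1)] unfolding p_def by auto
    have dens: "\<delta>\<^sup>2 * (real p)\<^sup>2 * (real n powr \<kappa> * w p) \<le> acount E P Q"
      using mult_right_mono[OF \<phi>n, of "(real p)\<^sup>2 * w p"] wpos[OF PQs(4)] unfolding ePQ
      by (simp add: algebra_simps)
    have wn: "real n powr \<kappa> * w p = (real n / real p) powr \<kappa>"
      unfolding w_def using PQs n0 by (simp add: powr_divide powr_minus_divide)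
    have "1 \<le> (real n / real p) powr \<kappa>" using pn PQs \<kappa>0 by (intro ge_one_powr_ge_zero) auto
    then have dens1: "\<delta>\<^sup>2 * (real p)\<^sup>2 \<le> acount E P Q"
      using dens mult_left_mono[of 1 "(real n / real p) powr \<kappa>" "\<delta>\<^sup>2 * (real p)\<^sup>2"] unfolding wn by simp
    have "acount E P Q \<le> real p * real p"
      using acount_le_mult[OF finPQ, of E] PQs unfolding p_def by simp
    then have "\<delta>\<^sup>2 * (real n / real p) powr \<kappa> * (real p)\<^sup>2 \<le> 1 * (real p)\<^sup>2"
      using dens unfolding wn by (simp add: power2_eq_square algebra_simps)
    then have "\<delta>\<^sup>2 * (real n / real p) powr \<kappa> \<le> 1" using PQs by simp
    then have "\<delta>\<^sup>2 \<le> (real p / real n) powr \<kappa>"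
      using PQs n0 by (simp add: powr_divide field_simps)
    then have "\<sigma> \<le> ((real p / real n) powr \<kappa>) powr (1/\<kappa>)"
      unfolding \<sigma>_def using \<kappa>0 by (intro powr_mono2) auto
    also have "\<dots> = real p / real n" using \<kappa>0 by (simp add: powr_powr)
    finally have \<sigma>p: "\<sigma> * real n \<le> real p" using n0 by (simp add: field_simps)
    have "1 \<le> \<epsilon> * (\<sigma> * real n)" using n by (simp add: mult.assoc)
    also have "\<dots> \<le> \<epsilon> * real p" using \<sigma>p \<epsilon> by (intro mult_left_mono) auto
    finally have \<epsilon>p: "1 \<le> \<epsilon> * real p" .
    have reg: "\<delta>\<^sup>2 * \<epsilon>\<^sup>2 / 2 * (real p)\<^sup>2 \<le> acount E A B"
      if AB: "A \<subseteq> P" "B \<subseteq> Q" "\<epsilon> * real p \<le> real (card A)" "\<epsilon> * real p \<le> real (card B)" for A B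
    proof -
      have wq: "0 < w q \<and> w q \<le> (1 + \<epsilon>\<^sup>2/4) * w p" if q: "\<epsilon> * real p \<le> real q" for q
      proof -
        have q0: "0 < q" using \<epsilon>p q by (cases q) auto
        have "w q \<le> (\<epsilon> * real p) powr (-\<kappa>)"
          unfolding w_def using q \<epsilon>p \<kappa>0 by (intro powr_mono2') linarith+
        also have "\<dots> = \<epsilon> powr (-\<kappa>) * w p" unfolding w_def using \<epsilon> by (simp add: powr_mult)
        also have "\<dots> \<le> (1 + \<epsilon>\<^sup>2/4) * w p"
          using \<kappa> wpos[OF PQs(4)] by (intro mult_right_mono) auto
        finally show ?thesis using wpos[OF q0] by simp
      qed
      have maxq: "acount E P' Q' \<le> \<phi> * (real q)\<^sup>2 * w q"
        if P'Q': "P' \<subseteq> P" "Q' \<subseteq> Q" "card P' = q" "card Q' = q" for P' Q' q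
      proof (cases "q = 0")
        case True
        then have "P' = {}" using P'Q' finPQ finite_subset by fastforce
        then show ?thesis by (simp add: acount_def True)
      next
        case False
        then have "(P', Q') \<in> \<F>" unfolding \<F>_def using P'Q' PQs by auto
        from max[OF this] have "acount E P' Q' / ((real q)\<^sup>2 * w q) \<le> \<phi>"
          unfolding \<phi>_def[symmetric] by (simp add: f_def P'Q')
        then show ?thesis using False wpos[of q] by (simp add: field_simps)
      qed
      have "\<epsilon>\<^sup>2/2 * acount E P Q \<le> acount E A B"
        by (rule extremal_pair_regular[where w = w and p = p and \<phi> = \<phi> and \<epsilon> = \<epsilon>])
          (use finPQ p_def PQs(3) \<epsilon> \<epsilon>p wq \<phi>0 ePQ maxq AB in auto)
      moreover have "\<delta>\<^sup>2 * \<epsilon>\<^sup>2 / 2 * (real p)\<^sup>2 \<le> \<epsilon>\<^sup>2/2 * acount E P Q"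
        using mult_left_mono[OF dens1, of "\<epsilon>\<^sup>2/2"] by (simp add: algebra_simps)
      ultimately show ?thesis by linarith
    qed
    show "\<exists>P\<subseteq>P0. \<exists>Q\<subseteq>Q0. card P = card Q \<and> \<sigma> * real n \<le> real (card P) \<and>
        (\<forall>A\<subseteq>P. \<forall>B\<subseteq>Q. \<epsilon> * real (card P) \<le> real (card A) \<and> \<epsilon> * real (card P) \<le> real (card B) \<longrightarrow>
            \<delta>\<^sup>2 * \<epsilon>\<^sup>2 / 2 * (real (card P))\<^sup>2 \<le> acount E A B)"
      by (intro exI[of _ P] exI[of _ Q] conjI PQs(1,2) allI impI) 
         (use PQs \<sigma>p reg in \<open>auto simp: p_def[symmetric]\<close>)
  qed
qed

section \<open>The bipartite double cover\<close>

text \<open>Out-copies carry the tag \<^term>\<open>True\<close>, in-copies the tag \<^term>\<open>False\<close>.\<close>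

definition nb :: "('a \<times> 'a) set \<Rightarrow> 'a \<times> bool \<Rightarrow> ('a \<times> bool) set" where
  "nb E x = (if snd x then (\<lambda>w. (w, False)) ` {w. (fst x, w) \<in> E}
             else (\<lambda>w. (w, True)) ` {w. (w, fst x) \<in> E})"

lemma nb_sym: "w \<in> nb E v \<longleftrightarrow> v \<in> nb E w"
  unfolding nb_def by (cases v; cases w) (auto split: if_splits)

lemma nb_True [simp]: "(w, s) \<in> nb E (u, True) \<longleftrightarrow> (u, w) \<in> E \<and> \<not> s"
  unfolding nb_def by auto

lemma nb_False [simp]: "(w, s) \<in> nb E (u, False) \<longleftrightarrow> (w, u) \<in> E \<and> s"
  unfolding nb_def by auto

lemma nb_snd: "w \<in> nb E v \<Longrightarrow> snd w = (\<not> snd v)"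
  unfolding nb_def by (auto split: if_splits)

lemma inj_on_fst_nb: "inj_on fst (nb E v)"
  by (rule inj_onI) (auto simp: nb_def split: if_splits)

lemma nb_subset: "E \<subseteq> V \<times> V \<Longrightarrow> nb E v \<subseteq> V \<times> UNIV"
  unfolding nb_def by auto

lemma exists_low_subset:
  fixes y :: "'a \<Rightarrow> real"
  assumes "finite U" "h \<le> card U"
  shows "\<exists>W\<subseteq>U. card W = h \<and> (\<forall>u\<in>W. \<forall>v\<in>U - W. y u \<le> y v)"
  using assms(2)
proof (induction h)
  case 0
  then show ?case by (intro exI[of _ "{}"]) auto
next
  case (Suc h)
  then obtain W where W: "W \<subseteq> U" "card W = h" "\<forall>u\<in>W. \<forall>v\<in>U - W. y u \<le> y v" by auto
  have finW: "finite W" using W assms finite_subset by auto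
  have "U - W \<noteq> {}" using W Suc.prems by (metis Diff_eq_empty_iff Suc_n_not_le_n subset_antisym)
  then obtain x where x: "x \<in> U - W" "\<forall>v\<in>U - W. y x \<le> y v"
    using finite_ex_minimiser[of "U - W" y] assms by auto
  have "card (insert x W) = Suc h" using x W finW by auto
  moreover have "\<forall>u\<in>insert x W. \<forall>v\<in>U - insert x W. y u \<le> y v" using x W by auto
  ultimately show ?case using x W by (intro exI[of _ "insert x W"]) auto
qed

text \<open>
  A fractional vertex cover of the arcs inside the core has weight almost \<^term>\<open>d\<close> at least.  If \<open>x\<close> and
  its copy both lie in the core, then its out- and in-neighbourhood are disjoint as there are no
  antiparallel arcs; hence the core covers almost \<^term>\<open>2 * d\<close> vertices.  The neighbours of a
  vertex of minimal weight \<^term>\<open>a\<close> weigh at least \<^term>\<open>\<mu> - a\<close>, and all others at least \<^term>\<open>a\<close>.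
\<close>

locale core =
  fixes V :: "'a set" and E :: "('a \<times> 'a) set" and C :: "('a \<times> bool) set" and d b :: real
  assumes finV: "finite V" and EV: "E \<subseteq> V \<times> V" and asym: "\<And>u v. (u, v) \<in> E \<Longrightarrow> (v, u) \<notin> E"
    and CV: "C \<subseteq> V \<times> UNIV"
    and b: "1 \<le> b" "4 * b \<le> d"
    and Cdeg: "\<And>x. x \<in> C \<Longrightarrow> d \<le> real (card (nb E x))"
    and Csize: "d / 2 \<le> real (card C)"
    and Cleave: "ecount (nb E) C (V \<times> UNIV - C) \<le> b\<^sup>2 / 2"
begin

definition good :: "('a \<times> bool) set" where
  "good = {x \<in> C. d - b \<le> real (card (nb E x \<inter> C))}"

abbreviation "U \<equiv> fst ` C"

lemma finC: "finite C" using CV finV finite_subset by fastforce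

lemma finU: "finite U" using finC by auto

lemma finnb: "finite (nb E x)" using nb_subset[OF EV, of x] finV finite_subset by fastforce

lemma UV: "U \<subseteq> V" using CV by auto

text \<open>Each vertex of \<open>C - good\<close> sends more than \<open>b\<close> edges out of
  \<open>C\<close>, and only \<open>b\<^sup>2 / 2\<close> edges leave \<open>C\<close>.\<close>

lemma card_bad: "real (card (C - good)) \<le> b / 2"
proof -
  have "real (card (C - good)) * b = (\<Sum>x\<in>C - good. b)" by simp
  also have "\<dots> \<le> (\<Sum>x\<in>C - good. real (card (nb E x \<inter> (V \<times> UNIV - C))))"
  proof (rule sum_mono)
    fix x assume x: "x \<in> C - good"
    have "nb E x = (nb E x \<inter> C) \<union> (nb E x \<inter> (V \<times> UNIV - C))" using nb_subset[OF EV, of x] by auto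
    then have "card (nb E x) \<le> card (nb E x \<inter> C) + card (nb E x \<inter> (V \<times> UNIV - C))"
      by (metis card_Un_le)
    then show "b \<le> real (card (nb E x \<inter> (V \<times> UNIV - C)))"
      using x Cdeg[of x] unfolding good_def by auto
  qed
  also have "\<dots> \<le> ecount (nb E) C (V \<times> UNIV - C)"
    unfolding ecount_def using finC by (intro sum_mono2) auto
  also have "\<dots> \<le> b / 2 * b" using Cleave by (simp add: power2_eq_square)
  finally show ?thesis using b by simp
qed

lemma card_fst_nb: "card (fst ` (nb E x \<inter> S)) = card (nb E x \<inter> S)"
  by (rule card_image) (rule inj_on_subset[OF inj_on_fst_nb], auto)

lemma good_exists:
  assumes "x \<in> good" shows "\<exists>z\<in>good. z \<in> nb E x"
proof (rule ccontr)
  assume "\<not> ?thesis"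
  then have "nb E x \<inter> C \<subseteq> C - good" by auto
  then have "card (nb E x \<inter> C) \<le> card (C - good)" using finC by (intro card_mono) auto
  then show False using assms card_bad b unfolding good_def by auto
qed

lemma card_U: "2 * d - 3 * b \<le> real (card U)"
proof (cases "\<exists>v. (v, True) \<in> good \<and> (v, False) \<in> good")
  case True
  then obtain v where v: "(v, True) \<in> good" "(v, False) \<in> good" by auto
  let ?A = "fst ` (nb E (v, True) \<inter> C)" and ?B = "fst ` (nb E (v, False) \<inter> C)"
  have "?A \<inter> ?B = {}" using asym by auto
  then have "card (?A \<union> ?B) = card ?A + card ?B" using finnb by (intro card_Un_disjoint) auto
  moreover have "card (?A \<union> ?B) \<le> card U" using finU by (intro card_mono) auto
  ultimately show ?thesis using v b unfolding good_def card_fst_nb by auto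
next
  case False
  \<comment> \<open>When no vertex has two good copies, each vertex of \<open>X \<inter> Y\<close>
    has a bad one, so the two sides overlap in at most \<open>b / 2\<close> vertices. A good vertex
    and a good neighbour of it lie on opposite sides and force each side to have
    \<open>d - b\<close> vertices.\<close>
  define X where "X = {v. (v, True) \<in> C}"
  define Y where "Y = {v. (v, False) \<in> C}"
  have X_nb: "fst ` (nb E x \<inter> C) \<subseteq> (if snd x then Y else X)" for x
    unfolding X_def Y_def by (cases x) (auto split: if_splits simp: nb_def)
  have "X \<subseteq> U" "Y \<subseteq> U" unfolding X_def Y_def by force+
  then have fin: "finite X" "finite Y" using finU finite_subset by blast+
  have "U \<subseteq> X \<union> Y"
  proof
    fix u assume "u \<in> U"
    then obtain s where "(u, s) \<in> C" by force
    then show "u \<in> X \<union> Y" unfolding X_def Y_def by (cases s) auto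
  qed
  then have UXY: "U = X \<union> Y" using \<open>X \<subseteq> U\<close> \<open>Y \<subseteq> U\<close> by auto
  have "C - good \<noteq> C" using Csize card_bad b by auto
  then obtain x where x: "x \<in> good" by auto
  then obtain z where z: "z \<in> good" "z \<in> nb E x" using good_exists[OF x] by blast
  have XY: "d - b \<le> real (card (if snd x then Y else X))" if "x \<in> good" for x
    using that card_mono[OF _ X_nb[of x]] fin unfolding good_def card_fst_nb by (auto split: if_splits)
  have cXY: "d - b \<le> real (card X)" "d - b \<le> real (card Y)"
    using XY[OF x] XY[OF z(1)] nb_snd[OF z(2)] by (auto split: if_splits)
  have "X \<inter> Y \<subseteq> fst ` (C - good)"
  proof
    fix v assume "v \<in> X \<inter> Y"
    then have "(v, True) \<in> C - good \<or> (v, False) \<in> C - good" using False unfolding X_def Y_def by auto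
    then show "v \<in> fst ` (C - good)" by force
  qed
  then have "card (X \<inter> Y) \<le> card (fst ` (C - good))" using finC by (intro card_mono) auto
  also have "\<dots> \<le> card (C - good)" using finC by (intro card_image_le) auto
  finally have "real (card (X \<inter> Y)) \<le> b / 2" using card_bad by linarith
  moreover have "card X + card Y = card U + card (X \<inter> Y)" unfolding UXY using fin by (rule card_Un_Int)
  ultimately show ?thesis using cXY b by linarith
qed

lemma light_dense_pair:
  fixes y :: "'a \<Rightarrow> real"
  assumes y0: "\<And>v. 0 \<le> y v" and \<mu>: "0 < \<mu>" and light: "(\<Sum>v\<in>V. y v) \<le> (d - 4 * b) * \<mu>"
  shows "\<exists>P Q. P \<times> {True} \<subseteq> C \<and> Q \<times> {False} \<subseteq> C \<and> (\<forall>p\<in>P. \<forall>q\<in>Q. y p + y q \<le> \<mu>)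
     \<and> b\<^sup>2 / 4 \<le> acount E P Q"
proof -
  \<comment> \<open>A single lightest vertex would only yield linearly many arcs. The
    \<open>h\<close> lightest ones, with \<open>h\<close> about \<open>b\<close>, yield
    quadratically many; the largest weight \<open>a\<close> among them takes over the part of the
    minimum.\<close>
  define h where "h = nat \<lceil>b\<rceil>"
  have h: "b \<le> real h" "real h \<le> b + 1" unfolding h_def using b by linarith+
  have hU: "real h \<le> real (card U)" using card_U b h by linarith
  obtain W where W: "W \<subseteq> U" "card W = h" "\<forall>u\<in>W. \<forall>v\<in>U - W. y u \<le> y v"
    using exists_low_subset[OF finU, of h y] hU by auto
  have finW: "finite W" using W finU finite_subset by auto
  define a where "a = Max (y ` W)"
  have "W \<noteq> {}" using W(2) h b by auto
  then have "a \<in> y ` W" unfolding a_def using finW by (intro Max_in) auto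
  then have a0: "0 \<le> a" and out: "\<And>v. v \<in> U - W \<Longrightarrow> a \<le> y v" using y0 W(3) by auto
  have aW: "y u \<le> a" if "u \<in> W" for u using that finW unfolding a_def by auto
  have "(\<Sum>v\<in>U. y v) \<le> (\<Sum>v\<in>V. y v)" using finV UV y0 by (intro sum_mono2)
  then have sumU: "(\<Sum>v\<in>U. y v) \<le> (d - 4 * b) * \<mu>" using light by linarith
  have cUW: "real (card (U - W)) = real (card U) - real h"
    using W finW hU by (simp add: card_Diff_subset of_nat_diff)
  \<comment> \<open>Otherwise the vertices of \<open>U - W\<close>, at least
    \<open>2 * d - 4 * b - 1\<close> many, would already weigh more than
    \<open>(d - 4 * b) * \<mu>\<close>.\<close>
  have a\<mu>: "a \<le> \<mu> / 2"
  proof (rule ccontr)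
    assume a: "\<not> ?thesis"
    have "(2 * d - 4 * b - 1) * (\<mu> / 2) \<le> real (card (U - W)) * a"
      using card_U cUW h a \<mu> b by (intro mult_mono) auto
    also have "\<dots> = (\<Sum>v\<in>U - W. a)" by simp
    also have "\<dots> \<le> (\<Sum>v\<in>U - W. y v)" using out by (intro sum_mono)
    also have "\<dots> \<le> (\<Sum>v\<in>U. y v)" using finU y0 by (intro sum_mono2) auto
    finally have "(d - 2 * b - 1/2) * \<mu> \<le> (d - 4 * b) * \<mu>" using sumU by (simp add: algebra_simps)
    then show False using \<mu> b by simp
  qed
  define Z where "Z = {v. y v \<le> \<mu> - a}"
  \<comment> \<open>If fewer than \<open>b\<close> core neighbours of \<open>x\<close> were in
    \<open>Z\<close>, then at least \<open>d - 2 * b\<close> vertices would weigh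
    \<open>\<mu> - a\<close> or more, and all others outside \<open>W\<close> at least
    \<open>a\<close>. The terms in \<open>a\<close> cancel up to a single \<open>a\<close>, and the
    total exceeds \<open>(d - 4 * b) * \<mu>\<close>.\<close>
  have rich: "b \<le> real (card (nb E x \<inter> C \<inter> {z. fst z \<in> Z}))" if x: "x \<in> good" for x
  proof (rule ccontr)
    assume poor: "\<not> ?thesis"
    define N where "N = fst ` (nb E x \<inter> (C \<inter> {z. fst z \<notin> Z}))"
    have NU: "N \<subseteq> U" unfolding N_def by auto
    have finN: "finite N" using NU finU finite_subset by auto
    have "nb E x \<inter> C = (nb E x \<inter> C \<inter> {z. fst z \<in> Z}) \<union> (nb E x \<inter> (C \<inter> {z. fst z \<notin> Z}))" by auto
    then have "card (nb E x \<inter> C) \<le> card (nb E x \<inter> C \<inter> {z. fst z \<in> Z}) + card (nb E x \<inter> (C \<inter> {z. fst z \<notin> Z}))"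
      by (metis card_Un_le)
    then have cN: "d - 2 * b \<le> real (card N)"
      unfolding N_def card_fst_nb using poor x unfolding good_def by auto
    have N\<mu>: "\<mu> - a \<le> y v" if "v \<in> N" for v using that unfolding N_def Z_def by auto
    define R where "R = U - N - W"
    have "real (card U) \<le> real (card N) + real (card W) + real (card R)"
    proof -
      have "U \<subseteq> N \<union> W \<union> R" unfolding R_def by auto
      then have "card U \<le> card (N \<union> W \<union> R)" using finN finW finU R_def by (intro card_mono) auto
      also have "\<dots> \<le> card N + card W + card R" by (meson card_Un_le add_le_mono order_refl order_trans)
      finally show ?thesis by linarith
    qed
    then have cR: "real (card U) - real (card N) - real h \<le> real (card R)" using W by simp
    have "(d - 2 * b) * (\<mu> - 2 * a) \<le> real (card N) * (\<mu> - 2 * a)"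
      using cN a\<mu> by (intro mult_right_mono) auto
    moreover have "(2 * d - 4 * b - 1) * a \<le> (real (card U) - real h) * a"
      using card_U h a0 by (intro mult_right_mono) auto
    moreover have "(real (card U) - real (card N) - real h) * a \<le> real (card R) * a"
      using cR a0 by (intro mult_right_mono)
    moreover have "(\<Sum>v\<in>N. \<mu> - a) \<le> (\<Sum>v\<in>N. y v)" using N\<mu> by (rule sum_mono)
    moreover have "(\<Sum>v\<in>R. a) \<le> (\<Sum>v\<in>R. y v)" using out unfolding R_def by (intro sum_mono) auto
    moreover have "(\<Sum>v\<in>N. y v) + (\<Sum>v\<in>R. y v) \<le> (\<Sum>v\<in>U. y v)"
    proof -
      have "(\<Sum>v\<in>N. y v) + (\<Sum>v\<in>R. y v) = (\<Sum>v\<in>N \<union> R. y v)"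
        by (rule sum.union_disjoint[symmetric]) (use finN finU R_def in auto)
      also have "\<dots> \<le> (\<Sum>v\<in>U. y v)" using finU NU y0 unfolding R_def by (intro sum_mono2) auto
      finally show ?thesis .
    qed
    ultimately have "(d - 2 * b) * (\<mu> - 2 * a) + (2 * d - 4 * b - 1) * a \<le> (d - 4 * b) * \<mu>"
      using sumU by (simp add: algebra_simps)
    then have "2 * b * \<mu> \<le> a" by (simp add: algebra_simps)
    moreover have "2 * \<mu> \<le> 2 * b * \<mu>" using b \<mu> by simp
    ultimately show False using a\<mu> \<mu> by linarith
  qed
  \<comment> \<open>At most \<open>b / 2\<close> vertices of \<open>W\<close> have no good copy, so
    on one side there are \<open>b / 4\<close> good copies of vertices of \<open>W\<close>, each
    with \<open>b\<close> neighbours that are light enough; this gives \<open>b\<^sup>2 / 4\<close>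
    arcs.\<close>
  define G1 where "G1 = {u \<in> W. (u, True) \<in> good}"
  define G2 where "G2 = {u \<in> W. (u, False) \<in> good}"
  have finG: "finite G1" "finite G2" unfolding G1_def G2_def using finW by auto
  have "W \<subseteq> G1 \<union> G2 \<union> fst ` (C - good)"
  proof
    fix u assume u: "u \<in> W"
    then obtain s where "(u, s) \<in> C" using W by force
    then show "u \<in> G1 \<union> G2 \<union> fst ` (C - good)"
      using u unfolding G1_def G2_def by (cases s) (force simp: image_iff)+
  qed
  then have "card W \<le> card (G1 \<union> G2 \<union> fst ` (C - good))" using finG finC by (intro card_mono) auto
  also have "\<dots> \<le> card G1 + card G2 + card (fst ` (C - good))"
    by (meson card_Un_le add_le_mono order_refl order_trans)
  also have "card (fst ` (C - good)) \<le> card (C - good)" using finC by (intro card_image_le) auto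
  finally have "b / 2 \<le> real (card G1) + real (card G2)" using W h card_bad by linarith
  then consider "b / 4 \<le> real (card G1)" | "b / 4 \<le> real (card G2)" by linarith
  then show ?thesis
  proof cases
    case 1
    define Q where "Q = {v. (v, False) \<in> C \<and> v \<in> Z}"
    have QU: "Q \<subseteq> U" unfolding Q_def by force
    have finQ: "finite Q" using QU finU finite_subset by auto
    have "b\<^sup>2 / 4 = b / 4 * b" by (simp add: power2_eq_square)
    also have "\<dots> \<le> real (card G1) * b" using 1 b by (intro mult_right_mono) auto
    also have "\<dots> = (\<Sum>u\<in>G1. b)" by simp
    also have "\<dots> \<le> (\<Sum>u\<in>G1. real (card {v\<in>Q. (v, u) \<in> E\<inverse>}))"
    proof (rule sum_mono)
      fix u assume "u \<in> G1"
      then have "b \<le> real (card (fst ` (nb E (u, True) \<inter> (C \<inter> {z. fst z \<in> Z}))))"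
        unfolding card_fst_nb using rich[of "(u, True)"] unfolding G1_def by (simp add: Int_assoc)
      also have "fst ` (nb E (u, True) \<inter> (C \<inter> {z. fst z \<in> Z})) = {v\<in>Q. (v, u) \<in> E\<inverse>}"
        unfolding Q_def by (auto, rule_tac x = "(x, False)" in image_eqI, auto)
      finally show "b \<le> real (card {v\<in>Q. (v, u) \<in> E\<inverse>})" .
    qed
    also have "\<dots> = acount E G1 Q" by (simp only: acount_eq_sum[OF finQ finG(1), symmetric] acount_converse)
    finally have "b\<^sup>2 / 4 \<le> acount E G1 Q" .
    moreover have "y p + y q \<le> \<mu>" if "p \<in> G1" "q \<in> Q" for p q
      using that aW[of p] unfolding G1_def Q_def Z_def by auto
    ultimately show ?thesis unfolding G1_def Q_def good_def
      by (intro exI[of _ G1] exI[of _ Q]) (auto simp: G1_def Q_def good_def)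
  next
    case 2
    define P where "P = {v. (v, True) \<in> C \<and> v \<in> Z}"
    have PU: "P \<subseteq> U" unfolding P_def by force
    have finP: "finite P" using PU finU finite_subset by auto
    have "b\<^sup>2 / 4 = b / 4 * b" by (simp add: power2_eq_square)
    also have "\<dots> \<le> real (card G2) * b" using 2 b by (intro mult_right_mono) auto
    also have "\<dots> = (\<Sum>u\<in>G2. b)" by simp
    also have "\<dots> \<le> (\<Sum>u\<in>G2. real (card {v\<in>P. (v, u) \<in> E}))"
    proof (rule sum_mono)
      fix u assume "u \<in> G2"
      then have "b \<le> real (card (fst ` (nb E (u, False) \<inter> (C \<inter> {z. fst z \<in> Z}))))"
        unfolding card_fst_nb using rich[of "(u, False)"] unfolding G2_def by (simp add: Int_assoc)
      also have "fst ` (nb E (u, False) \<inter> (C \<inter> {z. fst z \<in> Z})) = {v\<in>P. (v, u) \<in> E}"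
        unfolding P_def by (auto, rule_tac x = "(x, True)" in image_eqI, auto)
      finally show "b \<le> real (card {v\<in>P. (v, u) \<in> E})" .
    qed
    also have "\<dots> = acount E P G2" by (simp add: acount_eq_sum[OF finP finG(2), symmetric])
    finally have "b\<^sup>2 / 4 \<le> acount E P G2" .
    moreover have "y p + y q \<le> \<mu>" if "p \<in> P" "q \<in> G2" for p q
      using that aW[of q] unfolding G2_def P_def Z_def by auto
    ultimately show ?thesis
      by (intro exI[of _ P] exI[of _ G2]) (auto simp: G2_def P_def good_def)
  qed
qed

end

section \<open>Fractional matchings by regular pairs\<close>

definition cover_count :: "('a set \<times> 'a set) list \<Rightarrow> 'a \<Rightarrow> real" where
  "cover_count ps v = (\<Sum>(P, Q)\<leftarrow>ps. of_bool (v \<in> P) + of_bool (v \<in> Q))"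

text \<open>One side suffices because the pairs in use have sides of equal size; the loads of all
  vertices then sum to twice this value.\<close>

definition cover_size :: "('a set \<times> 'a set) list \<Rightarrow> real" where
  "cover_size ps = (\<Sum>(P, Q)\<leftarrow>ps. real (card P))"

lemma pos_part_square_le: "(max 0 (s + u))\<^sup>2 \<le> (max 0 s + u)\<^sup>2" for s u :: real
proof (cases "s + u \<le> 0")
  case True
  then show ?thesis by simp
next
  case False
  then show ?thesis by (intro power_mono) auto
qed

text \<open>\<open>cover_size ps / d\<close> is the target load of a vertex: if pairs of total size
  \<open>q * d\<close> cover every vertex at most \<open>q\<close> times, then scaling by
  \<open>1 / q\<close> gives a fractional matching of weight \<open>d\<close>.\<close>

definition excess :: "real \<Rightarrow> ('a set \<times> 'a set) list \<Rightarrow> 'a \<Rightarrow> real" where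
  "excess d ps v = max 0 (cover_count ps v - cover_size ps / d)"

text \<open>
  Blackwell's approachability argument: the new pair is chosen to have nonpositive inner product with
  the current excess, so that the squared norm of the excess only grows linearly.
\<close>

lemma excess_step:
  fixes d :: real
  assumes V: "finite V" "P \<subseteq> V" "Q \<subseteq> V" "card P = card Q" and d: "0 < d"
    and light: "\<And>p q. p \<in> P \<Longrightarrow> q \<in> Q \<Longrightarrow>
      excess d ps p + excess d ps q \<le> (\<Sum>v\<in>V. excess d ps v) / d"
  shows "(\<Sum>v\<in>V. (excess d ((P, Q) # ps) v)\<^sup>2) \<le> (\<Sum>v\<in>V. (excess d ps v)\<^sup>2)
     + (4 + (real (card V))\<^sup>2 / d\<^sup>2) * real (card P)"
proof -
  define y where "y = excess d ps"
  define p where "p = real (card P)"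
  define s where "s v = (of_bool (v \<in> P) + of_bool (v \<in> Q) :: real)" for v
  have fin: "finite P" "finite Q" using V finite_subset by blast+
  have y0: "0 \<le> y v" for v by (simp add: y_def excess_def)
  have step: "excess d ((P, Q) # ps) v = max 0 ((cover_count ps v - cover_size ps / d) + (s v - p / d))" for v
    by (simp add: excess_def cover_count_def cover_size_def s_def p_def algebra_simps add_divide_distrib)
  have sumP: "(\<Sum>v\<in>V. f v * of_bool (v \<in> P)) = sum f P" for f :: "'a \<Rightarrow> real"
    using V by (simp add: of_bool_def if_distrib sum.If_cases Int_absorb1 cong: if_cong)
  have sumQ: "(\<Sum>v\<in>V. f v * of_bool (v \<in> Q)) = sum f Q" for f :: "'a \<Rightarrow> real"
    using V by (simp add: of_bool_def if_distrib sum.If_cases Int_absorb1 cong: if_cong)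
  \<comment> \<open>Matching the vertices of \<open>P\<close> with those of \<open>Q\<close> turns
    the bound on \<open>excess d ps p + excess d ps q\<close> into one on the inner product of the
    excess with the new load.\<close>
  obtain h where h: "bij_betw h P Q" using V(4) fin by (metis finite_same_card_bij)
  have "sum y Q = (\<Sum>v\<in>P. y (h v))" using h by (metis sum.reindex_bij_betw)
  then have "sum y P + sum y Q = (\<Sum>v\<in>P. y v + y (h v))" by (simp add: sum.distrib)
  also have "\<dots> \<le> (\<Sum>v\<in>P. sum y V / d)"
    using h light unfolding y_def by (intro sum_mono) (auto simp: bij_betw_def)
  finally have inner: "sum y P + sum y Q \<le> p * (sum y V / d)" by (simp add: p_def)
  have "(\<Sum>v\<in>V. (excess d ((P, Q) # ps) v)\<^sup>2) \<le> (\<Sum>v\<in>V. (y v + (s v - p / d))\<^sup>2)"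
  proof (rule sum_mono)
    fix v
    have "y v = max 0 (cover_count ps v - cover_size ps / d)" by (simp add: y_def excess_def)
    then show "(excess d ((P, Q) # ps) v)\<^sup>2 \<le> (y v + (s v - p / d))\<^sup>2"
      by (simp only: step pos_part_square_le)
  qed
  \<comment> \<open>\<open>P\<close> and \<open>Q\<close> may overlap here, so \<open>s v\<close>
    can be 2; hence the factor 2 in the bound on \<open>(s v)\<^sup>2\<close>.\<close>
  also have "\<dots> \<le> (\<Sum>v\<in>V. (y v)\<^sup>2 + 2 * (y v * s v - y v * (p / d))
      + (2 * (of_bool (v \<in> P) + of_bool (v \<in> Q)) + (p / d)\<^sup>2))"
  proof (rule sum_mono)
    fix v
    have "0 \<le> s v * (p / d)" unfolding s_def p_def using d by simp
    moreover have "(s v)\<^sup>2 \<le> 2 * (of_bool (v \<in> P) + of_bool (v \<in> Q))"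
      unfolding s_def by (auto simp: of_bool_def power2_eq_square)
    moreover have "(y v + (s v - p / d))\<^sup>2 = (y v)\<^sup>2 + 2 * (y v * s v - y v * (p / d))
        + ((s v)\<^sup>2 - 2 * (s v * (p / d)) + (p / d)\<^sup>2)"
      by (simp add: power2_eq_square algebra_simps)
    ultimately show "(y v + (s v - p / d))\<^sup>2 \<le> (y v)\<^sup>2 + 2 * (y v * s v - y v * (p / d))
      + (2 * (of_bool (v \<in> P) + of_bool (v \<in> Q)) + (p / d)\<^sup>2)" by linarith
  qed
  also have "\<dots> = (\<Sum>v\<in>V. (y v)\<^sup>2) + 2 * (sum y P + sum y Q - p * (sum y V / d))
      + (2 * (p + p) + real (card V) * (p / d)\<^sup>2)"
  proof -
    have "(\<Sum>v\<in>V. y v * s v) = sum y P + sum y Q"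
      unfolding s_def by (simp add: distrib_left sum.distrib sumP sumQ)
    moreover have "(\<Sum>v\<in>V. y v * (p / d)) = p * (sum y V / d)"
      by (simp only: sum_distrib_right[symmetric]) simp
    moreover have "(\<Sum>v\<in>V. of_bool (v \<in> P) :: real) = p"
      using sumP[of "\<lambda>_. 1"] by (simp add: p_def)
    moreover have "(\<Sum>v\<in>V. of_bool (v \<in> Q) :: real) = p"
      using sumQ[of "\<lambda>_. 1"] V by (simp add: p_def)
    ultimately show ?thesis
      by (simp only: sum.distrib sum_subtractf sum_distrib_left[symmetric] sum_constant)
  qed
  also have "real (card V) * (p / d)\<^sup>2 \<le> (real (card V))\<^sup>2 / d\<^sup>2 * p"
  proof -
    have "p \<le> real (card V)" unfolding p_def using V by (auto intro!: card_mono)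
    then have "p * p \<le> real (card V) * p" unfolding p_def by (intro mult_right_mono) auto
    then have "real (card V) * (p * p) \<le> real (card V) * (real (card V) * p)"
      by (intro mult_left_mono) auto
    then have "real (card V) * (p * p) / d\<^sup>2 \<le> real (card V) * (real (card V) * p) / d\<^sup>2"
      by (intro divide_right_mono) auto
    then show ?thesis by (simp add: power2_eq_square algebra_simps)
  qed
  finally have "(\<Sum>v\<in>V. (excess d ((P, Q) # ps) v)\<^sup>2) \<le> (\<Sum>v\<in>V. (y v)\<^sup>2)
      + 2 * (sum y P + sum y Q - p * (sum y V / d)) + (2 * (p + p) + (real (card V))\<^sup>2 / d\<^sup>2 * p)" by simp
  moreover have "(4 + (real (card V))\<^sup>2 / d\<^sup>2) * p = 2 * (p + p) + (real (card V))\<^sup>2 / d\<^sup>2 * p"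
    by (simp add: distrib_right)
  ultimately have "(\<Sum>v\<in>V. (excess d ((P, Q) # ps) v)\<^sup>2) \<le> (\<Sum>v\<in>V. (y v)\<^sup>2)
      + 2 * (sum y P + sum y Q - p * (sum y V / d)) + (4 + (real (card V))\<^sup>2 / d\<^sup>2) * p" by presburger
  moreover have "2 * (sum y P + sum y Q - p * (sum y V / d)) \<le> 0" using inner by simp
  ultimately have "(\<Sum>v\<in>V. (excess d ((P, Q) # ps) v)\<^sup>2) \<le> (\<Sum>v\<in>V. (y v)\<^sup>2)
      + (4 + (real (card V))\<^sup>2 / d\<^sup>2) * p" by (smt (verit))
  then show ?thesis unfolding y_def p_def .
qed

lemma sum_le_sqrt_card_mult:
  fixes y :: "'a \<Rightarrow> real"
  assumes "finite V"
  shows "(\<Sum>v\<in>V. y v) \<le> sqrt (real (card V) * (\<Sum>v\<in>V. (y v)\<^sup>2))"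
proof (rule real_le_rsqrt)
  show "(\<Sum>v\<in>V. y v)\<^sup>2 \<le> real (card V) * (\<Sum>v\<in>V. (y v)\<^sup>2)"
    using sum_squared_le_sum_of_squares[of y V] by (simp add: mult.commute)
qed

text \<open>Pairs are added until their total size reaches \<open>q * d\<close>. The squared norm of
  the excess is then linear in \<open>q\<close>, so by Cauchy-Schwarz the total overload beyond
  \<open>q\<close> grows only like \<open>sqrt q\<close> and is negligible relative to
  \<open>q\<close>. The hypothesis \<open>dual\<close> finds a pair that a weighting of small total
  leaves light; it is applied to the excess itself.\<close>

lemma fractional_matching:
  fixes d \<sigma> :: real and q :: nat
  assumes V: "finite V" "V \<noteq> {}" and d: "0 < d" and \<sigma>: "0 < \<sigma>"
    and good: "\<And>P Q. good P Q \<Longrightarrow> P \<subseteq> V \<and> Q \<subseteq> V \<and> card P = card Q \<and> \<sigma> * real (card V) \<le> real (card P)"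
    and dual: "\<And>y \<mu>. (\<And>v. 0 \<le> y v) \<Longrightarrow> 0 < \<mu> \<Longrightarrow> (\<Sum>v\<in>V. y v) \<le> d * \<mu> \<Longrightarrow>
       \<exists>P Q. good P Q \<and> (\<forall>p\<in>P. \<forall>q\<in>Q. y p + y q \<le> \<mu>)"
  shows "\<exists>ps. (\<forall>(P, Q)\<in>set ps. good P Q) \<and>
     real q * d \<le> cover_size ps \<and> cover_size ps \<le> real q * d + real (card V) \<and>
     (\<Sum>v\<in>V. max 0 (cover_count ps v - real q)) \<le> real (card V) * (real (card V) / d)
        + sqrt (real (card V) * ((4 + (real (card V))\<^sup>2 / d\<^sup>2) * (real q * d + real (card V))))"
proof -
  define K where "K = 4 + (real (card V))\<^sup>2 / d\<^sup>2"
  have K0: "0 \<le> K" unfolding K_def by simp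
  have nV: "0 < real (card V)" using V by (simp add: card_gt_0_iff)
  \<comment> \<open>\<open>m\<close> is a bound on progress: each added pair contributes at least
    \<open>\<sigma> * card V\<close>, so the size \<open>q * d\<close> is reached for large
    \<open>m\<close>.\<close>
  have build: "\<exists>ps. (\<forall>(P, Q)\<in>set ps. good P Q) \<and> cover_size ps \<le> real q * d + real (card V) \<and>
      (\<Sum>v\<in>V. (excess d ps v)\<^sup>2) \<le> K * cover_size ps \<and>
      (real q * d \<le> cover_size ps \<or> real m * (\<sigma> * real (card V)) \<le> cover_size ps)" for m
  proof (induction m)
    case 0
    then show ?case using d
      by (intro exI[of _ "[]"]) (simp add: cover_size_def excess_def cover_count_def)
  next
    case (Suc m)
    then obtain ps where ps: "\<forall>(P, Q)\<in>set ps. good P Q" "cover_size ps \<le> real q * d + real (card V)"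
      "(\<Sum>v\<in>V. (excess d ps v)\<^sup>2) \<le> K * cover_size ps"
      "real q * d \<le> cover_size ps \<or> real m * (\<sigma> * real (card V)) \<le> cover_size ps" by blast
    show ?case
    proof (cases "real q * d \<le> cover_size ps")
      case True
      then show ?thesis using ps by blast
    next
      case False
      then have small: "cover_size ps < real q * d" "real m * (\<sigma> * real (card V)) \<le> cover_size ps"
        using ps(4) by auto
      have y0: "0 \<le> excess d ps v" for v by (simp add: excess_def)
      obtain P Q where PQ: "good P Q" and light: "\<And>x z. x \<in> P \<Longrightarrow> z \<in> Q \<Longrightarrow>
          excess d ps x + excess d ps z \<le> (\<Sum>v\<in>V. excess d ps v) / d"
      proof (cases "(\<Sum>v\<in>V. excess d ps v) = 0")
        case True
        then have z: "excess d ps v = 0" if "v \<in> V" for v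
          using that V y0 by (simp add: sum_nonneg_eq_0_iff)
        \<comment> \<open>With zero excess the level \<open>\<mu>\<close> would be 0, which
          \<open>dual\<close> excludes; here any good pair will do.\<close>
        obtain P Q where PQ: "good P Q" using dual[of "\<lambda>_. 0" 1] d by auto
        then show ?thesis using that[of P Q] good[OF PQ] z True by (metis add_0 div_0 order_refl subsetD)
      next
        case False
        then have "0 < (\<Sum>v\<in>V. excess d ps v)" using y0 by (simp add: sum_nonneg order_less_le)
        then obtain P Q where "good P Q"
          "\<forall>x\<in>P. \<forall>z\<in>Q. excess d ps x + excess d ps z \<le> (\<Sum>v\<in>V. excess d ps v) / d"
          using dual[of "excess d ps" "(\<Sum>v\<in>V. excess d ps v) / d"] y0 d by auto
        then show ?thesis using that by blast
      qed
      have sub: "P \<subseteq> V" "Q \<subseteq> V" "card P = card Q" "\<sigma> * real (card V) \<le> real (card P)"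
        using good[OF PQ] by auto
      have cs: "cover_size ((P, Q) # ps) = real (card P) + cover_size ps"
        by (simp add: cover_size_def)
      have cP: "real (card P) \<le> real (card V)" using sub V by (auto intro!: card_mono)
      have "(\<Sum>v\<in>V. (excess d ((P, Q) # ps) v)\<^sup>2) \<le> (\<Sum>v\<in>V. (excess d ps v)\<^sup>2) + K * real (card P)"
        unfolding K_def by (rule excess_step[OF V(1) sub(1-3) d light])
      also have "\<dots> \<le> K * cover_size ((P, Q) # ps)" using ps(3) cs by (simp add: algebra_simps)
      finally have "(\<Sum>v\<in>V. (excess d ((P, Q) # ps) v)\<^sup>2) \<le> K * cover_size ((P, Q) # ps)" .
      moreover have "real (Suc m) * (\<sigma> * real (card V)) \<le> cover_size ((P, Q) # ps)"
        using small(2) sub(4) cs by (simp add: algebra_simps)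
      ultimately show ?thesis using ps(1) PQ cs cP small(1)
        by (intro exI[of _ "(P, Q) # ps"]) auto
    qed
  qed
  obtain m :: nat where m: "real q * d < real m * (\<sigma> * real (card V))"
    using reals_Archimedean3[of "\<sigma> * real (card V)"] \<sigma> nV by (metis mult_pos_pos)
  obtain ps where ps: "\<forall>(P, Q)\<in>set ps. good P Q" "cover_size ps \<le> real q * d + real (card V)"
      "(\<Sum>v\<in>V. (excess d ps v)\<^sup>2) \<le> K * cover_size ps"
      "real q * d \<le> cover_size ps" using build[of m] m by force
  have "(\<Sum>v\<in>V. max 0 (cover_count ps v - real q)) \<le> (\<Sum>v\<in>V. real (card V) / d + excess d ps v)"
  proof (rule sum_mono)
    fix v
    \<comment> \<open>The last pair may overshoot \<open>q * d\<close> by up to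
      \<open>card V\<close>.\<close>
    have "cover_size ps / d - real q \<le> real (card V) / d"
      using divide_right_mono[OF ps(2), of d] d by (simp add: add_divide_distrib)
    moreover have "0 \<le> real (card V) / d" using d by simp
    ultimately show "max 0 (cover_count ps v - real q) \<le> real (card V) / d + excess d ps v"
      unfolding excess_def by linarith
  qed
  also have "\<dots> = real (card V) * (real (card V) / d) + (\<Sum>v\<in>V. excess d ps v)"
    by (simp add: sum.distrib)
  also have "(\<Sum>v\<in>V. excess d ps v) \<le> sqrt (real (card V) * (\<Sum>v\<in>V. (excess d ps v)\<^sup>2))"
    by (rule sum_le_sqrt_card_mult[OF V(1)])
  also have "\<dots> \<le> sqrt (real (card V) * (K * (real q * d + real (card V))))"
    using ps(2,3) K0 by (intro real_sqrt_le_mono mult_left_mono order_trans[OF ps(3)]) auto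
  finally show ?thesis using ps(1,2,4) unfolding K_def by (intro exI[of _ ps]) auto
qed

section \<open>Rounding a fractional matching to disjoint pairs\<close>

lemma exists_disjoint_subsets:
  assumes "finite I" "card I * s \<le> card V" "finite V"
  shows "\<exists>f. (\<forall>i\<in>I. f i \<subseteq> V \<and> card (f i) = s) \<and> disjoint_family_on f I"
  using assms
proof (induction I arbitrary: V rule: finite_induct)
  case empty
  then show ?case by (auto simp: disjoint_family_on_def)
next
  case (insert x I)
  then have le: "s + card I * s \<le> card V" by simp
  then obtain A where A: "A \<subseteq> V" "card A = s" by (metis add_leD1 obtain_subset_with_card_n)
  have finA: "finite A" using A insert.prems finite_subset by auto
  have "card I * s \<le> card (V - A)" using le A finA by (simp add: card_Diff_subset)
  then obtain f where f: "\<forall>i\<in>I. f i \<subseteq> V - A \<and> card (f i) = s" "disjoint_family_on f I"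
    using insert.IH[of "V - A"] insert.prems by auto
  define g where "g = f(x := A)"
  have "\<forall>i\<in>insert x I. g i \<subseteq> V \<and> card (g i) = s" using f A unfolding g_def by auto
  moreover have "disjoint_family_on g (insert x I)"
    unfolding disjoint_family_on_def
  proof (intro ballI impI)
    fix a b assume ab: "a \<in> insert x I" "b \<in> insert x I" "a \<noteq> b"
    have fA: "f i \<inter> A = {}" if "i \<in> I" for i using f(1) that by blast
    consider "a = x" "b \<in> I" "b \<noteq> x" | "b = x" "a \<in> I" "a \<noteq> x" | "a \<in> I" "b \<in> I" "a \<noteq> x" "b \<noteq> x"
      using ab by auto
    then show "g a \<inter> g b = {}"
    proof cases
      case 1
      then show ?thesis using fA[of b] by (simp add: g_def Int_commute)
    next
      case 2
      then show ?thesis using fA[of a] by (simp add: g_def)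
    next
      case 3
      then show ?thesis using f(2) ab(3) by (simp add: g_def disjoint_family_on_def)
    qed
  qed
  ultimately show ?case by blast
qed

text \<open>Each vertex keeps at most \<open>q\<close> of the indices whose set contains it, and the
  vertices are grouped by the kept set \<open>K\<close>. Each index of \<open>K\<close> receives its
  own \<open>q\<close>-th part of the group, which is possible as \<open>K\<close> has at most
  \<open>q\<close> elements. Rounding costs less than one vertex per group, whence
  \<open>2 ^ card I\<close>; \<open>loss i\<close> counts the vertices that dropped the index
  \<open>i\<close>.\<close>

lemma disjoint_selection:
  fixes Z :: "'i \<Rightarrow> 'a set" and q :: nat
  assumes I: "finite I" and V: "finite V" and Z: "\<And>i. i \<in> I \<Longrightarrow> Z i \<subseteq> V" and q: "0 < q"
  shows "\<exists>Z' loss. (\<forall>i\<in>I. Z' i \<subseteq> Z i) \<and> disjoint_family_on Z' I \<and>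
    (\<forall>i\<in>I. 0 \<le> loss i \<and> (real (card (Z i)) - loss i) / real q - 2 ^ card I \<le> real (card (Z' i))) \<and>
    (\<Sum>i\<in>I. loss i) = (\<Sum>v\<in>V. max 0 (real (card {i\<in>I. v \<in> Z i}) - real q))"
proof -
  define L where "L v = {i\<in>I. v \<in> Z i}" for v
  have "\<forall>K. \<exists>M. M \<subseteq> K \<and> card M = min q (card K)" for K :: "'i set"
    by (meson min.cobounded2 obtain_subset_with_card_n)
  then have "\<forall>K :: 'i set. \<exists>M. M \<subseteq> K \<and> card M = min q (card K)" by blast
  then obtain sub :: "'i set \<Rightarrow> 'i set" where sub: "\<And>K. sub K \<subseteq> K" "\<And>K. card (sub K) = min q (card K)"
    by metis
  have finL: "finite (L v)" for v unfolding L_def using I by auto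
  define At where "At K = {v\<in>V. sub (L v) = K}" for K
  have finAt: "finite (At K)" for K unfolding At_def using V by auto
  define \<A> where "\<A> = {K. K \<subseteq> I \<and> card K \<le> q}"
  have fin\<A>: "finite \<A>" unfolding \<A>_def using I by auto
  have subL: "sub (L v) \<in> \<A>" for v
    unfolding \<A>_def using sub[of "L v"] L_def by auto
  have "\<forall>K\<in>\<A>. \<exists>f. (\<forall>i\<in>K. f i \<subseteq> At K \<and> card (f i) = card (At K) div q) \<and> disjoint_family_on f K"
  proof
    fix K assume K: "K \<in> \<A>"
    show "\<exists>f. (\<forall>i\<in>K. f i \<subseteq> At K \<and> card (f i) = card (At K) div q) \<and> disjoint_family_on f K"
    proof (rule exists_disjoint_subsets)
      show "finite K" using K I finite_subset unfolding \<A>_def by auto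
      have "card K * (card (At K) div q) \<le> q * (card (At K) div q)"
        using K unfolding \<A>_def by auto
      then show "card K * (card (At K) div q) \<le> card (At K)"
        by (meson order_trans times_div_less_eq_dividend)
    qed (rule finAt)
  qed
  then obtain f where f: "\<And>K i. K \<in> \<A> \<Longrightarrow> i \<in> K \<Longrightarrow> f K i \<subseteq> At K"
    "\<And>K i. K \<in> \<A> \<Longrightarrow> i \<in> K \<Longrightarrow> card (f K i) = card (At K) div q"
    "\<And>K. K \<in> \<A> \<Longrightarrow> disjoint_family_on (f K) K" by metis
  define Z' where "Z' i = (\<Union>K\<in>{K\<in>\<A>. i \<in> K}. f K i)" for i
  define loss where "loss i = real (card {v\<in>V. i \<in> L v - sub (L v)})" for i
  have AtD: "At K \<inter> At K' = {}" if "K \<noteq> K'" for K K' using that unfolding At_def by auto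
  have Z'Z: "Z' i \<subseteq> Z i" if "i \<in> I" for i
  proof
    fix v assume "v \<in> Z' i"
    then obtain K where "K \<in> \<A>" "i \<in> K" "v \<in> f K i" unfolding Z'_def by auto
    then have "v \<in> At K" "i \<in> K" using f(1) by blast+
    then show "v \<in> Z i" using sub(1)[of "L v"] unfolding At_def L_def by auto
  qed
  have disj: "disjoint_family_on Z' I"
    unfolding disjoint_family_on_def
  proof (intro ballI impI)
    fix i j assume ij: "i \<in> I" "j \<in> I" "i \<noteq> j"
    show "Z' i \<inter> Z' j = {}"
    proof (rule ccontr)
      assume "Z' i \<inter> Z' j \<noteq> {}"
      then obtain v K K' where v: "K \<in> \<A>" "i \<in> K" "v \<in> f K i" "K' \<in> \<A>" "j \<in> K'" "v \<in> f K' j"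
        unfolding Z'_def by blast
      have "v \<in> At K" "v \<in> At K'" using f(1) v by blast+
      then have "K = K'" using AtD by blast
      then show False using f(3)[OF v(1)] v ij unfolding disjoint_family_on_def by blast
    qed
  qed
  have card_Z': "(real (card (Z i)) - loss i) / real q - 2 ^ card I \<le> real (card (Z' i))" if i: "i \<in> I" for i
  proof -
    let ?A = "{K\<in>\<A>. i \<in> K}"
    have finA: "finite ?A" using fin\<A> by auto
    have "card (Z' i) = (\<Sum>K\<in>?A. card (f K i))"
      unfolding Z'_def
    proof (rule card_UN_disjoint[OF finA])
      show "\<forall>K\<in>?A. finite (f K i)"
      proof
        fix K assume "K \<in> ?A"
        then show "finite (f K i)" using finite_subset[OF f(1)[of K i] finAt] by simp
      qed
      show "\<forall>K\<in>?A. \<forall>M\<in>?A. K \<noteq> M \<longrightarrow> f K i \<inter> f M i = {}"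
      proof (intro ballI impI)
        fix K M assume KM: "K \<in> ?A" "M \<in> ?A" "K \<noteq> M"
        then have "f K i \<subseteq> At K" "f M i \<subseteq> At M" by (simp_all add: f(1))
        then show "f K i \<inter> f M i = {}" using AtD[OF KM(3)] by auto
      qed
    qed
    also have "\<dots> = (\<Sum>K\<in>?A. card (At K) div q)" using f(2) by (intro sum.cong) auto
    finally have cZ': "real (card (Z' i)) = (\<Sum>K\<in>?A. real (card (At K) div q))" by simp
    have "(\<Sum>K\<in>?A. real (card (At K)) / real q - 1) \<le> (\<Sum>K\<in>?A. real (card (At K) div q))"
    proof (rule sum_mono)
      fix K
      show "real (card (At K)) / real q - 1 \<le> real (card (At K) div q)"
      proof -
        have "card (At K) < (card (At K) div q + 1) * q"
          using dividend_less_div_times[of q "card (At K)"] q by (simp add: algebra_simps)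
        then have "real (card (At K)) < real ((card (At K) div q + 1) * q)" by (simp only: of_nat_less_iff)
        then have "real (card (At K)) < (real (card (At K) div q) + 1) * real q"
          by (simp only: of_nat_mult of_nat_add of_nat_1)
        then have "real (card (At K)) / real q < real (card (At K) div q) + 1"
          using q by (simp only: pos_divide_less_eq of_nat_0_less_iff)
        then show ?thesis by linarith
      qed
    qed
    moreover have "(\<Sum>K\<in>?A. real (card (At K)) / real q - 1)
        = (\<Sum>K\<in>?A. real (card (At K))) / real q - real (card ?A)"
      by (simp add: sum_subtractf sum_divide_distrib)
    moreover have "real (card ?A) \<le> 2 ^ card I"
    proof -
      have "card ?A \<le> card (Pow I)" using I unfolding \<A>_def by (intro card_mono) auto
      then have "card ?A \<le> 2 ^ card I" using I by (simp only: card_Pow)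
      then have "real (card ?A) \<le> real (2 ^ card I)" by (simp only: of_nat_le_iff)
      then show ?thesis by simp
    qed
    moreover have "(\<Sum>K\<in>?A. real (card (At K))) / real q = (real (card (Z i)) - loss i) / real q"
    proof -
      have "(\<Sum>K\<in>?A. card (At K)) = card (\<Union>K\<in>?A. At K)"
        by (rule card_UN_disjoint[symmetric]) (use finA finAt AtD in auto)
      also have "(\<Union>K\<in>?A. At K) = {v\<in>V. i \<in> sub (L v)}" unfolding At_def using subL by auto
      finally have 1: "(\<Sum>K\<in>?A. card (At K)) = card {v\<in>V. i \<in> sub (L v)}" .
      have "Z i = {v\<in>V. i \<in> sub (L v)} \<union> {v\<in>V. i \<in> L v - sub (L v)}"
        using Z[OF i] i sub(1) unfolding L_def by blast
      then have "card (Z i) = card ({v\<in>V. i \<in> sub (L v)} \<union> {v\<in>V. i \<in> L v - sub (L v)})" by simp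
      also have "\<dots> = card {v\<in>V. i \<in> sub (L v)} + card {v\<in>V. i \<in> L v - sub (L v)}"
        by (rule card_Un_disjoint) (use V in auto)
      finally have "real (card (Z i)) = real (card {v\<in>V. i \<in> sub (L v)}) + loss i"
        unfolding loss_def by simp
      moreover have "(\<Sum>K\<in>?A. real (card (At K))) = real (card {v\<in>V. i \<in> sub (L v)})"
        using arg_cong[OF 1, of real] by (simp only: of_nat_sum)
      ultimately have "(\<Sum>K\<in>?A. real (card (At K))) = real (card (Z i)) - loss i" by linarith
      then show ?thesis by simp
    qed
    ultimately show ?thesis using cZ' by linarith
  qed
  have "(\<Sum>i\<in>I. loss i) = (\<Sum>i\<in>I. \<Sum>v\<in>V. of_bool (i \<in> L v - sub (L v)) :: real)"
  proof (rule sum.cong[OF refl])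
    fix i
    have 1: "(\<Sum>v\<in>V. of_bool (i \<in> L v - sub (L v)) :: real) = real (card ({v. i \<in> L v - sub (L v)} \<inter> V))"
      by (simp only: real_card_Int_eq_sum[OF V] mem_Collect_eq)
    show "loss i = (\<Sum>v\<in>V. of_bool (i \<in> L v - sub (L v)))"
      unfolding loss_def 1 by (rule arg_cong[where f = "\<lambda>S. real (card S)"]) auto
  qed
  also have "\<dots> = (\<Sum>v\<in>V. \<Sum>i\<in>I. of_bool (i \<in> L v - sub (L v)))" by (rule sum.swap)
  also have "\<dots> = (\<Sum>v\<in>V. max 0 (real (card (L v)) - real q))"
  proof (rule sum.cong[OF refl])
    fix v
    have LI: "L v \<subseteq> I" unfolding L_def by auto
    have "(\<Sum>i\<in>I. of_bool (i \<in> L v - sub (L v)) :: real) = real (card ({i. i \<in> L v - sub (L v)} \<inter> I))"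
      by (simp only: real_card_Int_eq_sum[OF I] mem_Collect_eq)
    also have "{i. i \<in> L v - sub (L v)} \<inter> I = L v - sub (L v)" using LI by auto
    also have "card (L v - sub (L v)) = card (L v) - min q (card (L v))"
      using sub[of "L v"] finL finite_subset[of "sub (L v)" "L v"] by (simp add: card_Diff_subset)
    finally show "(\<Sum>i\<in>I. of_bool (i \<in> L v - sub (L v)) :: real) = max 0 (real (card (L v)) - real q)"
      by (auto simp: min_def max_def of_nat_diff)
  qed
  finally have total: "(\<Sum>i\<in>I. loss i) = (\<Sum>v\<in>V. max 0 (real (card (L v)) - real q))" .
  have loss0: "0 \<le> loss i" for i unfolding loss_def by simp
  show ?thesis
    by (intro exI[of _ Z'] exI[of _ loss] conjI ballI Z'Z disj loss0 card_Z' total[unfolded L_def])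
qed

text \<open>
  The core with its expansion, and disjoint regular pairs whose total size exceeds a class of the tree
  by a linear amount.
\<close>

locale host =
  fixes V :: "'a set" and E :: "('a \<times> 'a) set" and C :: "('a \<times> bool) set"
    and J :: "nat set" and P Q :: "nat \<Rightarrow> 'a set" and d \<alpha> \<epsilon> \<zeta> \<gamma> :: real
  assumes finV: "finite V" and EV: "E \<subseteq> V \<times> V" and CV: "C \<subseteq> V \<times> UNIV"
    and d: "\<alpha> * real (card V) \<le> d" "d \<le> real (card V)" and C2: "d / 2 \<le> real (card C)"
    and inner: "\<And>x. x \<in> C \<Longrightarrow> d / 2 \<le> real (card (nb E x \<inter> C))"
    and expand: "\<And>S. S \<subseteq> C \<Longrightarrow>
      \<alpha>\<^sup>2 / 1024 * real (card V) * min (real (card S)) (real (card (C - S))) \<le> ecount (nb E) S (C - S)"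
    and finJ: "finite J"
    and PC: "\<And>j. j \<in> J \<Longrightarrow> P j \<times> {True} \<subseteq> C" and QC: "\<And>j. j \<in> J \<Longrightarrow> Q j \<times> {False} \<subseteq> C"
    and cardQ: "\<And>j. j \<in> J \<Longrightarrow> card (Q j) = card (P j)"
    and size: "\<And>j. j \<in> J \<Longrightarrow> \<zeta> * real (card V) \<le> real (card (P j))"
    and disjP: "disjoint_family_on P J" and disjQ: "disjoint_family_on Q J"
    and disjPQ: "\<And>i j. i \<in> J \<Longrightarrow> j \<in> J \<Longrightarrow> P i \<inter> Q j = {}"
    and reg: "\<And>j A B. j \<in> J \<Longrightarrow> A \<subseteq> P j \<Longrightarrow> B \<subseteq> Q j \<Longrightarrow> \<epsilon> * real (card (P j)) \<le> real (card A) \<Longrightarrow>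
       \<epsilon> * real (card (P j)) \<le> real (card B) \<Longrightarrow> \<gamma> * (real (card V))\<^sup>2 \<le> acount E A B"
    and total: "d - \<alpha> * real (card V) / 2 \<le> (\<Sum>j\<in>J. real (card (P j)))"

lemma cover_count_eq_card:
  "cover_count ps v = real (card {i \<in> {..<length ps} \<times> UNIV. v \<in> (if snd i then fst (ps ! fst i) else snd (ps ! fst i))})"
proof -
  let ?I = "{..<length ps} \<times> (UNIV :: bool set)"
  let ?Z = "\<lambda>i. if snd i then fst (ps ! fst i) else snd (ps ! fst i)"
  have "cover_count ps v = (\<Sum>t<length ps. (\<lambda>(P, Q). of_bool (v \<in> P) + of_bool (v \<in> Q)) (ps ! t))"
    unfolding cover_count_def by (simp add: sum_list_sum_nth atLeast0LessThan)
  also have "\<dots> = (\<Sum>t<length ps. \<Sum>s\<in>UNIV. of_bool (v \<in> ?Z (t, s)))"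
    by (intro sum.cong refl) (simp add: UNIV_bool case_prod_beta add.commute)
  also have "\<dots> = (\<Sum>i\<in>?I. of_bool (v \<in> ?Z i))"
    by (simp only: sum.cartesian_product split_def fst_conv snd_conv)
  also have "\<dots> = real (card ({i. v \<in> ?Z i} \<inter> ?I))"
    by (simp only: real_card_Int_eq_sum finite_cartesian_product finite_lessThan finite mem_Collect_eq)
  also have "{i. v \<in> ?Z i} \<inter> ?I = {i \<in> ?I. v \<in> ?Z i}" by blast
  finally show ?thesis .
qed

text \<open>Simplifies the overload of \<open>fractional_matching\<close>. What matters is the
  factor \<open>sqrt q\<close>: after the later division by \<open>q\<close> a large
  \<open>q\<close> makes the overload small.\<close>

lemma loss_bound:
  fixes n d \<alpha> :: real and q :: nat
  assumes \<alpha>: "0 < \<alpha>" "\<alpha> \<le> 1" and d: "\<alpha> * n / 2 \<le> d" "d \<le> n" and n: "0 < n" and q: "0 < q"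
  shows "n * (n / d) + sqrt (n * ((4 + n\<^sup>2 / d\<^sup>2) * (real q * d + n))) \<le> 6 * n * sqrt (real q) / \<alpha>"
proof -
  have d0: "0 < d" using d \<alpha> n by (smt (verit) mult_pos_pos half_gt_zero)
  have nd: "n / d \<le> 2 / \<alpha>"
    using d(1) d0 \<alpha> by (simp add: field_simps)
  have "(n / d)\<^sup>2 \<le> (2 / \<alpha>)\<^sup>2" using nd d0 n by (intro power_mono) auto
  then have "4 + n\<^sup>2 / d\<^sup>2 \<le> 4 + 4 / \<alpha>\<^sup>2" by (simp add: power_divide)
  also have "\<dots> \<le> 8 / \<alpha>\<^sup>2"
  proof -
    have "4 \<le> 4 / \<alpha>\<^sup>2" using \<alpha> power_le_one[of \<alpha> 2] by (simp add: pos_le_divide_eq)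
    then show ?thesis by simp
  qed
  finally have K: "4 + n\<^sup>2 / d\<^sup>2 \<le> 8 / \<alpha>\<^sup>2" .
  have "real q * d + n \<le> real q * n + real q * n"
    using d n q by (intro add_mono mult_left_mono) (auto simp: mult_le_cancel_right1)
  then have "(4 + n\<^sup>2 / d\<^sup>2) * (real q * d + n) \<le> 8 / \<alpha>\<^sup>2 * (2 * real q * n)"
    using K d0 n by (intro mult_mono) (simp_all add: algebra_simps)
  then have "n * ((4 + n\<^sup>2 / d\<^sup>2) * (real q * d + n)) \<le> n * (8 / \<alpha>\<^sup>2 * (2 * real q * n))"
    using n by (intro mult_left_mono) auto
  also have "\<dots> = (4 * n / \<alpha>)\<^sup>2 * real q" by (simp add: power2_eq_square)
  finally have "sqrt (n * ((4 + n\<^sup>2 / d\<^sup>2) * (real q * d + n))) \<le> sqrt ((4 * n / \<alpha>)\<^sup>2 * real q)"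
    by (rule real_sqrt_le_mono)
  also have "\<dots> = 4 * n / \<alpha> * sqrt (real q)" using n \<alpha> by (simp add: real_sqrt_mult)
  finally have 1: "sqrt (n * ((4 + n\<^sup>2 / d\<^sup>2) * (real q * d + n))) \<le> 4 * n / \<alpha> * sqrt (real q)" .
  have "n * (n / d) \<le> n * (2 / \<alpha>)" using nd n by (intro mult_left_mono) auto
  also have "\<dots> \<le> 2 * n / \<alpha> * sqrt (real q)"
  proof -
    have "1 \<le> sqrt (real q)" using q by simp
    then have "2 * n / \<alpha> * 1 \<le> 2 * n / \<alpha> * sqrt (real q)" using n \<alpha> by (intro mult_left_mono) auto
    then show ?thesis by (simp add: ac_simps)
  qed
  finally have "n * (n / d) \<le> 2 * n / \<alpha> * sqrt (real q)" .
  moreover have "6 * n * sqrt (real q) / \<alpha> = 2 * n / \<alpha> * sqrt (real q) + 4 * n / \<alpha> * sqrt (real q)"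
    by (simp add: field_simps)
  ultimately show ?thesis using 1 by linarith
qed

text \<open>The error \<open>\<alpha> * n / 2\<close> in the total size is spent as follows:
  \<open>4 * b = \<alpha> * n / 4\<close> for the weight of the fractional matching, and
  \<open>\<alpha> * n / 64\<close> each for the overload, the rounding and the pairs that are
  discarded.\<close>

lemma host_structure:
  fixes \<alpha> \<epsilon> :: real
  assumes \<alpha>: "0 < \<alpha>" "\<alpha> \<le> 1" and \<epsilon>: "0 < \<epsilon>" "\<epsilon> \<le> 1/4"
  shows "\<exists>\<zeta>>0. \<exists>\<gamma>>0. \<exists>n0. \<forall>(V :: 'a set) E d. finite V \<and> E \<subseteq> V \<times> V \<and> E \<noteq> {} \<and>
     (\<forall>u v. (u, v) \<in> E \<longrightarrow> (v, u) \<notin> E) \<and> n0 \<le> card V \<and> \<alpha> * real (card V) \<le> d \<and>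
     (\<forall>x. nb E x \<noteq> {} \<longrightarrow> d \<le> real (card (nb E x))) \<longrightarrow>
     (\<exists>C J P Q. host V E C J P Q d \<alpha> \<epsilon> \<zeta> \<gamma>)"
proof -
  \<comment> \<open>With this \<open>q\<close> the overload
    \<open>6 * n * sqrt q / \<alpha>\<close>, divided by \<open>q\<close>, is at most
    \<open>\<alpha> * n / 64\<close>.\<close>
  define q where "q = nat \<lceil>(384 / \<alpha>\<^sup>2)\<^sup>2\<rceil>"
  have q: "(384 / \<alpha>\<^sup>2)\<^sup>2 \<le> real q" unfolding q_def by (rule real_nat_ceiling_ge)
  have "0 < (384 / \<alpha>\<^sup>2)\<^sup>2" using \<alpha> by simp
  then have q0: "0 < q" using q by (metis of_nat_0_less_iff order_less_le_trans)
  have sq: "384 / \<alpha>\<^sup>2 \<le> sqrt (real q)" using q \<alpha> by (intro real_le_rsqrt)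
  \<comment> \<open>Pairs whose sides keep less than a proportion \<open>\<xi> / q\<close> will be
    discarded. Their total is at most \<open>\<xi> * (2 * n) = \<alpha> * n / 64\<close>, and the
    others inherit \<open>\<epsilon>\<close>-regularity if the original pairs have parameter
    \<open>\<epsilon>0 = \<epsilon> * \<xi> / q\<close>.\<close>
  define \<xi> where "\<xi> = \<alpha> / 128"
  define \<epsilon>0 where "\<epsilon>0 = \<epsilon> * \<xi> / real q"
  have \<xi>: "0 < \<xi>" "\<xi> \<le> 1" unfolding \<xi>_def using \<alpha> by auto
  have \<epsilon>0: "0 < \<epsilon>0" "\<epsilon>0 \<le> 1/4"
  proof -
    show "0 < \<epsilon>0" unfolding \<epsilon>0_def using \<epsilon> \<xi> q0 by simp
    have "\<epsilon> * \<xi> \<le> 1/4 * 1" using \<epsilon> \<xi> by (intro mult_mono) auto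
    moreover have "\<epsilon> * \<xi> / real q \<le> \<epsilon> * \<xi> / 1"
      by (rule divide_left_mono) (use \<epsilon> \<xi> q0 in auto)
    ultimately show "\<epsilon>0 \<le> 1/4" unfolding \<epsilon>0_def by linarith
  qed
  \<comment> \<open>The density \<open>b\<^sup>2 / 4\<close> of \<open>light_dense_pair\<close> for
    \<open>b = \<alpha> * n / 16\<close>.\<close>
  define \<delta> where "\<delta> = \<alpha>\<^sup>2 / 1024"
  have \<delta>: "0 < \<delta>" "\<delta> \<le> 1" unfolding \<delta>_def using \<alpha> power_le_one[of \<alpha> 2] by auto
  obtain \<sigma> where \<sigma>: "0 < \<sigma>" "\<sigma> \<le> 1" and pair:
    "\<And>(E :: ('a \<times> 'a) set) P0 Q0 n. finite P0 \<Longrightarrow> finite Q0 \<Longrightarrow> card P0 \<le> n \<Longrightarrow> card Q0 \<le> n \<Longrightarrow>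
     1 \<le> \<epsilon>0 * \<sigma> * real n \<Longrightarrow> \<delta> * (real n)\<^sup>2 \<le> acount E P0 Q0 \<Longrightarrow>
     \<exists>P\<subseteq>P0. \<exists>Q\<subseteq>Q0. card P = card Q \<and> \<sigma> * real n \<le> real (card P) \<and>
        (\<forall>A\<subseteq>P. \<forall>B\<subseteq>Q. \<epsilon>0 * real (card P) \<le> real (card A) \<and> \<epsilon>0 * real (card P) \<le> real (card B) \<longrightarrow>
            \<delta>\<^sup>2 * \<epsilon>0\<^sup>2 / 2 * (real (card P))\<^sup>2 \<le> acount E A B)"
    using regular_pair[OF \<delta> \<epsilon>0, where ?'a = 'a] by metis
  define Tm where "Tm = nat \<lceil>(real q + 1) / \<sigma>\<rceil>"
  \<comment> \<open>The three terms ensure \<open>1 \<le> b\<close>, the size condition of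
    \<open>regular_pair\<close>, and that rounding loses at most \<open>\<alpha> * n / 64\<close>;
    for \<open>T\<close> pairs there are \<open>2 * T\<close> sides, so the exponential in
    \<open>disjoint_selection\<close> is \<open>4 ^ T\<close>.\<close>
  define n0 where "n0 = nat \<lceil>16 / \<alpha> + 1 / (\<epsilon>0 * \<sigma>) + 64 / \<alpha> * (real Tm * 4 ^ Tm)\<rceil> + 1"
  define \<zeta> where "\<zeta> = \<xi> * \<sigma> / real q"
  define \<gamma> where "\<gamma> = \<delta>\<^sup>2 * \<epsilon>0\<^sup>2 / 2 * \<sigma>\<^sup>2"
  have \<zeta>0: "0 < \<zeta>" unfolding \<zeta>_def using \<xi> \<sigma> q0 by simp
  have \<gamma>0: "0 < \<gamma>" unfolding \<gamma>_def using \<delta> \<epsilon>0 \<sigma> by simp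
  show ?thesis
  proof (rule exI[of _ \<zeta>], rule conjI[OF \<zeta>0], rule exI[of _ \<gamma>], rule conjI[OF \<gamma>0], rule exI[of _ n0],
      intro allI impI, elim conjE)
    fix V :: "'a set" and E d
    assume finV: "finite V" and EV: "E \<subseteq> V \<times> V" and E: "E \<noteq> {}"
      and asym: "\<forall>u v. (u, v) \<in> E \<longrightarrow> (v, u) \<notin> E" and n0: "n0 \<le> card V"
      and d: "\<alpha> * real (card V) \<le> d" and deg: "\<forall>x. nb E x \<noteq> {} \<longrightarrow> d \<le> real (card (nb E x))"
    define n where "n = card V"
    have "16 / \<alpha> + 1 / (\<epsilon>0 * \<sigma>) + 64 / \<alpha> * (real Tm * 4 ^ Tm) \<le> real n"
      using n0 unfolding n0_def n_def by linarith
    moreover have "0 \<le> 16 / \<alpha>" "0 \<le> 1 / (\<epsilon>0 * \<sigma>)" "0 \<le> 64 / \<alpha> * (real Tm * 4 ^ Tm)"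
      using \<alpha> \<epsilon>0 \<sigma> by auto
    ultimately have "16 / \<alpha> \<le> real n" "1 / (\<epsilon>0 * \<sigma>) \<le> real n" "64 / \<alpha> * (real Tm * 4 ^ Tm) \<le> real n"
      by linarith+
    then have n1: "16 \<le> \<alpha> * real n" and n2: "1 \<le> \<epsilon>0 * \<sigma> * real n"
      and n3: "real Tm * 4 ^ Tm \<le> \<alpha> * real n / 64"
      using \<alpha> \<epsilon>0 \<sigma> by (simp_all add: field_simps)
    have npos: "0 < real n" using n1 \<alpha> by (smt (verit) mult_nonneg_nonpos)
    have finnb: "finite (nb E x)" for x using nb_subset[OF EV, of x] finV finite_subset by fastforce
    obtain u0 v0 where uv: "(u0, v0) \<in> E" using E by auto
    have fst_nb: "card (nb E x) \<le> n" for x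
    proof -
      have "card (nb E x) = card (fst ` nb E x)" by (rule card_image[OF inj_on_fst_nb, symmetric])
      also have "\<dots> \<le> n" unfolding n_def using nb_subset[OF EV, of x] finV by (intro card_mono) auto
      finally show ?thesis .
    qed
    have "nb E (u0, True) \<noteq> {}" using uv by (auto simp: nb_def)
    then have dn: "d \<le> real n" using deg fst_nb[of "(u0, True)"] by (meson of_nat_mono order_trans)
    define \<Omega> where "\<Omega> = {x \<in> V \<times> UNIV. nb E x \<noteq> {}}"
    have fin\<Omega>: "finite \<Omega>" unfolding \<Omega>_def using finV by auto
    have ne\<Omega>: "\<Omega> \<noteq> {}" unfolding \<Omega>_def using uv EV by (auto simp: nb_def)
    have closed: "nb E x \<subseteq> \<Omega>" for x
      unfolding \<Omega>_def using nb_subset[OF EV, of x] nb_sym[of _ E x] by blast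
    have "card \<Omega> \<le> card (V \<times> (UNIV :: bool set))" unfolding \<Omega>_def using finV by (intro card_mono) auto
    then have c\<Omega>: "real (card \<Omega>) \<le> 2 * real n" unfolding n_def by (simp add: card_cartesian_product)
    \<comment> \<open>As the double cover has at most \<open>2 * n\<close> vertices, this makes the
      number of edges leaving the core at most \<open>b\<^sup>2 / 2\<close>.\<close>
    define \<nu> where "\<nu> = \<alpha>\<^sup>2 / 1024 * real n"
    define b where "b = \<alpha> * real n / 16"
    have \<nu>0: "0 \<le> \<nu>" unfolding \<nu>_def by simp
    have \<nu>\<Omega>: "\<nu> * real (card \<Omega>) \<le> b\<^sup>2 / 2"
    proof -
      have "\<nu> * real (card \<Omega>) \<le> \<nu> * (2 * real n)" using c\<Omega> \<nu>0 by (intro mult_left_mono)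
      also have "\<dots> = b\<^sup>2 / 2" unfolding \<nu>_def b_def by (simp add: power2_eq_square)
      finally show ?thesis .
    qed
    have b1: "1 \<le> b" unfolding b_def using n1 by simp
    have bd: "16 * b \<le> d" unfolding b_def using d n_def by simp
    have "(16 * b)\<^sup>2 \<le> d\<^sup>2" using b1 bd by (intro power_mono) auto
    then have "256 * b\<^sup>2 \<le> d\<^sup>2" by (simp add: power_mult_distrib)
    moreover have "0 < b\<^sup>2" using b1 by simp
    ultimately have "b\<^sup>2 / 2 < 3/16 * d\<^sup>2" by linarith
    then have \<nu>d: "\<nu> * real (card \<Omega>) < 3/16 * d\<^sup>2" using \<nu>\<Omega> by linarith
    have d4: "4 \<le> d" using b1 bd by linarith
    have deg\<Omega>: "d \<le> real (card (nb E v))" if "v \<in> \<Omega>" for v using deg that unfolding \<Omega>_def by auto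
    obtain C where C: "C \<subseteq> \<Omega>" "d / 2 \<le> real (card C)"
      "ecount (nb E) C (\<Omega> - C) \<le> \<nu> * real (card \<Omega>)"
      "\<And>v. v \<in> C \<Longrightarrow> d / 2 \<le> real (card (nb E v \<inter> C))"
      "\<And>S. S \<subseteq> C \<Longrightarrow> \<nu> * min (real (card S)) (real (card (C - S))) \<le> ecount (nb E) S (C - S)"
      by (rule robust_core[OF fin\<Omega> ne\<Omega> nb_sym closed deg\<Omega> d4 \<nu>0 \<nu>d]) (assumption | rule that)+
    have CV: "C \<subseteq> V \<times> UNIV" using C(1) unfolding \<Omega>_def by auto
    have "ecount (nb E) C (V \<times> UNIV - C) = ecount (nb E) C (\<Omega> - C)"
    proof -
      have "nb E x \<inter> (V \<times> UNIV - C) = nb E x \<inter> (\<Omega> - C)" for x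
        using closed[of x] nb_subset[OF EV, of x] by blast
      then show ?thesis unfolding ecount_def by simp
    qed
    then have leave: "ecount (nb E) C (V \<times> UNIV - C) \<le> b\<^sup>2 / 2" using C(3) \<nu>\<Omega> by linarith
    have asymE: "(v, u) \<notin> E" if "(u, v) \<in> E" for u v using asym that by blast
    have degC: "d \<le> real (card (nb E x))" if "x \<in> C" for x using deg\<Omega> C(1) that by blast
    have bd4: "4 * b \<le> d" using b1 bd by linarith
    interpret core V E C d b
      by (rule core.intro[OF finV EV asymE CV b1 bd4 degC C(2) leave])
    define d' where "d' = d - 4 * b"
    have d': "\<alpha> * real n / 2 \<le> d'" "d' \<le> real n" "0 < d'"
      using bd b1 dn d unfolding d'_def b_def n_def by auto
    define gp where "gp A B \<longleftrightarrow> A \<times> {True} \<subseteq> C \<and> B \<times> {False} \<subseteq> C \<and> card A = card B \<and>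
        \<sigma> * real n \<le> real (card A) \<and>
        (\<forall>A'\<subseteq>A. \<forall>B'\<subseteq>B. \<epsilon>0 * real (card A) \<le> real (card A') \<and> \<epsilon>0 * real (card A) \<le> real (card B') \<longrightarrow>
            \<delta>\<^sup>2 * \<epsilon>0\<^sup>2 / 2 * (real (card A))\<^sup>2 \<le> acount E A' B')" for A B
    have gpD: "A \<times> {True} \<subseteq> C" "B \<times> {False} \<subseteq> C" "card A = card B" "\<sigma> * real n \<le> real (card A)"
      "\<forall>A'\<subseteq>A. \<forall>B'\<subseteq>B. \<epsilon>0 * real (card A) \<le> real (card A') \<and> \<epsilon>0 * real (card A) \<le> real (card B') \<longrightarrow>
            \<delta>\<^sup>2 * \<epsilon>0\<^sup>2 / 2 * (real (card A))\<^sup>2 \<le> acount E A' B'" if "gp A B" for A B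
    proof -
      note g = that[unfolded gp_def]
      show "A \<times> {True} \<subseteq> C" by (rule conjunct1[OF g])
      show "B \<times> {False} \<subseteq> C" by (rule conjunct1[OF conjunct2[OF g]])
      show "card A = card B" by (rule conjunct1[OF conjunct2[OF conjunct2[OF g]]])
      show "\<sigma> * real n \<le> real (card A)" by (rule conjunct1[OF conjunct2[OF conjunct2[OF conjunct2[OF g]]]])
      show "\<forall>A'\<subseteq>A. \<forall>B'\<subseteq>B. \<epsilon>0 * real (card A) \<le> real (card A') \<and> \<epsilon>0 * real (card A) \<le> real (card B') \<longrightarrow>
            \<delta>\<^sup>2 * \<epsilon>0\<^sup>2 / 2 * (real (card A))\<^sup>2 \<le> acount E A' B'"
        by (rule conjunct2[OF conjunct2[OF conjunct2[OF conjunct2[OF g]]]])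
    qed
    have gpV: "A \<subseteq> V \<and> B \<subseteq> V \<and> card A = card B \<and> \<sigma> * real (card V) \<le> real (card A)"
      if "gp A B" for A B
      using gpD(1-4)[OF that] CV unfolding n_def by auto
    have dual: "\<exists>A B. gp A B \<and> (\<forall>p\<in>A. \<forall>r\<in>B. y p + y r \<le> \<mu>)"
      if y: "\<And>v. 0 \<le> y v" "0 < \<mu>" "(\<Sum>v\<in>V. y v) \<le> d' * \<mu>" for y \<mu>
    proof -
      obtain P0 Q0 where PQ0: "P0 \<times> {True} \<subseteq> C" "Q0 \<times> {False} \<subseteq> C"
        "\<forall>p\<in>P0. \<forall>r\<in>Q0. y p + y r \<le> \<mu>" "b\<^sup>2 / 4 \<le> acount E P0 Q0"
        using light_dense_pair[of y \<mu>] y unfolding d'_def by blast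
      have PQV: "P0 \<subseteq> V" "Q0 \<subseteq> V" using PQ0 CV by blast+
      then have fin: "finite P0" "finite Q0" "card P0 \<le> n" "card Q0 \<le> n"
        unfolding n_def using finV by (auto intro: finite_subset card_mono)
      have "\<delta> * (real n)\<^sup>2 \<le> acount E P0 Q0"
        using PQ0(4) unfolding \<delta>_def b_def by (simp add: power_divide power_mult_distrib)
      from pair[OF fin n2 this] show ?thesis
      proof (elim exE conjE)
        fix A B
        assume AB: "A \<subseteq> P0" "B \<subseteq> Q0" "card A = card B" "\<sigma> * real n \<le> real (card A)"
          "\<forall>A'\<subseteq>A. \<forall>B'\<subseteq>B. \<epsilon>0 * real (card A) \<le> real (card A') \<and> \<epsilon>0 * real (card A) \<le> real (card B') \<longrightarrow>
            \<delta>\<^sup>2 * \<epsilon>0\<^sup>2 / 2 * (real (card A))\<^sup>2 \<le> acount E A' B'"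
        have "A \<times> {True} \<subseteq> C" "B \<times> {False} \<subseteq> C" using AB(1,2) PQ0(1,2) by auto
        then have "gp A B" unfolding gp_def by (intro conjI AB(3-5))
        moreover have "\<forall>p\<in>A. \<forall>r\<in>B. y p + y r \<le> \<mu>" using AB(1,2) PQ0(3) by auto
        ultimately show ?thesis by (intro exI[of _ A] exI[of _ B] conjI)
      qed
    qed
    have Vne: "V \<noteq> {}" using npos unfolding n_def by auto
    obtain ps where ps: "\<forall>(A, B)\<in>set ps. gp A B" "real q * d' \<le> cover_size ps"
      "cover_size ps \<le> real q * d' + real n"
      and over0: "(\<Sum>v\<in>V. max 0 (cover_count ps v - real q)) \<le> real n * (real n / d')
        + sqrt (real n * ((4 + (real n)\<^sup>2 / d'\<^sup>2) * (real q * d' + real n)))"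
      using fractional_matching[OF finV Vne d'(3) \<sigma>(1), of gp q] gpV dual unfolding n_def by blast
    have over: "(\<Sum>v\<in>V. max 0 (cover_count ps v - real q)) / real q \<le> \<alpha> * real n / 64"
    proof -
      have "(\<Sum>v\<in>V. max 0 (cover_count ps v - real q)) \<le> 6 * real n * sqrt (real q) / \<alpha>"
        using over0 loss_bound[OF \<alpha> d'(1,2) npos q0] by linarith
      then have "(\<Sum>v\<in>V. max 0 (cover_count ps v - real q)) / real q \<le> 6 * real n * sqrt (real q) / \<alpha> / real q"
        by (intro divide_right_mono) auto
      also have "\<dots> = 6 * real n / \<alpha> / sqrt (real q)"
        using q0 \<alpha> by (simp add: field_simps)
      also have "\<dots> \<le> 6 * real n / \<alpha> / (384 / \<alpha>\<^sup>2)"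
        using sq \<alpha> npos q0 by (intro divide_left_mono) auto
      also have "\<dots> = \<alpha> * real n / 64" using \<alpha> by (simp add: power2_eq_square)
      finally show ?thesis .
    qed
    define T where "T = length ps"
    define A where "A t = fst (ps ! t)" for t
    define B where "B t = snd (ps ! t)" for t
    have gpt: "gp (A t) (B t)" if "t < T" for t
      using ps(1) nth_mem[of t ps] that unfolding T_def A_def B_def by (auto simp: case_prod_beta)
    have csz: "cover_size ps = (\<Sum>t<T. real (card (A t)))"
      unfolding cover_size_def T_def A_def by (simp add: sum_list_sum_nth atLeast0LessThan case_prod_beta)
    have "real T * (\<sigma> * real n) = (\<Sum>t<T. \<sigma> * real n)" by simp
    also have "\<dots> \<le> cover_size ps" unfolding csz by (intro sum_mono) (simp add: gpD(4)[OF gpt])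
    also have "\<dots> \<le> (real q + 1) * real n"
      using ps(3) d'(2) mult_left_mono[OF d'(2), of "real q"] by (simp add: distrib_right)
    finally have "real T * \<sigma> \<le> real q + 1" using npos by (simp add: mult.assoc[symmetric])
    then have "real T \<le> (real q + 1) / \<sigma>" using \<sigma> by (simp add: field_simps)
    then have T: "T \<le> Tm" unfolding Tm_def by linarith
    define I where "I = {..<T} \<times> (UNIV :: bool set)"
    define Z where "Z i = (if snd i then A (fst i) else B (fst i))" for i
    have finI: "finite I" unfolding I_def by auto
    have cI: "card I = 2 * T" unfolding I_def by (simp add: card_cartesian_product)
    have ZV: "Z i \<subseteq> V" if "i \<in> I" for i
      using that gpV[OF gpt, of "fst i"] unfolding I_def Z_def by auto
    have cnt: "cover_count ps v = real (card {i\<in>I. v \<in> Z i})" for v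
      unfolding cover_count_eq_card I_def Z_def T_def A_def B_def ..
    obtain Z' loss where Z': "\<forall>i\<in>I. Z' i \<subseteq> Z i" "disjoint_family_on Z' I"
      "\<forall>i\<in>I. 0 \<le> loss i \<and> (real (card (Z i)) - loss i) / real q - 2 ^ card I \<le> real (card (Z' i))"
      "(\<Sum>i\<in>I. loss i) = (\<Sum>v\<in>V. max 0 (real (card {i\<in>I. v \<in> Z i}) - real q))"
      by (rule exE[OF disjoint_selection[where Z = Z, OF finI finV ZV q0]], assumption, elim exE conjE, rule that; assumption)
    \<comment> \<open>The sides of a pair may shrink unequally; both are trimmed to the smaller
      size. Subtracting both losses bounds that size from below.\<close>
    define c where "c t = min (card (Z' (t, True))) (card (Z' (t, False)))" for t
    have ct: "(real (card (A t)) - loss (t, True) - loss (t, False)) / real q - 4 ^ T \<le> real (c t)"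
      if t: "t < T" for t
    proof -
      have I2: "(t, True) \<in> I" "(t, False) \<in> I" unfolding I_def using t by auto
      have 4: "(2::real) ^ card I = 4 ^ T" unfolding cI by (simp add: power_mult)
      have "card (Z (t, True)) = card (A t)" "card (Z (t, False)) = card (A t)"
        by (simp_all add: Z_def gpD(3)[OF gpt[OF t], symmetric])
      then have 1: "(real (card (A t)) - loss (t, True)) / real q - 4 ^ T \<le> real (card (Z' (t, True)))"
        "(real (card (A t)) - loss (t, False)) / real q - 4 ^ T \<le> real (card (Z' (t, False)))"
        "0 \<le> loss (t, True)" "0 \<le> loss (t, False)"
        using Z'(3) I2 4 by auto
      have "(real (card (A t)) - loss (t, True) - loss (t, False)) / real q \<le> (real (card (A t)) - loss (t, True)) / real q"
        "(real (card (A t)) - loss (t, True) - loss (t, False)) / real q \<le> (real (card (A t)) - loss (t, False)) / real q"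
        using 1 by (intro divide_right_mono; simp)+
      then show ?thesis unfolding c_def using 1 by (simp add: min_def)
    qed
    have sumc: "d' - \<alpha> * real n / 32 \<le> (\<Sum>t<T. real (c t))"
    proof -
      have "(\<Sum>t<T. (real (card (A t)) - loss (t, True) - loss (t, False)) / real q - 4 ^ T)
          = (\<Sum>t<T. real (card (A t))) / real q - (\<Sum>t<T. loss (t, True) + loss (t, False)) / real q - real T * 4 ^ T"
        by (simp add: sum_subtractf sum_divide_distrib[symmetric] sum.distrib diff_diff_eq diff_divide_distrib)
      moreover have "(\<Sum>t<T. loss (t, True) + loss (t, False)) / real q = (\<Sum>i\<in>I. loss i) / real q"
      proof -
        have "(\<Sum>t<T. loss (t, True) + loss (t, False)) = (\<Sum>t<T. \<Sum>s\<in>UNIV. loss (t, s))"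
          by (intro sum.cong refl) (simp add: UNIV_bool add.commute)
        then show ?thesis unfolding I_def by (simp add: sum.cartesian_product case_prod_beta)
      qed
      moreover have "(\<Sum>i\<in>I. loss i) / real q \<le> \<alpha> * real n / 64"
        using over unfolding Z'(4) cnt .
      moreover have "d' \<le> (\<Sum>t<T. real (card (A t))) / real q"
        using ps(2) q0 unfolding csz by (simp add: field_simps)
      moreover have "real T * 4 ^ T \<le> \<alpha> * real n / 64"
      proof -
        have "real T * 4 ^ T \<le> real Tm * 4 ^ Tm" using T by (intro mult_mono power_increasing) auto
        then show ?thesis using n3 by linarith
      qed
      moreover have "(\<Sum>t<T. (real (card (A t)) - loss (t, True) - loss (t, False)) / real q - 4 ^ T)
          \<le> (\<Sum>t<T. real (c t))" using ct by (intro sum_mono) auto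
      ultimately show ?thesis by linarith
    qed
    define J where "J = {t. t < T \<and> \<xi> * real (card (A t)) / real q \<le> real (c t)}"
    have finJ: "finite J" unfolding J_def by auto
    have "\<forall>t. \<exists>P. P \<subseteq> Z' (t, True) \<and> card P = c t" and "\<forall>t. \<exists>Q. Q \<subseteq> Z' (t, False) \<and> card Q = c t"
      unfolding c_def by (meson min.cobounded1 min.cobounded2 obtain_subset_with_card_n)+
    then obtain P Q where PQ: "\<And>t. P t \<subseteq> Z' (t, True)" "\<And>t. card (P t) = c t"
      "\<And>t. Q t \<subseteq> Z' (t, False)" "\<And>t. card (Q t) = c t" by metis
    have sub: "P t \<subseteq> A t" "Q t \<subseteq> B t" if "t \<in> J" for t
    proof -
      have "(t, True) \<in> I" "(t, False) \<in> I" using that unfolding I_def J_def by auto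
      then have "Z' (t, True) \<subseteq> A t" "Z' (t, False) \<subseteq> B t" using Z'(1) unfolding Z_def by fastforce+
      then show "P t \<subseteq> A t" "Q t \<subseteq> B t" using PQ by blast+
    qed
    have disj: "Z' (i, s) \<inter> Z' (j, s') = {}" if "i \<in> J" "j \<in> J" "(i, s) \<noteq> (j, s')" for i j s s'
      using Z'(2) that unfolding disjoint_family_on_def I_def J_def by auto
    have "(\<Sum>t<T. real (c t)) \<le> (\<Sum>t\<in>J. real (c t)) + \<alpha> * real n / 64"
    proof -
      have split: "{..<T} = J \<union> ({..<T} - J)" unfolding J_def by auto
      have "(\<Sum>t<T. real (c t)) = (\<Sum>t\<in>J. real (c t)) + (\<Sum>t\<in>{..<T} - J. real (c t))"
        by (subst split, rule sum.union_disjoint) (use finJ in auto)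
      also have "(\<Sum>t\<in>{..<T} - J. real (c t)) \<le> (\<Sum>t\<in>{..<T} - J. \<xi> * real (card (A t)) / real q)"
        unfolding J_def by (intro sum_mono) auto
      also have "\<dots> \<le> (\<Sum>t<T. \<xi> * real (card (A t)) / real q)" using \<xi> by (intro sum_mono2) auto
      also have "\<dots> = \<xi> * (cover_size ps / real q)"
        unfolding csz by (simp add: sum_distrib_left sum_divide_distrib)
      also have "\<dots> \<le> \<xi> * (2 * real n)"
      proof (rule mult_left_mono)
        have "real q * d' \<le> real q * real n" using d'(2) by (intro mult_left_mono) auto
        moreover have "1 * real n \<le> real q * real n" using q0 by (intro mult_right_mono) auto
        ultimately have "cover_size ps \<le> real q * real n + real q * real n" using ps(3) by linarith
        then show "cover_size ps / real q \<le> 2 * real n" using q0 by (simp add: field_simps)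
      qed (use \<xi> in auto)
      also have "\<dots> = \<alpha> * real n / 64" unfolding \<xi>_def by simp
      finally show ?thesis by simp
    qed
    then have tot: "d - \<alpha> * real n / 2 \<le> (\<Sum>j\<in>J. real (card (P j)))"
      using sumc mult_pos_pos[OF \<alpha>(1) npos] unfolding PQ(2) d'_def b_def by linarith
    have sz: "\<xi> * real (card (A j)) / real q \<le> real (card (P j))" "\<sigma> * real n \<le> real (card (A j))" if "j \<in> J" for j
      using that gpD(4)[OF gpt[of j]] unfolding PQ(2) J_def by auto
    have "host V E C J P Q d \<alpha> \<epsilon> \<zeta> \<gamma>"
    proof
      show "\<alpha> * real (card V) \<le> d" by fact
      show "d \<le> real (card V)" using dn n_def by simp
      show "d / 2 \<le> real (card (nb E x \<inter> C))" if "x \<in> C" for x using C(4) that .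
      show "\<alpha>\<^sup>2 / 1024 * real (card V) * min (real (card S)) (real (card (C - S))) \<le> ecount (nb E) S (C - S)"
        if "S \<subseteq> C" for S using C(5)[OF that] unfolding \<nu>_def n_def .
      show "P j \<times> {True} \<subseteq> C" "Q j \<times> {False} \<subseteq> C" if "j \<in> J" for j
      proof -
        have "j < T" using that unfolding J_def by simp
        then show "P j \<times> {True} \<subseteq> C" "Q j \<times> {False} \<subseteq> C"
          using sub[OF that] gpD(1,2)[OF gpt[of j]] by blast+
      qed
      show "card (Q j) = card (P j)" if "j \<in> J" for j by (simp add: PQ)
      show "\<zeta> * real (card V) \<le> real (card (P j))" if "j \<in> J" for j
      proof -
        have "\<zeta> * real n = \<xi> * (\<sigma> * real n) / real q" unfolding \<zeta>_def by simp
        also have "\<dots> \<le> \<xi> * real (card (A j)) / real q"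
          using sz(2)[OF that] \<xi> q0 by (intro divide_right_mono mult_left_mono) auto
        finally show ?thesis using sz(1)[OF that] unfolding n_def by linarith
      qed
      show "disjoint_family_on P J" "disjoint_family_on Q J"
        unfolding disjoint_family_on_def using PQ(1,3) disj by (blast, blast)
      show "P i \<inter> Q j = {}" if "i \<in> J" "j \<in> J" for i j
        using PQ(1)[of i] PQ(3)[of j] disj[OF that, of True False] by blast
      show "d - \<alpha> * real (card V) / 2 \<le> (\<Sum>j\<in>J. real (card (P j)))" using tot n_def by simp
      fix j A' B' assume j: "j \<in> J" and AB: "A' \<subseteq> P j" "B' \<subseteq> Q j"
        "\<epsilon> * real (card (P j)) \<le> real (card A')" "\<epsilon> * real (card (P j)) \<le> real (card B')"
      have "\<epsilon>0 * real (card (A j)) = \<epsilon> * (\<xi> * real (card (A j)) / real q)" unfolding \<epsilon>0_def by simp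
      also have "\<dots> \<le> \<epsilon> * real (card (P j))" using sz(1)[OF j] \<epsilon> by (intro mult_left_mono) auto
      finally have "\<epsilon>0 * real (card (A j)) \<le> \<epsilon> * real (card (P j))" .
      then have "\<delta>\<^sup>2 * \<epsilon>0\<^sup>2 / 2 * (real (card (A j)))\<^sup>2 \<le> acount E A' B'"
      proof -
        assume le: "\<epsilon>0 * real (card (A j)) \<le> \<epsilon> * real (card (P j))"
        have "j < T" using j unfolding J_def by simp
        from gpD(5)[OF gpt[OF this], rule_format, of A' B'] show ?thesis
          using AB sub[OF j] le by (meson order_trans)
      qed
      moreover have "\<gamma> * (real n)\<^sup>2 = \<delta>\<^sup>2 * \<epsilon>0\<^sup>2 / 2 * (\<sigma> * real n)\<^sup>2"
        unfolding \<gamma>_def by (simp add: power_mult_distrib)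
      moreover have "\<dots> \<le> \<delta>\<^sup>2 * \<epsilon>0\<^sup>2 / 2 * (real (card (A j)))\<^sup>2"
        using sz(2)[OF j] \<sigma> by (intro mult_left_mono power_mono) auto
      ultimately show "\<gamma> * (real (card V))\<^sup>2 \<le> acount E A' B'" unfolding n_def by linarith
    qed (use finV EV CV C finJ in auto)
    then show "\<exists>C J P Q. host V E C J P Q d \<alpha> \<epsilon> \<zeta> \<gamma>" by blast
  qed
qed

section \<open>Hitting sets and balanced assignments\<close>

lemma greedy_hitting:
  fixes t :: real
  assumes V: "finite V" "V \<noteq> {}" and F: "finite \<F>" "\<And>F. F \<in> \<F> \<Longrightarrow> F \<subseteq> V \<and> t \<le> real (card F)"
    and t: "0 < t"
  shows "\<exists>H\<subseteq>V. card H \<le> r \<and>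
    real (card {F\<in>\<F>. F \<inter> H = {}}) \<le> real (card \<F>) * exp (- t / real (card V)) ^ r"
proof (induction r)
  case 0
  have "{F\<in>\<F>. F \<inter> {} = {}} = \<F>" by auto
  then show ?case by (intro exI[of _ "{}"]) simp
next
  case (Suc r)
  then obtain H where H: "H \<subseteq> V" "card H \<le> r"
    "real (card {F\<in>\<F>. F \<inter> H = {}}) \<le> real (card \<F>) * exp (- t / real (card V)) ^ r" by auto
  define U where "U = {F\<in>\<F>. F \<inter> H = {}}"
  define n where "n = real (card V)"
  have n0: "0 < n" unfolding n_def using V by (simp add: card_gt_0_iff)
  have finU: "finite U" unfolding U_def using F by auto
  \<comment> \<open>By double counting, some vertex lies in at least the average proportion
    \<open>t / n\<close> of the sets not hit so far.\<close>
  have "\<exists>v\<in>V. t / n * real (card U) \<le> real (card {F\<in>U. v \<in> F})"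
  proof (rule ccontr)
    assume "\<not> ?thesis"
    then have lt: "real (card {F\<in>U. v \<in> F}) < t / n * real (card U)" if "v \<in> V" for v using that by auto
    have "t * real (card U) = (\<Sum>F\<in>U. t)" by simp
    also have "\<dots> \<le> (\<Sum>F\<in>U. real (card F))" using F unfolding U_def by (intro sum_mono) auto
    also have "\<dots> = (\<Sum>F\<in>U. \<Sum>v\<in>V. if v \<in> F then 1 else 0)"
    proof (rule sum.cong[OF refl])
      fix G assume "G \<in> U"
      then have "G \<subseteq> V" using F unfolding U_def by auto
      then have "V \<inter> {v. v \<in> G} = G" by auto
      then show "real (card G) = (\<Sum>v\<in>V. if v \<in> G then 1 else 0)" using V by (simp add: sum.If_cases)
    qed
    also have "\<dots> = (\<Sum>v\<in>V. \<Sum>F\<in>U. if v \<in> F then 1 else 0)" by (rule sum.swap)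
    also have "\<dots> = (\<Sum>v\<in>V. real (card {F\<in>U. v \<in> F}))"
      using finU by (simp add: sum.If_cases Int_def)
    also have "\<dots> < (\<Sum>v\<in>V. t / n * real (card U))" using lt V by (intro sum_strict_mono) auto
    also have "\<dots> = t * real (card U)" using n0 unfolding n_def by simp
    finally show False by simp
  qed
  then obtain v where v: "v \<in> V" "t / n * real (card U) \<le> real (card {F\<in>U. v \<in> F})" by auto
  have "{F\<in>\<F>. F \<inter> insert v H = {}} = U - {F\<in>U. v \<in> F}" unfolding U_def by auto
  then have "card {F\<in>\<F>. F \<inter> insert v H = {}} = card U - card {F\<in>U. v \<in> F}"
    using finU by (simp add: card_Diff_subset)
  moreover have "card {F\<in>U. v \<in> F} \<le> card U" using finU by (intro card_mono) auto
  ultimately have "real (card {F\<in>\<F>. F \<inter> insert v H = {}}) \<le> (1 - t / n) * real (card U)"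
    using v(2) by (simp add: of_nat_diff left_diff_distrib)
  also have "\<dots> \<le> exp (- t / n) * real (card U)"
    using exp_ge_add_one_self[of "- t / n"] by (intro mult_right_mono) auto
  also have "\<dots> \<le> exp (- t / n) * (real (card \<F>) * exp (- t / n) ^ r)"
    using H(3) unfolding U_def n_def by (intro mult_left_mono) auto
  finally have "real (card {F\<in>\<F>. F \<inter> insert v H = {}}) \<le> real (card \<F>) * exp (- t / n) ^ Suc r"
    by (simp add: ac_simps)
  moreover have "card (insert v H) \<le> Suc r" using H(2) finite_subset[OF H(1) V(1)] by (simp add: card_insert_if)
  ultimately show ?case using H(1) v(1) unfolding n_def by (intro exI[of _ "insert v H"]) auto
qed

text \<open>Provides the reservoir. In each of \<open>M\<close> rounds the vertices chosen so far
  are removed from all sets, which leaves at least \<open>t\<close> of their \<open>2 * t\<close>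
  elements, and \<open>r\<close> fresh vertices hit every remainder. The bound on unhit sets drops
  below 1, so there are none.\<close>

lemma multiple_hitting:
  fixes t :: real
  assumes V: "finite V" "V \<noteq> {}" and F: "finite \<F>" "\<And>F. F \<in> \<F> \<Longrightarrow> F \<subseteq> V \<and> 2 * t \<le> real (card F)"
    and t: "0 < t" and r: "real (card \<F>) < exp (t / real (card V)) ^ r" and M: "real (M * r) \<le> t"
  shows "\<exists>R\<subseteq>V. card R \<le> M * r \<and> (\<forall>F\<in>\<F>. M \<le> card (F \<inter> R))"
  using M
proof (induction M)
  case 0
  then show ?case by (intro exI[of _ "{}"]) auto
next
  case (Suc M)
  have "real (M * r) \<le> real (Suc M * r)" by simp
  then have Mt: "real (M * r) \<le> t" using Suc.prems by linarith
  then obtain R where R: "R \<subseteq> V" "card R \<le> M * r" "\<forall>F\<in>\<F>. M \<le> card (F \<inter> R)"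
    using Suc.IH by auto
  have finR: "finite R" using R V finite_subset by auto
  define \<G> where "\<G> = (\<lambda>F. F - R) ` \<F>"
  have fin\<G>: "finite \<G>" unfolding \<G>_def using F by auto
  have \<G>: "G \<subseteq> V \<and> t \<le> real (card G)" if "G \<in> \<G>" for G
  proof -
    obtain K where K: "K \<in> \<F>" "G = K - R" using \<open>G \<in> \<G>\<close> unfolding \<G>_def by auto
    have "card K - card R \<le> card (K - R)" by (rule diff_card_le_card_Diff[OF finR])
    moreover have "real (card R) \<le> t" using R(2) Mt by (meson of_nat_mono order_trans)
    ultimately show ?thesis using F(2)[OF K(1)] K by auto
  qed
  obtain H where H: "H \<subseteq> V" "card H \<le> r"
    "real (card {G\<in>\<G>. G \<inter> H = {}}) \<le> real (card \<G>) * exp (- t / real (card V)) ^ r"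
    using greedy_hitting[OF V fin\<G> \<G> t] by auto
  have "card \<G> \<le> card \<F>" unfolding \<G>_def using F by (intro card_image_le)
  then have "real (card \<G>) < exp (t / real (card V)) ^ r" using r by linarith
  then have "real (card \<G>) * exp (- t / real (card V)) ^ r
      < exp (t / real (card V)) ^ r * exp (- t / real (card V)) ^ r"
    by (intro mult_strict_right_mono) auto
  also have "\<dots> = 1" by (simp add: power_mult_distrib[symmetric] exp_minus)
  finally have "card {G\<in>\<G>. G \<inter> H = {}} = 0" using H(3) by linarith
  then have none: "{G\<in>\<G>. G \<inter> H = {}} = {}" using fin\<G> by simp
  have finH: "finite H" using H V finite_subset by auto
  have "Suc M \<le> card (K \<inter> (R \<union> H))" if K: "K \<in> \<F>" for K
  proof -
    have "K - R \<in> \<G>" unfolding \<G>_def using K by auto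
    then have "(K - R) \<inter> H \<noteq> {}" using none by blast
    then obtain v where v: "v \<in> K" "v \<notin> R" "v \<in> H" by auto
    have "Suc M \<le> card (insert v (K \<inter> R))" using R(3) K v finR by auto
    also have "\<dots> \<le> card (K \<inter> (R \<union> H))" using v finR finH by (intro card_mono) auto
    finally show ?thesis .
  qed
  moreover have "card (R \<union> H) \<le> Suc M * r" using R(2) H(2) card_Un_le[of R H] by simp
  ultimately show ?case using R(1) H(1) by (intro exI[of _ "R \<union> H"]) auto
qed

text \<open>
  Derandomisation: if item \<open>i\<close> were assigned to \<open>j\<close> with probability \<^term>\<open>\<omega> j\<close>, the expected
  sum of squared deviations would grow by at most \<^term>\<open>(x i)\<^sup>2 + (y i)\<^sup>2\<close> in each step.
\<close>

lemma balanced_assignment: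
  fixes x y :: "nat \<Rightarrow> real" and \<omega> :: "'j \<Rightarrow> real"
  assumes J: "finite J" and \<omega>: "\<And>j. j \<in> J \<Longrightarrow> 0 < \<omega> j" "(\<Sum>j\<in>J. \<omega> j) = 1"
  shows "\<exists>a. (\<forall>i<r. a i \<in> J) \<and>
     (\<Sum>j\<in>J. ((\<Sum>i\<in>{i. i < r \<and> a i = j}. x i) - \<omega> j * (\<Sum>i<r. x i))\<^sup>2
           + ((\<Sum>i\<in>{i. i < r \<and> a i = j}. y i) - \<omega> j * (\<Sum>i<r. y i))\<^sup>2)
     \<le> (\<Sum>i<r. (x i)\<^sup>2 + (y i)\<^sup>2)"
proof (induction r)
  case 0
  then show ?case by auto
next
  case (Suc r)
  then obtain a where a: "\<forall>i<r. a i \<in> J" and le: "(\<Sum>j\<in>J. ((\<Sum>i\<in>{i. i < r \<and> a i = j}. x i) - \<omega> j * (\<Sum>i<r. x i))\<^sup>2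
           + ((\<Sum>i\<in>{i. i < r \<and> a i = j}. y i) - \<omega> j * (\<Sum>i<r. y i))\<^sup>2)
     \<le> (\<Sum>i<r. (x i)\<^sup>2 + (y i)\<^sup>2)" by blast
  define D where "D z j = (\<Sum>i\<in>{i. i < r \<and> a i = j}. z i) - \<omega> j * (\<Sum>i<r. z i)" for z :: "nat \<Rightarrow> real" and j
  define W where "W = (\<Sum>j\<in>J. (\<omega> j)\<^sup>2)"
  define Db where "Db z = (\<Sum>j\<in>J. \<omega> j * D z j)" for z
  \<comment> \<open>The increase of the sum of squares of \<open>D z\<close> if item
    \<open>r\<close> goes to \<open>k\<close>. Its average with weights \<open>\<omega>\<close> is
    \<open>(z r)\<^sup>2 * (1 - W)\<close>, so some \<open>k\<close> is good enough for
    \<open>x\<close> and \<open>y\<close> together.\<close>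
  define g where "g z k = 2 * z r * (D z k - Db z) + (z r)\<^sup>2 * (1 - 2 * \<omega> k + W)" for z k
  have avg: "(\<Sum>k\<in>J. \<omega> k * g z k) = (z r)\<^sup>2 * (1 - W)" for z
  proof -
    have "(\<Sum>k\<in>J. \<omega> k * g z k) = (\<Sum>k\<in>J. 2 * z r * (\<omega> k * D z k) - 2 * z r * Db z * \<omega> k
        + ((z r)\<^sup>2 * (1 + W) * \<omega> k - 2 * (z r)\<^sup>2 * (\<omega> k)\<^sup>2))"
      unfolding g_def by (intro sum.cong refl) (simp add: algebra_simps power2_eq_square)
    also have "\<dots> = 2 * z r * (\<Sum>k\<in>J. \<omega> k * D z k) - 2 * z r * Db z * (\<Sum>k\<in>J. \<omega> k)
        + ((z r)\<^sup>2 * (1 + W) * (\<Sum>k\<in>J. \<omega> k) - 2 * (z r)\<^sup>2 * (\<Sum>k\<in>J. (\<omega> k)\<^sup>2))"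
      by (simp only: sum.distrib sum_subtractf sum_distrib_left)
    also have "\<dots> = (z r)\<^sup>2 * (1 - W)" unfolding \<omega>(2) Db_def[symmetric] W_def[symmetric] by (simp add: algebra_simps)
    finally show ?thesis .
  qed
  have W0: "0 \<le> W" unfolding W_def by (simp add: sum_nonneg)
  have "\<exists>k\<in>J. g x k + g y k \<le> (x r)\<^sup>2 + (y r)\<^sup>2"
  proof (rule ccontr)
    assume "\<not> ?thesis"
    then have gt: "(x r)\<^sup>2 + (y r)\<^sup>2 < g x k + g y k" if "k \<in> J" for k using that by auto
    have ne: "J \<noteq> {}" using \<omega>(2) by auto
    have "(x r)\<^sup>2 + (y r)\<^sup>2 = (\<Sum>k\<in>J. \<omega> k * ((x r)\<^sup>2 + (y r)\<^sup>2))"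
      using \<omega>(2) by (simp add: sum_distrib_right[symmetric])
    also have "\<dots> < (\<Sum>k\<in>J. \<omega> k * (g x k + g y k))"
      using J ne gt \<omega>(1) by (intro sum_strict_mono) auto
    also have "\<dots> = (x r)\<^sup>2 * (1 - W) + (y r)\<^sup>2 * (1 - W)"
      by (simp only: distrib_left sum.distrib avg)
    also have "\<dots> \<le> (x r)\<^sup>2 + (y r)\<^sup>2" using W0 by (simp add: algebra_simps)
    finally show False by simp
  qed
  then obtain k where k: "k \<in> J" "g x k + g y k \<le> (x r)\<^sup>2 + (y r)\<^sup>2" by auto
  define a' where "a' = a(r := k)"
  have new: "(\<Sum>i\<in>{i. i < Suc r \<and> a' i = j}. z i) - \<omega> j * (\<Sum>i<Suc r. z i)
      = D z j + z r * (of_bool (j = k) - \<omega> j)" for z :: "nat \<Rightarrow> real" and j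
  proof (cases "j = k")
    case True
    have "{i. i < Suc r \<and> a' i = j} = insert r {i. i < r \<and> a i = j}"
      unfolding a'_def using True by (auto simp: less_Suc_eq)
    then have "(\<Sum>i\<in>{i. i < Suc r \<and> a' i = j}. z i) = z r + (\<Sum>i\<in>{i. i < r \<and> a i = j}. z i)" by simp
    then show ?thesis using True by (simp add: D_def algebra_simps)
  next
    case False
    have "{i. i < Suc r \<and> a' i = j} = {i. i < r \<and> a i = j}"
      unfolding a'_def using False by (auto simp: less_Suc_eq)
    then show ?thesis using False by (simp add: D_def algebra_simps)
  qed
  have sq: "(\<Sum>j\<in>J. (D z j + z r * (of_bool (j = k) - \<omega> j))\<^sup>2) = (\<Sum>j\<in>J. (D z j)\<^sup>2) + g z k" for z
  proof -
    have "(\<Sum>j\<in>J. (D z j + z r * (of_bool (j = k) - \<omega> j))\<^sup>2)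
      = (\<Sum>j\<in>J. (D z j)\<^sup>2 + (if j = k then 2 * z r * D z j + (z r)\<^sup>2 * (1 - 2 * \<omega> j) else 0)
          - 2 * z r * (\<omega> j * D z j) + (z r)\<^sup>2 * (\<omega> j)\<^sup>2)"
      by (intro sum.cong refl) (auto simp: power2_eq_square algebra_simps)
    also have "\<dots> = (\<Sum>j\<in>J. (D z j)\<^sup>2) + (2 * z r * D z k + (z r)\<^sup>2 * (1 - 2 * \<omega> k))
        - 2 * z r * Db z + (z r)\<^sup>2 * W"
      unfolding sum.distrib sum_subtractf Db_def W_def sum_distrib_left using J k(1) by simp
    finally show ?thesis unfolding g_def by (simp add: algebra_simps)
  qed
  have "(\<Sum>j\<in>J. (D x j + x r * (of_bool (j = k) - \<omega> j))\<^sup>2 + (D y j + y r * (of_bool (j = k) - \<omega> j))\<^sup>2)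
     = (\<Sum>j\<in>J. (D x j)\<^sup>2 + (D y j)\<^sup>2) + (g x k + g y k)"
    unfolding sum.distrib sq by simp
  also have "\<dots> \<le> (\<Sum>i<r. (x i)\<^sup>2 + (y i)\<^sup>2) + ((x r)\<^sup>2 + (y r)\<^sup>2)"
    by (rule add_mono[OF le[folded D_def] k(2)])
  finally have fin: "(\<Sum>j\<in>J. (D x j + x r * (of_bool (j = k) - \<omega> j))\<^sup>2 + (D y j + y r * (of_bool (j = k) - \<omega> j))\<^sup>2)
    \<le> (\<Sum>i<r. (x i)\<^sup>2 + (y i)\<^sup>2) + ((x r)\<^sup>2 + (y r)\<^sup>2)" .
  show ?case
  proof (intro exI[of _ a'] conjI)
    show "\<forall>i<Suc r. a' i \<in> J" using a k(1) by (auto simp: a'_def less_Suc_eq)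
  qed (unfold new, use fin in simp)
qed

section \<open>Cutting trees into pieces\<close>

text \<open>\<open>par\<close> is irrelevant for the first element, the root.\<close>

definition parent_order :: "('b \<Rightarrow> 'b) \<Rightarrow> 'b list \<Rightarrow> bool" where
  "parent_order par vs \<longleftrightarrow> distinct vs \<and> (\<forall>xs v ys. vs = xs @ v # ys \<longrightarrow> xs \<noteq> [] \<longrightarrow> par v \<in> set xs)"

lemma filter_eq_appendE:
  assumes "filter S vs = xs @ ys"
  obtains us zs where "vs = us @ zs" "filter S us = xs" "filter S zs = ys"
  using assms
proof (induction vs arbitrary: xs thesis)
  case Nil
  then show ?case by auto
next
  case (Cons v vs)
  show ?case
  proof (cases "S v \<and> xs \<noteq> []")
    case True
    then obtain xs' where xs': "xs = v # xs'" "filter S vs = xs' @ ys" using Cons.prems(2) by (cases xs) auto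
    obtain us zs where "vs = us @ zs" "filter S us = xs'" "filter S zs = ys" using Cons.IH[OF _ xs'(2)] by blast
    then show ?thesis using Cons.prems(1)[of "v # us" zs] True xs'(1) by simp
  next
    case False
    show ?thesis
    proof (cases "S v")
      case True
      then show ?thesis using Cons.prems(1)[of "[]" "v # vs"] Cons.prems(2) False by simp
    next
      case nS: False
      then have "filter S vs = xs @ ys" using Cons.prems(2) by simp
      then obtain us zs where "vs = us @ zs" "filter S us = xs" "filter S zs = ys" using Cons.IH by blast
      then show ?thesis using Cons.prems(1)[of "v # us" zs] nS by simp
    qed
  qed
qed

text \<open>Serves both parts of a cut: the subtree that is removed and the rest of the
  tree.\<close>

lemma parent_order_filter:
  assumes vs: "parent_order par vs"
    and closed: "\<And>v. v \<in> set vs \<Longrightarrow> S v \<Longrightarrow> v \<noteq> hd (filter S vs) \<Longrightarrow> S (par v)"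
  shows "parent_order par (filter S vs)"
  unfolding parent_order_def
proof (intro conjI allI impI)
  show "distinct (filter S vs)" using vs unfolding parent_order_def by simp
  fix xs v ys assume eq: "filter S vs = xs @ v # ys" and ne: "xs \<noteq> []"
  obtain us zs where us: "vs = us @ zs" "filter S us = xs" "filter S zs = v # ys"
    by (rule filter_eq_appendE[OF eq])
  obtain as bs where ab: "zs = as @ v # bs" "\<forall>u\<in>set as. \<not> S u" "S v"
    using us(3) by (auto simp: filter_eq_Cons_iff)
  have "us \<noteq> []" using us(2) ne by auto
  then have "par v \<in> set (us @ as)" using vs us(1) ab(1) unfolding parent_order_def by (metis append.assoc append_is_Nil_conv)
  have "distinct (filter S vs)" using vs unfolding parent_order_def by simp
  then have "v \<noteq> hd (filter S vs)" using eq ne by (cases xs) auto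
  then have "S (par v)" using closed[of v] us(1) ab by auto
  then show "par v \<in> set xs" using \<open>par v \<in> set (us @ as)\<close> us(2) ab(2) by auto
qed

lemma parent_order_in:
  assumes "parent_order par vs" "v \<in> set (tl vs)"
  shows "par v \<in> set vs" "v \<in> set vs"
proof -
  obtain u ws where "vs = u # ws" using assms(2) by (cases vs) auto
  then obtain xs ys where "ws = xs @ v # ys" using assms(2) by (auto simp: in_set_conv_decomp)
  then have "vs = (u # xs) @ v # ys" using \<open>vs = u # ws\<close> by simp
  then show "par v \<in> set vs" using assms(1) unfolding parent_order_def by (metis Un_iff list.distinct(1) set_append)
  show "v \<in> set vs" using \<open>vs = u # ws\<close> assms(2) by simp
qed

definition child_rel :: "('b \<Rightarrow> 'b) \<Rightarrow> 'b list \<Rightarrow> ('b \<times> 'b) set" where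
  "child_rel par vs = {(par v, v) |v. v \<in> set (tl vs)}"

lemma parent_order_butlast:
  "parent_order par (vs @ [v]) \<Longrightarrow> parent_order par vs"
  unfolding parent_order_def by (auto simp: append_assoc)

lemma acyclic_child_rel: "parent_order par vs \<Longrightarrow> acyclic (child_rel par vs)"
proof (induction vs rule: rev_induct)
  case Nil
  then show ?case by (simp add: child_rel_def acyclic_def)
next
  case (snoc v vs)
  note po = parent_order_butlast[OF snoc.prems]
  show ?case
  proof (cases vs)
    case Nil
    then show ?thesis by (simp add: child_rel_def acyclic_def)
  next
    case (Cons u us)
    have eq: "child_rel par (vs @ [v]) = insert (par v, v) (child_rel par vs)"
      unfolding child_rel_def using Cons by auto
    have v: "v \<notin> set vs" using snoc.prems unfolding parent_order_def by auto
    have pv: "par v \<in> set vs" using snoc.prems Cons unfolding parent_order_def by blast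
    have "(v, par v) \<notin> (child_rel par vs)\<^sup>*"
    proof
      assume "(v, par v) \<in> (child_rel par vs)\<^sup>*"
      then show False
      proof (cases rule: converse_rtranclE)
        case base
        then show ?thesis using v pv by auto
      next
        case (step y)
        then have "v \<in> set vs" using parent_order_in(1)[OF po] unfolding child_rel_def by auto
        then show ?thesis using v by auto
      qed
    qed
    then show ?thesis unfolding eq acyclic_insert using snoc.IH[OF po] by simp
  qed
qed

lemma hd_ancestor:
  assumes "parent_order par vs" "v \<in> set vs"
  shows "(hd vs, v) \<in> (child_rel par vs)\<^sup>*"
  using assms
proof (induction vs arbitrary: v rule: rev_induct)
  case Nil
  then show ?case by simp
next
  case (snoc w vs)
  note po = parent_order_butlast[OF snoc.prems(1)]
  show ?case
  proof (cases vs)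
    case Nil
    then show ?thesis using snoc.prems by simp
  next
    case (Cons u us)
    have eq: "child_rel par (vs @ [w]) = insert (par w, w) (child_rel par vs)"
      unfolding child_rel_def using Cons by auto
    have hd: "hd (vs @ [w]) = hd vs" using Cons by simp
    have old: "(hd vs, x) \<in> (child_rel par (vs @ [w]))\<^sup>*" if "x \<in> set vs" for x
      using snoc.IH[OF po that] rtrancl_mono[of "child_rel par vs" "child_rel par (vs @ [w])"] eq by blast
    have pw: "par w \<in> set vs" using snoc.prems(1) Cons unfolding parent_order_def by blast
    have "(hd vs, w) \<in> (child_rel par (vs @ [w]))\<^sup>*"
      using old[OF pw] by (rule rtrancl_into_rtrancl) (simp add: eq)
    then show ?thesis using old snoc.prems(2) hd by auto
  qed
qed

definition piece_order :: "('b \<Rightarrow> 'b) \<Rightarrow> 'b list list \<Rightarrow> bool" where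
  "piece_order par ps \<longleftrightarrow> distinct (concat ps) \<and> (\<forall>p\<in>set ps. p \<noteq> [] \<and> parent_order par p) \<and>
     (\<forall>qs p rs. ps = qs @ p # rs \<longrightarrow> qs \<noteq> [] \<longrightarrow> par (hd p) \<in> set (concat qs))"

text \<open>A smallest subtree with at least \<open>s\<close> vertices is cut off. The subtrees at
  the children of its root are smaller than \<open>s\<close>, so it has at most
  \<open>\<Delta> * s + 1\<close> vertices. Every piece except possibly the one with the root of the
  tree has at least \<open>s\<close> vertices; that exception accounts for the last summand
  \<open>s\<close> in the bound on the number of pieces.\<close>

lemma cut_tree:
  assumes "parent_order par vs" "vs \<noteq> []" "\<And>u. card {v \<in> set (tl vs). par v = u} \<le> \<Delta>" "1 \<le> s"
  shows "\<exists>ps. piece_order par ps \<and> set (concat ps) = set vs \<and> ps \<noteq> [] \<and> hd (hd ps) = hd vs \<and>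
     (\<forall>p\<in>set ps. length p \<le> (\<Delta> + 1) * s) \<and> s * length ps \<le> length vs + s"
  using assms
proof (induction "length vs" arbitrary: vs rule: less_induct)
  case less
  note po = less.prems(1)
  have dist: "distinct vs" using po unfolding parent_order_def by simp
  define r where "r = child_rel par vs"
  define D where "D v = {w \<in> set vs. (v, w) \<in> r\<^sup>*}" for v
  have finD: "finite (D v)" for v unfolding D_def by auto
  show ?case
  proof (cases "length vs < s")
    case True
    have "length vs \<le> (\<Delta> + 1) * s" using True by simp
    then show ?thesis using less.prems dist
      by (intro exI[of _ "[vs]"]) (auto simp: piece_order_def Cons_eq_append_conv)
  next
    case False
    have "D (hd vs) = set vs" unfolding D_def r_def using hd_ancestor[OF po] by auto
    then have "s \<le> card (D (hd vs))" using False dist by (simp add: distinct_card)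
    then obtain x where x: "x \<in> set vs \<and> s \<le> card (D x)"
      and xmin: "\<And>z. z \<in> set vs \<and> s \<le> card (D z) \<Longrightarrow> card (D x) \<le> card (D z)"
      using exists_least_iff[of "\<lambda>n. \<exists>z. z \<in> set vs \<and> s \<le> card (D z) \<and> card (D z) = n"] less.prems(2)
      by (metis hd_in_set not_less)
    define ch where "ch = {v \<in> set (tl vs). par v = x}"
    have small: "card (D v) \<le> s" if "v \<in> ch" for v
    proof -
      have vr: "(x, v) \<in> r" using that unfolding ch_def r_def child_rel_def by auto
      have "D v \<subseteq> D x" unfolding D_def using vr by (auto intro: converse_rtrancl_into_rtrancl)
      moreover have "x \<notin> D v"
      proof
        assume "x \<in> D v"
        then have "(v, x) \<in> r\<^sup>*" unfolding D_def by auto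
        then have "(x, x) \<in> r\<^sup>+" using vr by (rule rtrancl_into_trancl2[rotated])
        then show False using acyclic_child_rel[OF po] unfolding r_def acyclic_def by blast
      qed
      moreover have "x \<in> D x" unfolding D_def using x by auto
      ultimately have "card (D v) < card (D x)" using finD by (intro psubset_card_mono) auto
      moreover have "v \<in> set vs" using parent_order_in(2)[OF po] that unfolding ch_def by auto
      ultimately show ?thesis using xmin[of v] by force
    qed
    have "D x \<subseteq> insert x (\<Union>v\<in>ch. D v)"
    proof
      fix w assume w: "w \<in> D x"
      then have "(x, w) \<in> r\<^sup>*" unfolding D_def by auto
      then show "w \<in> insert x (\<Union>v\<in>ch. D v)"
      proof (cases rule: converse_rtranclE)
        case base
        then show ?thesis by simp
      next
        case (step v)
        then have "v \<in> ch" unfolding ch_def r_def child_rel_def by auto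
        moreover have "w \<in> D v" using w step(2) unfolding D_def by auto
        ultimately show ?thesis by auto
      qed
    qed
    then have "card (D x) \<le> card (insert x (\<Union>v\<in>ch. D v))"
      using finD unfolding ch_def by (intro card_mono) auto
    also have "\<dots> \<le> 1 + card (\<Union>v\<in>ch. D v)" by (simp add: card_insert_le_m1 card_insert_if finD ch_def)
    also have "card (\<Union>v\<in>ch. D v) \<le> (\<Sum>v\<in>ch. card (D v))" unfolding ch_def by (intro card_UN_le) auto
    also have "\<dots> \<le> (\<Sum>v\<in>ch. s)" using small by (intro sum_mono) auto
    also have "\<dots> = card ch * s" by simp
    also have "\<dots> \<le> \<Delta> * s" using less.prems(3)[of x] unfolding ch_def by (intro mult_right_mono) auto
    finally have Dx: "card (D x) \<le> (\<Delta> + 1) * s" using less.prems(4) by simp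
    define p where "p = filter (\<lambda>v. v \<in> D x) vs"
    define vs' where "vs' = filter (\<lambda>v. v \<notin> D x) vs"
    have setp: "set p = D x" unfolding p_def D_def by auto
    have distp: "distinct p" unfolding p_def using dist by simp
    have lenp: "length p = card (D x)" using distinct_card[OF distp] setp by simp
    have dpar: "par w \<in> D x" if w: "w \<in> D x" "w \<noteq> x" for w
    proof -
      have "(x, w) \<in> r\<^sup>*" using w unfolding D_def by auto
      then obtain z where z: "(x, z) \<in> r\<^sup>*" "(z, w) \<in> r" using w(2) by (metis rtranclE)
      then have "z = par w" "w \<in> set (tl vs)" unfolding r_def child_rel_def by auto
      then show ?thesis unfolding D_def using z(1) parent_order_in(1)[OF po] by auto
    qed
    have upar: "par w \<notin> D x" if "w \<in> set (tl vs)" "w \<notin> D x" for w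
    proof
      assume "par w \<in> D x"
      then have "(x, par w) \<in> r\<^sup>*" unfolding D_def by auto
      moreover have "(par w, w) \<in> r" unfolding r_def child_rel_def using that by auto
      ultimately have "w \<in> D x" unfolding D_def using that parent_order_in(2)[OF po]
        by (auto intro: rtrancl_into_rtrancl)
      then show False using that by auto
    qed
    have pne: "p \<noteq> []" using x setp less.prems(4) finD unfolding D_def by auto
    have hdp: "hd p = x"
    proof (rule ccontr)
      assume ne: "hd p \<noteq> x"
      obtain w p' where wp: "p = w # p'" using pne by (cases p) auto
      obtain us zs where us: "vs = us @ w # zs" "\<forall>u\<in>set us. u \<notin> D x"
        using wp unfolding p_def by (auto simp: filter_eq_Cons_iff)
      have w: "w \<in> D x" "w \<noteq> x" using setp wp ne by auto
      have "x \<in> D x" unfolding D_def using x by auto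
      have "par w \<in> D x" using dpar w by auto
      show False
      proof (cases us)
        case Nil
        then have "w = hd vs" using us by simp
        then have "(w, x) \<in> r\<^sup>*" using hd_ancestor[OF po] x unfolding r_def by auto
        moreover have "(x, w) \<in> r\<^sup>*" using w unfolding D_def by auto
        ultimately have "(x, x) \<in> r\<^sup>+" using w(2)
          by (metis rtranclD rtrancl_trancl_trancl)
        then show ?thesis using acyclic_child_rel[OF po] unfolding r_def acyclic_def by blast
      next
        case (Cons a as)
        then have "par w \<in> set us" using po us(1) unfolding parent_order_def by blast
        then show ?thesis using us(2) \<open>par w \<in> D x\<close> by auto
      qed
    qed
    have pop: "parent_order par p"
      unfolding p_def by (rule parent_order_filter[OF po]) (use dpar hdp p_def in auto)
    show ?thesis
    proof (cases "x = hd vs")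
      case True
      then have "D x = set vs" using \<open>D (hd vs) = set vs\<close> by simp
      then have "length vs \<le> (\<Delta> + 1) * s" using Dx dist by (simp add: distinct_card)
      moreover have "s * 1 \<le> length vs + s" by simp
      ultimately show ?thesis using less.prems dist
        by (intro exI[of _ "[vs]"]) (auto simp: piece_order_def Cons_eq_append_conv)
    next
      case False
      have hdD: "hd vs \<notin> D x"
      proof
        assume "hd vs \<in> D x"
        then have "(x, hd vs) \<in> r\<^sup>*" unfolding D_def by auto
        moreover have "(hd vs, x) \<in> r\<^sup>*" using hd_ancestor[OF po] x unfolding r_def by auto
        ultimately have "(x, x) \<in> r\<^sup>+" using False by (metis rtranclD rtrancl_trancl_trancl)
        then show False using acyclic_child_rel[OF po] unfolding r_def acyclic_def by blast
      qed
      obtain u us where vs: "vs = u # us" using less.prems(2) by (cases vs) auto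
      have vs': "vs' = u # filter (\<lambda>v. v \<notin> D x) us" unfolding vs'_def using hdD vs by simp
      have po': "parent_order par vs'"
        unfolding vs'_def
      proof (rule parent_order_filter[OF po])
        fix v assume v: "v \<in> set vs" "v \<notin> D x" "v \<noteq> hd (filter (\<lambda>v. v \<notin> D x) vs)"
        then have "v \<in> set (tl vs)" using vs' vs unfolding vs'_def by auto
        then show "par v \<notin> D x" using upar v by auto
      qed
      have len: "length vs = length p + length vs'"
        unfolding p_def vs'_def by (rule sum_length_filter_compl[symmetric])
      have "length vs' < length vs" using len pne by simp
      moreover have "card {v \<in> set (tl vs'). par v = w} \<le> \<Delta>" for w
      proof -
        have "card {v \<in> set (tl vs'). par v = w} \<le> card {v \<in> set (tl vs). par v = w}"
          unfolding vs' vs by (intro card_mono) auto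
        then show ?thesis using less.prems(3)[of w] by linarith
      qed
      ultimately obtain ps where ps: "piece_order par ps" "set (concat ps) = set vs'" "ps \<noteq> []"
        "hd (hd ps) = hd vs'" "\<forall>p\<in>set ps. length p \<le> (\<Delta> + 1) * s" "s * length ps \<le> length vs' + s"
        using less.hyps[of vs'] po' vs' less.prems(4) by blast
      have xtl: "x \<in> set (tl vs)" using x False vs by auto
      have parx: "par x \<in> set vs'"
      proof -
        have "par x \<notin> D x"
        proof
          assume "par x \<in> D x"
          then have "(x, par x) \<in> r\<^sup>*" unfolding D_def by auto
          moreover have "(par x, x) \<in> r" unfolding r_def child_rel_def using xtl by auto
          ultimately have "(x, x) \<in> r\<^sup>+" by (rule rtrancl_into_trancl1)
          then show False using acyclic_child_rel[OF po] unfolding r_def acyclic_def by blast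
        qed
        then show ?thesis using parent_order_in(1)[OF po xtl] unfolding vs'_def by auto
      qed
      \<comment> \<open>The subtree hangs below a vertex of the rest, so it may come last;
        everything attached to its vertices belongs to it.\<close>
      have "piece_order par (ps @ [p])"
        unfolding piece_order_def
      proof (intro conjI ballI allI impI)
        show "distinct (concat (ps @ [p]))"
          using ps(1,2) distp setp unfolding piece_order_def vs'_def by auto
        show "q \<noteq> []" "parent_order par q" if "q \<in> set (ps @ [p])" for q
          using that ps(1) pne pop unfolding piece_order_def by auto
        fix qs q rs assume eq: "ps @ [p] = qs @ q # rs" and ne: "qs \<noteq> []"
        show "par (hd q) \<in> set (concat qs)"
        proof (cases rs rule: rev_cases)
          case Nil
          then have "q = p" "qs = ps" using eq by auto
          then show ?thesis using parx hdp ps(2) by simp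
        next
          case (snoc rs' z)
          then have "ps = qs @ q # rs'" using eq by auto
          then show ?thesis using ps(1) ne unfolding piece_order_def by blast
        qed
      qed
      moreover have "set (concat (ps @ [p])) = set vs" using ps(2) setp unfolding vs'_def D_def by auto
      moreover have "hd (hd (ps @ [p])) = hd vs" using ps(3,4) vs' vs by simp
      moreover have "\<forall>q\<in>set (ps @ [p]). length q \<le> (\<Delta> + 1) * s" using ps(5) lenp Dx by auto
      moreover have "s * length (ps @ [p]) \<le> length vs + s"
        using ps(6) len lenp x by simp
      ultimately show ?thesis by blast
    qed
  qed
qed

section \<open>Oriented trees as parent orders\<close>

lemma parent_order_snoc:
  assumes "parent_order par xs" "w \<notin> set xs" "u \<in> set xs"
  shows "parent_order (par(w := u)) (xs @ [w])"
  unfolding parent_order_def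
proof (intro conjI allI impI)
  show "distinct (xs @ [w])" using assms unfolding parent_order_def by simp
  fix ys v zs assume eq: "xs @ [w] = ys @ v # zs" and ne: "ys \<noteq> []"
  show "(par(w := u)) v \<in> set ys"
  proof (cases zs rule: rev_cases)
    case Nil
    then show ?thesis using eq assms by auto
  next
    case (snoc zs' z)
    then have "xs = ys @ v # zs'" using eq by auto
    then show ?thesis using assms(1,2) ne unfolding parent_order_def by auto
  qed
qed

lemma parent_order_prefix: "parent_order par (xs @ ys) \<Longrightarrow> parent_order par xs"
  by (induction ys rule: rev_induct) (simp, metis append.assoc parent_order_butlast)

lemma pcas_append: "pcas u (p @ q) w \<longleftrightarrow> (\<exists>x. pcas u p x \<and> pcas x q w)"
  by (induction p arbitrary: u) auto

lemma pawalk_verts_append: "pcas u p w \<Longrightarrow> pcas w q z \<Longrightarrow> pawalk_verts u (p @ q) = pawalk_verts u p @ tl (pawalk_verts w q)"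
  by (induction p arbitrary: u) (cases q, auto)

lemma parcs_mk_symmetric_proj:
  "(u, v) \<in> parcs (mk_symmetric (with_proj T)) \<longleftrightarrow> (u, v) \<in> parcs T \<or> (v, u) \<in> parcs T"
  by (auto simp: mk_symmetric_def intro: bexI[of _ "(v, u)"])

lemma (in pair_wf_digraph) exists_simple_walk:
  assumes "(a, b) \<in> (parcs G)\<^sup>*" "a \<in> pverts G"
  shows "\<exists>p. pcas a p b \<and> set p \<subseteq> parcs G \<and> distinct (pawalk_verts a p) \<and> set (pawalk_verts a p) \<subseteq> pverts G"
proof -
  have "reachable (with_proj G) a b" using assms reachable_conv' by simp
  then obtain p where "awalk a p b" using reachable_awalk by auto
  then have "apath a (awalk_to_apath p) b" by (rule apath_awalk_to_apath)
  then show ?thesis unfolding apath_def awalk_conv by (auto simp: awalk_def)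
qed

context oriented_tree
begin

abbreviation "Sym \<equiv> mk_symmetric (with_proj G)"

definition adj :: "'a \<Rightarrow> 'a \<Rightarrow> bool" where
  "adj u v \<longleftrightarrow> (u, v) \<in> parcs G \<or> (v, u) \<in> parcs G"

lemma adj_in_verts': "adj u v \<Longrightarrow> u \<in> pverts G \<and> v \<in> pverts G"
  unfolding adj_def using arc_fst_in_verts arc_snd_in_verts by fastforce

lemma parcs_Sym: "(u, v) \<in> parcs Sym \<longleftrightarrow> adj u v"
  unfolding parcs_mk_symmetric_proj adj_def ..

lemma pverts_Sym: "pverts Sym = pverts G"
  unfolding mk_symmetric_def by simp

lemma verts_nonempty: "pverts G \<noteq> {}"
  using tree_connected unfolding connected_def strongly_connected_def by (simp add: pverts_Sym)

lemma crossing_edge: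
  assumes "S \<subseteq> pverts G" "S \<noteq> {}" "S \<noteq> pverts G"
  shows "\<exists>u\<in>S. \<exists>w\<in>pverts G - S. adj u w"
proof (rule ccontr)
  assume no: "\<not> ?thesis"
  obtain a b where ab: "a \<in> S" "b \<in> pverts G" "b \<notin> S" using assms by auto
  have "reachable (with_proj Sym) a b"
    using tree_connected ab assms(1) unfolding connected_def strongly_connected_def by (auto simp: pverts_Sym)
  then have "(a, b) \<in> (parcs Sym)\<^sup>*" using reachable_rtranclI by fastforce
  then have "b \<in> S"
  proof (induction rule: rtrancl_induct)
    case base
    then show ?case by (rule ab(1))
  next
    case (step y z)
    then show ?case using no adj_in_verts' parcs_Sym by blast
  qed
  then show False using ab by simp
qed

lemma exists_growth_order:
  assumes "1 \<le> m" "m \<le> card (pverts G)"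
  shows "\<exists>par vs. parent_order par vs \<and> length vs = m \<and> set vs \<subseteq> pverts G \<and> (\<forall>v\<in>set (tl vs). adj (par v) v)"
  using assms
proof (induction m rule: dec_induct)
  case base
  obtain v where "v \<in> pverts G" using verts_nonempty by auto
  then show ?case by (intro exI[of _ id] exI[of _ "[v]"]) (auto simp: parent_order_def Cons_eq_append_conv)
next
  case (step m)
  then obtain par vs where vs: "parent_order par vs" "length vs = m" "set vs \<subseteq> pverts G"
    "\<forall>v\<in>set (tl vs). adj (par v) v" by auto
  have dist: "distinct vs" using vs(1) unfolding parent_order_def by simp
  have ne: "vs \<noteq> []" using vs(2) step by auto
  have "card (set vs) < card (pverts G)" using dist vs(2) step by (simp add: distinct_card)
  then obtain u w where uw: "u \<in> set vs" "w \<in> pverts G" "w \<notin> set vs" "adj u w"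
  proof -
    have "set vs \<noteq> pverts G" using \<open>card (set vs) < card (pverts G)\<close> by auto
    then show ?thesis using crossing_edge[OF vs(3)] ne that by blast
  qed
  have "\<forall>v\<in>set (tl (vs @ [w])). adj ((par(w := u)) v) v"
  proof
    fix v assume "v \<in> set (tl (vs @ [w]))"
    then have "v = w \<or> v \<in> set (tl vs)" using ne by auto
    then show "adj ((par(w := u)) v) v" using uw vs(4) ne by (cases "v = w") auto
  qed
  moreover have "length (vs @ [w]) = Suc m" "set (vs @ [w]) \<subseteq> pverts G" using vs(2,3) uw(2) by auto
  ultimately show ?case using parent_order_snoc[OF vs(1) uw(3,1)] by blast
qed

text \<open>The earlier vertices are connected among themselves by parent edges. A second neighbour
  of \<open>v\<close> among them would thus close a cycle through \<open>v\<close>.\<close>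

lemma no_second_earlier_neighbour:
  assumes po: "parent_order par (xs @ v # ys)" and sub: "set (xs @ v # ys) \<subseteq> pverts G"
    and padj: "\<forall>w\<in>set (tl (xs @ v # ys)). adj (par w) w"
    and u: "u \<in> set xs" "adj u v"
  shows "u = par v"
proof (rule ccontr)
  assume ne: "u \<noteq> par v"
  have xs: "xs \<noteq> []" using u by auto
  have pox: "parent_order par xs" by (rule parent_order_prefix[OF po])
  have pv: "par v \<in> set xs" using po xs unfolding parent_order_def by blast
  have vx: "v \<notin> set xs" using po unfolding parent_order_def by simp
  have vtl: "v \<in> set (tl (xs @ v # ys))" using xs by (cases xs) auto
  \<comment> \<open>Restricting to the earlier vertices keeps the path away from \<open>v\<close>.
    As \<open>u\<close> differs from \<open>par v\<close>, the path is nonempty, so the cycle has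
    length at least 3.\<close>
  define H where "H = \<lparr>pverts = set xs, parcs = parcs Sym \<inter> set xs \<times> set xs\<rparr>"
  interpret H: pair_wf_digraph H by unfold_locales (auto simp: H_def)
  have symH: "sym (parcs H)" unfolding H_def sym_def by (auto simp: parcs_mk_symmetric_proj)
  have "child_rel par xs \<subseteq> parcs H"
  proof
    fix e assume "e \<in> child_rel par xs"
    then obtain w where w: "e = (par w, w)" "w \<in> set (tl xs)" unfolding child_rel_def by auto
    then have "w \<in> set (tl (xs @ v # ys))" using xs by (cases xs) auto
    then show "e \<in> parcs H" using w padj parent_order_in[OF pox w(2)] unfolding H_def by (simp add: parcs_Sym)
  qed
  then have reach: "(hd xs, w) \<in> (parcs H)\<^sup>*" if "w \<in> set xs" for w
    using hd_ancestor[OF pox that] rtrancl_mono by blast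
  have "(par v, hd xs) \<in> (parcs H)\<^sup>*"
    using reach[OF pv] sym_rtrancl[OF symH] by (meson symD)
  then have "(par v, u) \<in> (parcs H)\<^sup>*" using reach[OF u(1)] by (rule rtrancl_trans)
  then obtain p where p: "pcas (par v) p u" "set p \<subseteq> parcs H" "distinct (pawalk_verts (par v) p)"
    "set (pawalk_verts (par v) p) \<subseteq> set xs"
    using H.exists_simple_walk[of "par v" u] pv unfolding H_def by auto
  define c where "c = p @ [(u, v), (v, par v)]"
  have "pcas (par v) c (par v)" unfolding c_def pcas_append using p(1) by auto
  moreover have "set c \<subseteq> parcs Sym"
    using p(2) u(2) padj vtl unfolding c_def H_def by (auto simp: parcs_Sym adj_def parcs_mk_symmetric_proj)
  moreover have "par v \<in> pverts Sym" using pv sub by (auto simp: pverts_Sym)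
  moreover have "distinct (tl (pawalk_verts (par v) c))"
  proof -
    have eq: "pawalk_verts (par v) c = pawalk_verts (par v) p @ [v, par v]"
      unfolding c_def using pawalk_verts_append[OF p(1), of "[(u, v), (v, par v)]" "par v"] by simp
    obtain ws where ws: "pawalk_verts (par v) p = par v # ws"
      using p(1) by (cases p) auto
    then show ?thesis unfolding eq using p(3,4) vx pv by auto
  qed
  moreover have "p \<noteq> []" using p(1) ne by auto
  then have "3 \<le> length c" unfolding c_def by (cases p) auto
  ultimately have "pre_digraph.cycle (with_proj Sym) c \<and> 3 \<le> length c"
    unfolding pre_digraph.cycle_def pre_digraph.awalk_def cas_with_proj_eq awalk_verts_with_proj_eq
    by (auto simp: c_def)
  then show False using tree_acyclic unfolding underlying_acyclic_def by blast
qed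

text \<open>A growth order of all vertices exists by connectedness. Of the two ends of an edge one
  comes first, and by \<open>no_second_earlier_neighbour\<close> it is the parent of the
  other.\<close>

lemma exists_tree_order:
  "\<exists>par vs. parent_order par vs \<and> vs \<noteq> [] \<and> set vs = pverts G \<and>
     (\<forall>v\<in>set (tl vs). adj (par v) v) \<and>
     (\<forall>u v. adj u v \<longrightarrow> (v \<in> set (tl vs) \<and> u = par v) \<or> (u \<in> set (tl vs) \<and> v = par u))"
proof -
  have "1 \<le> card (pverts G)" using verts_nonempty pair_finite_verts by (simp add: Suc_leI card_gt_0_iff)
  then obtain par vs where vs: "parent_order par vs" "length vs = card (pverts G)" "set vs \<subseteq> pverts G"
    "\<forall>v\<in>set (tl vs). adj (par v) v" using exists_growth_order[of "card (pverts G)"] by auto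
  have dist: "distinct vs" using vs(1) unfolding parent_order_def by simp
  have setvs: "set vs = pverts G"
    using vs(2,3) dist pair_finite_verts by (intro card_subset_eq) (auto simp: distinct_card)
  have key: "v \<in> set (tl vs) \<and> u = par v" if "adj u v" "vs = xs @ v # ys" "u \<in> set xs" for u v xs ys
  proof -
    have "u = par v"
      using no_second_earlier_neighbour[of par xs v ys u] vs(1,3,4) that by auto
    moreover have "v \<in> set (tl vs)" using that by (cases xs) auto
    ultimately show ?thesis by simp
  qed
  have "(v \<in> set (tl vs) \<and> u = par v) \<or> (u \<in> set (tl vs) \<and> v = par u)" if uv: "adj u v" for u v
  proof -
    have "u \<noteq> v" using uv pair_no_loops unfolding adj_def by fastforce
    have in_vs: "u \<in> set vs" "v \<in> set vs" using adj_in_verts'[OF uv] setvs by auto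
    obtain xs ys where xy: "vs = xs @ v # ys" using in_vs by (meson split_list)
    show ?thesis
    proof (cases "u \<in> set xs")
      case True
      then show ?thesis using key[OF uv xy] by auto
    next
      case False
      then have "u \<in> set ys" using in_vs xy \<open>u \<noteq> v\<close> by auto
      then obtain as bs where "ys = as @ u # bs" by (meson split_list)
      then have "vs = (xs @ v # as) @ u # bs" using xy by simp
      moreover have "adj v u" using uv unfolding adj_def by auto
      ultimately show ?thesis using key[of v u "xs @ v # as" bs] by auto
    qed
  qed
  moreover have "vs \<noteq> []" using setvs verts_nonempty by auto
  ultimately show ?thesis using vs setvs by (intro exI[of _ par] exI[of _ vs]) auto
qed

end

text \<open>\<open>cl\<close> marks the vertices that are tails of arcs and will be mapped to
  out-copies. Both \<open>cl\<close> and the given bipartition flip along every edge, so by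
  connectedness they agree up to an exchange of the classes, and the classes of \<open>cl\<close>
  have equal size.\<close>

lemma antidirected_tree_order:
  fixes T :: "'b pair_pre_digraph"
  assumes T: "oriented_tree T" "antidirected T" "balanced T" and k: "1 \<le> card (parcs T)"
  obtains par vs cl m where "parent_order par vs" "vs \<noteq> []" "set vs = pverts T"
    "\<And>v. v \<in> set (tl vs) \<Longrightarrow> cl v = (\<not> cl (par v))"
    "\<And>u v. (u, v) \<in> parcs T \<Longrightarrow> cl u \<and> \<not> cl v \<and>
       ((v \<in> set (tl vs) \<and> u = par v) \<or> (u \<in> set (tl vs) \<and> v = par u))"
    "\<And>s. card {v \<in> set vs. cl v = s} = m" "2 * m \<le> card (parcs T) + 1"
    "\<And>u. card {v \<in> set (tl vs). par v = u} \<le> max_total_degree T"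
proof -
  interpret oriented_tree T by (rule T(1))
  obtain par vs where vs: "parent_order par vs" "vs \<noteq> []" "set vs = pverts T"
    "\<forall>v\<in>set (tl vs). adj (par v) v"
    "\<forall>u v. adj u v \<longrightarrow> (v \<in> set (tl vs) \<and> u = par v) \<or> (u \<in> set (tl vs) \<and> v = par u)"
    using exists_tree_order by auto
  have dist: "distinct vs" using vs(1) unfolding parent_order_def by simp
  define cl where "cl v = (0 < out_degree (with_proj T) v)" for v
  have out: "cl u" if "(u, v) \<in> parcs T" for u v
  proof -
    have "(u, v) \<in> out_arcs (with_proj T) u" using that by simp
    then show ?thesis unfolding cl_def out_degree_def by (metis card_gt_0_iff empty_iff finite_out_arcs)
  qed
  have inn: "\<not> cl v" if "(u, v) \<in> parcs T" for u v
  proof -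
    have "(u, v) \<in> in_arcs (with_proj T) v" using that by simp
    then have "0 < in_degree (with_proj T) v" unfolding in_degree_def by (metis card_gt_0_iff empty_iff finite_in_arcs)
    moreover have "v \<in> pverts T" using in_arcsD2[OF that] .
    ultimately show ?thesis using T(2) by (auto simp: antidirected_def cl_def)
  qed
  have flip: "cl v = (\<not> cl u)" if "adj u v" for u v using that out inn unfolding adj_def by auto
  have arcs: "cl u \<and> \<not> cl v \<and> ((v \<in> set (tl vs) \<and> u = par v) \<or> (u \<in> set (tl vs) \<and> v = par u))"
    if "(u, v) \<in> parcs T" for u v using that out inn vs(5) unfolding adj_def by blast
  obtain A B where AB: "A \<union> B = pverts T" "A \<inter> B = {}" "parcs T \<subseteq> A \<times> B \<union> B \<times> A" "card A = card B"
    using T(3) unfolding balanced_def bipartition_def by auto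
  have AB_flip: "(v \<in> A) = (u \<notin> A)" if "adj u v" for u v
    using that AB(2,3) unfolding adj_def by auto
  define r where "r = hd vs"
  have rel: "((v \<in> A) = (r \<in> A)) = (cl v = cl r)" if "v \<in> set vs" for v
    using hd_ancestor[OF vs(1) that] unfolding r_def
  proof (induction rule: rtrancl_induct)
    case base
    then show ?case by simp
  next
    case (step y z)
    then have "adj y z" using vs(4) unfolding child_rel_def by auto
    then show ?case using step.IH flip AB_flip by auto
  qed
  have finAB: "finite A" "finite B" using AB(1) pair_finite_verts by (metis finite_Un)+
  have cls: "card {v \<in> set vs. cl v = s} = card A" for s
  proof -
    have "{v \<in> set vs. cl v = s} = A \<or> {v \<in> set vs. cl v = s} = B"
    proof (cases "(r \<in> A) = (cl r = s)")
      case True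
      then have "{v \<in> set vs. cl v = s} = A" using rel AB(1) vs(3) by blast
      then show ?thesis ..
    next
      case False
      then have "{v \<in> set vs. cl v = s} = B" using rel AB(1,2) vs(3) by blast
      then show ?thesis ..
    qed
    then show ?thesis using AB(4) by auto
  qed
  have len: "length vs = 2 * card A"
    using card_Un_disjoint[OF finAB AB(2)] AB(1,4) vs(3) dist by (simp add: distinct_card[symmetric])
  \<comment> \<open>Each vertex other than the root has its own arc to or from its parent; the root
    accounts for the 1 in the bound on \<open>2 * m\<close>. Restricted to the children of
    \<open>u\<close>, the same injection bounds their number by the total degree of
    \<open>u\<close>.\<close>
  define arc where "arc v = (if cl v then (v, par v) else (par v, v))" for v
  have "inj_on arc (set (tl vs))"
  proof (rule inj_onI)
    fix v w assume vw: "v \<in> set (tl vs)" "w \<in> set (tl vs)" "arc v = arc w"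
    show "v = w"
    proof (rule ccontr)
      assume "v \<noteq> w"
      then have "v = par w" "w = par v" using vw(3) unfolding arc_def by (auto split: if_splits)
      then have "(v, w) \<in> child_rel par vs" "(w, v) \<in> child_rel par vs"
        using vw unfolding child_rel_def by auto
      then have "(v, v) \<in> (child_rel par vs)\<^sup>+" by (meson trancl.intros)
      then show False using acyclic_child_rel[OF vs(1)] unfolding acyclic_def by blast
    qed
  qed
  moreover have "arc ` set (tl vs) \<subseteq> parcs T"
  proof (rule image_subsetI)
    fix v assume "v \<in> set (tl vs)"
    then have "adj (par v) v" using vs(4) by auto
    then show "arc v \<in> parcs T" using out inn unfolding arc_def adj_def by auto
  qed
  ultimately have "card (set (tl vs)) \<le> card (parcs T)"
    using pair_finite_arcs by (metis card_image card_mono)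
  then have m: "2 * card A \<le> card (parcs T) + 1"
    using dist len vs(2) by (simp add: distinct_card distinct_tl)
  have "card {v \<in> set (tl vs). par v = u} \<le> max_total_degree T" for u
  proof (cases "{v \<in> set (tl vs). par v = u} = {}")
    case False
    then obtain v0 where "v0 \<in> set (tl vs)" "par v0 = u" by auto
    then have u: "u \<in> pverts T" using vs(4) adj_in_verts' by auto
    let ?X = "{v \<in> set (tl vs). par v = u}"
    have "inj_on arc ?X" using \<open>inj_on arc (set (tl vs))\<close> by (rule inj_on_subset) auto
    moreover have "arc ` ?X \<subseteq> in_arcs (with_proj T) u \<union> out_arcs (with_proj T) u"
    proof (rule image_subsetI)
      fix v assume "v \<in> ?X"
      then have "arc v \<in> parcs T" "par v = u" using \<open>arc ` set (tl vs) \<subseteq> parcs T\<close> by auto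
      then show "arc v \<in> in_arcs (with_proj T) u \<union> out_arcs (with_proj T) u"
        by (cases "cl v") (simp_all add: arc_def)
    qed
    moreover have "finite (in_arcs (with_proj T) u \<union> out_arcs (with_proj T) u)"
      by (intro finite_UnI finite_in_arcs finite_out_arcs)
    ultimately have "card ?X \<le> card (in_arcs (with_proj T) u \<union> out_arcs (with_proj T) u)"
      by (meson card_inj_on_le)
    also have "\<dots> \<le> total_degree T u"
      unfolding total_degree_def in_degree_def out_degree_def by (rule card_Un_le)
    also have "\<dots> \<le> max_total_degree T"
      unfolding max_total_degree_def using u pair_finite_verts by (intro Max_ge) auto
    finally show ?thesis .
  qed (simp only: card.empty)
  moreover have "cl v = (\<not> cl (par v))" if "v \<in> set (tl vs)" for v using flip vs(4) that by auto
  ultimately show thesis using that[OF vs(1-3) _ arcs cls m] by blast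
qed

lemma contains_copyI:
  fixes \<phi> :: "'b \<Rightarrow> 'a"
  assumes D: "pair_wf_digraph D" and T: "pair_wf_digraph T"
    and inj: "inj_on \<phi> (pverts T)" and verts: "\<phi> ` pverts T \<subseteq> pverts D"
    and arcs: "\<And>u v. (u, v) \<in> parcs T \<Longrightarrow> (\<phi> u, \<phi> v) \<in> parcs D"
  shows "contains_copy D T"
proof -
  interpret D: pair_wf_digraph D by (rule D)
  interpret T: pair_wf_digraph T by (rule T)
  define f where "f = \<lparr>iso_verts = \<phi>, iso_arcs = map_prod \<phi> \<phi>, iso_head = snd, iso_tail = fst\<rparr>"
  define H where "H = \<lparr>pverts = \<phi> ` pverts T, parcs = map_prod \<phi> \<phi> ` parcs T\<rparr>"
  interpret H: pair_wf_digraph H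
    by unfold_locales (auto simp: H_def dest: T.in_arcsD1 T.in_arcsD2)
  have inj2: "inj_on (map_prod \<phi> \<phi>) (parcs T)"
  proof (rule inj_onI)
    fix e e' assume "e \<in> parcs T" "e' \<in> parcs T" "map_prod \<phi> \<phi> e = map_prod \<phi> \<phi> e'"
    then show "e = e'" using T.in_arcsD1 T.in_arcsD2 inj by (cases e; cases e') (auto simp: inj_on_def)
  qed
  have "pre_digraph.digraph_isomorphism (with_proj T) f"
    unfolding pre_digraph.digraph_isomorphism_def f_def using inj inj2 T.wf_digraph by simp
  moreover have "with_proj H = app_iso f (with_proj T)"
    unfolding app_iso_def f_def H_def with_proj_def by simp
  ultimately have "digraph_iso (with_proj T) (with_proj H)" unfolding digraph_iso_def by blast
  moreover have "subgraph (with_proj H) (with_proj D)"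
    unfolding subgraph_def compatible_def using verts arcs D.wf_digraph H.wf_digraph by (auto simp: H_def)
  ultimately show ?thesis unfolding contains_copy_def by blast
qed

section \<open>Embedding the pieces\<close>

lemma embed_piece:
  fixes nxt :: "'v \<Rightarrow> 'v set" and pr :: "'v \<Rightarrow> 'a"
  assumes x0: "x0 \<in> C" and nxt: "\<And>x. x \<in> C \<Longrightarrow> nxt x \<subseteq> C" "\<And>x. inj_on pr (nxt x)" "\<And>x. finite (nxt x)"
    and room: "\<And>x. x \<in> C \<Longrightarrow> K \<le> card {y \<in> nxt x. pr y \<notin> Used}"
    and p: "parent_order par p" "p \<noteq> []" "length p \<le> K"
  shows "\<exists>\<psi>. \<psi> (hd p) \<in> nxt x0 \<and> (\<forall>v\<in>set (tl p). \<psi> v \<in> nxt (\<psi> (par v))) \<and>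
     inj_on (pr \<circ> \<psi>) (set p) \<and> (\<forall>v\<in>set p. \<psi> v \<in> C \<and> pr (\<psi> v) \<notin> Used)"
  using p
proof (induction p rule: rev_induct)
  case Nil
  then show ?case by simp
next
  case (snoc v p)
  show ?case
  proof (cases "p = []")
    case True
    have "0 < card {y \<in> nxt x0. pr y \<notin> Used}" using room[OF x0] snoc.prems by simp
    then have "{y \<in> nxt x0. pr y \<notin> Used} \<noteq> {}" by (metis card.empty less_irrefl)
    then obtain y where "y \<in> nxt x0" "pr y \<notin> Used" by auto
    then show ?thesis using True nxt(1)[OF x0] by (intro exI[of _ "\<lambda>_. y"]) auto
  next
    case False
    then obtain \<psi> where \<psi>: "\<psi> (hd p) \<in> nxt x0" "\<forall>v\<in>set (tl p). \<psi> v \<in> nxt (\<psi> (par v))"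
      "inj_on (pr \<circ> \<psi>) (set p)" "\<forall>v\<in>set p. \<psi> v \<in> C \<and> pr (\<psi> v) \<notin> Used"
    proof -
      have "length p \<le> K" using snoc.prems(3) by simp
      then show ?thesis using snoc.IH[OF parent_order_butlast[OF snoc.prems(1)] False] that by blast
    qed
    have pv: "par v \<in> set p" using snoc.prems(1) False unfolding parent_order_def by blast
    have vp: "v \<notin> set p" using snoc.prems(1) unfolding parent_order_def by simp
    let ?x = "\<psi> (par v)"
    let ?B = "{y \<in> nxt ?x. pr y \<notin> Used}"
    have x: "?x \<in> C" using \<psi>(4) pv by auto
    have finB: "finite ?B" using nxt(3)[of ?x] by auto
    have inj: "inj_on pr ?B" by (rule inj_on_subset[OF nxt(2)[of ?x]]) auto
    have "card ((pr \<circ> \<psi>) ` set p) \<le> length p" by (meson card_image_le card_length finite_set order_trans)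
    moreover have "Suc (length p) \<le> card (pr ` ?B)"
      using room[OF x] snoc.prems(3) card_image[OF inj] by simp
    ultimately have "\<not> pr ` ?B \<subseteq> (pr \<circ> \<psi>) ` set p"
      by (meson card_mono finite_imageI finite_set le_trans not_less_eq_eq)
    then obtain y where y: "y \<in> ?B" "pr y \<notin> (pr \<circ> \<psi>) ` set p" by blast
    define \<psi>' where "\<psi>' = \<psi>(v := y)"
    have same: "\<psi>' w = \<psi> w" if "w \<in> set p" for w using that vp unfolding \<psi>'_def by auto
    have tlp: "par w \<in> set p" "w \<in> set p" if "w \<in> set (tl p)" for w
      using parent_order_in[OF parent_order_butlast[OF snoc.prems(1)] that] .
    have "\<psi>' (hd (p @ [v])) \<in> nxt x0" using False \<psi>(1) same[of "hd p"] by simp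
    moreover have "\<forall>w\<in>set (tl (p @ [v])). \<psi>' w \<in> nxt (\<psi>' (par w))"
    proof
      fix w assume "w \<in> set (tl (p @ [v]))"
      then consider "w = v" | "w \<in> set (tl p)" using False by auto
      then show "\<psi>' w \<in> nxt (\<psi>' (par w))"
      proof cases
        case 1
        then show ?thesis using y same[OF pv] unfolding \<psi>'_def by auto
      next
        case 2
        then show ?thesis using \<psi>(2) same[OF tlp(1)[OF 2]] same[OF tlp(2)[OF 2]] by simp
      qed
    qed
    moreover have "inj_on (pr \<circ> \<psi>') (set (p @ [v]))"
    proof -
      have "inj_on (pr \<circ> \<psi>') (set p)" using \<psi>(3) same by (simp add: inj_on_def)
      moreover have "(pr \<circ> \<psi>') v \<notin> (pr \<circ> \<psi>') ` set p" using y(2) same unfolding \<psi>'_def by auto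
      ultimately show ?thesis using vp by (simp add: inj_on_insert)
    qed
    moreover have "\<forall>w\<in>set (p @ [v]). \<psi>' w \<in> C \<and> pr (\<psi>' w) \<notin> Used"
    proof
      fix w assume "w \<in> set (p @ [v])"
      then consider "w = v" | "w \<in> set p" by auto
      then show "\<psi>' w \<in> C \<and> pr (\<psi>' w) \<notin> Used"
      proof cases
        case 1
        then show ?thesis using y(1) nxt(1)[OF x] unfolding \<psi>'_def by auto
      next
        case 2
        then show ?thesis using \<psi>(4) same[OF 2] by simp
      qed
    qed
    ultimately show ?thesis by blast
  qed
qed

text \<open>
  The vertices of positive rank form a subtree at the root of the piece of depth at most \<^term>\<open>H\<close>.
\<close>

lemma card_positive_rank:
  fixes rk :: "'v \<Rightarrow> nat"
  assumes p: "parent_order par p"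
    and \<psi>: "\<forall>v\<in>set (tl p). \<psi> v \<in> nxt (\<psi> (par v))" "\<forall>v\<in>set p. \<psi> v \<in> C"
    and rk: "\<And>x y. x \<in> C \<Longrightarrow> y \<in> nxt x \<Longrightarrow> rk y < rk x \<or> rk y = 0" "\<And>x. x \<in> C \<Longrightarrow> rk x \<le> H"
    and ch: "\<And>u. card {v \<in> set (tl p). par v = u} \<le> \<Delta>"
  shows "card {v \<in> set p. 1 \<le> rk (\<psi> v)} \<le> (\<Delta> + 2) ^ H"
proof -
  \<comment> \<open>\<open>S i\<close> holds the vertices of rank at least \<open>H + 1 - i\<close>:
    empty for \<open>i = 0\<close>, and all vertices of positive rank for \<open>i = H\<close>. A
    vertex of \<open>S (Suc i)\<close> is the root or a child of a vertex in
    \<open>S i\<close>.\<close>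
  define S where "S i = {v \<in> set p. H + 1 \<le> rk (\<psi> v) + i}" for i
  have finS: "finite (S i)" for i unfolding S_def by auto
  have "i \<le> H \<longrightarrow> card (S i) \<le> (\<Delta> + 2) ^ i" for i
  proof (induction i)
    case 0
    have "S 0 = {}" unfolding S_def using rk(2) \<psi>(2) by fastforce
    then show ?case by simp
  next
    case (Suc i)
    show ?case
    proof
      assume iH: "Suc i \<le> H"
      have "S (Suc i) \<subseteq> insert (hd p) (\<Union>u\<in>S i. {v \<in> set (tl p). par v = u})"
      proof
        fix v assume v: "v \<in> S (Suc i)"
        show "v \<in> insert (hd p) (\<Union>u\<in>S i. {v \<in> set (tl p). par v = u})"
        proof (cases "v = hd p")
          case False
          then have vt: "v \<in> set (tl p)" using v unfolding S_def by (cases p) auto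
          note pin = parent_order_in[OF p vt]
          have "rk (\<psi> v) \<noteq> 0" using v iH unfolding S_def by auto
          then have "rk (\<psi> v) < rk (\<psi> (par v))"
            using rk(1)[of "\<psi> (par v)" "\<psi> v"] \<psi> vt pin by auto
          then have "par v \<in> S i" using v pin unfolding S_def by auto
          then show ?thesis using vt by auto
        qed simp
      qed
      then have "card (S (Suc i)) \<le> card (insert (hd p) (\<Union>u\<in>S i. {v \<in> set (tl p). par v = u}))"
        using finS by (intro card_mono) auto
      also have "\<dots> \<le> Suc (card (\<Union>u\<in>S i. {v \<in> set (tl p). par v = u}))" using finS by (simp add: card_insert_if)
      also have "card (\<Union>u\<in>S i. {v \<in> set (tl p). par v = u}) \<le> (\<Sum>u\<in>S i. card {v \<in> set (tl p). par v = u})"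
        using finS by (intro card_UN_le) auto
      also have "\<dots> \<le> (\<Sum>u\<in>S i. \<Delta>)" using ch by (intro sum_mono) auto
      also have "\<dots> \<le> (\<Delta> + 2) ^ i * \<Delta>" using Suc iH by simp
      also have "Suc ((\<Delta> + 2) ^ i * \<Delta>) \<le> (\<Delta> + 2) ^ Suc i" by (simp add: algebra_simps Suc_le_eq)
      finally show "card (S (Suc i)) \<le> (\<Delta> + 2) ^ Suc i" by simp
    qed
  qed
  then have "card (S H) \<le> (\<Delta> + 2) ^ H" by simp
  moreover have "S H = {v \<in> set p. 1 \<le> rk (\<psi> v)}" unfolding S_def by auto
  ultimately show ?thesis by simp
qed

lemma acount_singleton_left: "acount E {u} B = real (card {v \<in> B. (u, v) \<in> E})"
proof -
  have "E \<inter> {u} \<times> B = Pair u ` {v \<in> B. (u, v) \<in> E}" by auto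
  then show ?thesis unfolding acount_def by (simp add: card_image inj_on_def)
qed

lemma acount_singleton_right: "acount E A {v} = real (card {u \<in> A. (u, v) \<in> E})"
proof -
  have "E \<inter> A \<times> {v} = (\<lambda>u. (u, v)) ` {u \<in> A. (u, v) \<in> E}" by auto
  then show ?thesis unfolding acount_def by (simp add: card_image inj_on_def)
qed

text \<open>\<open>A\<close> and \<open>B\<close> minimise \<open>h * (card A + card B)\<close>
  minus the number of arcs between them. Removing a vertex of degree below \<open>h\<close> would
  lower this value. If a side were smaller than \<open>a\<close>, adding its whole complement would
  gain a dense pair, whose arcs outweigh the total cost
  \<open>h * (card A0 + card B0)\<close>.\<close>

lemma min_degree_core:
  fixes a h :: real
  assumes fin: "finite A0" "finite B0" and h: "0 \<le> h"
    and dense: "\<And>A B. A \<subseteq> A0 \<Longrightarrow> B \<subseteq> B0 \<Longrightarrow> a \<le> real (card A) \<Longrightarrow> a \<le> real (card B) \<Longrightarrow>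
       h * (real (card A0) + real (card B0)) < acount E A B"
    and big: "2 * a \<le> real (card A0)" "2 * a \<le> real (card B0)"
  shows "\<exists>A\<subseteq>A0. \<exists>B\<subseteq>B0. a \<le> real (card A) \<and> a \<le> real (card B) \<and>
     (\<forall>u\<in>A. h \<le> real (card {v \<in> B. (u, v) \<in> E})) \<and> (\<forall>v\<in>B. h \<le> real (card {u \<in> A. (u, v) \<in> E}))"
proof -
  define f where "f X = h * (real (card (fst X)) + real (card (snd X))) - acount E (fst X) (snd X)"
    for X :: "'a set \<times> 'b set"
  have "\<exists>X\<in>Pow A0 \<times> Pow B0. \<forall>Y\<in>Pow A0 \<times> Pow B0. f X \<le> f Y"
    by (rule finite_ex_minimiser) (use fin in auto)
  then obtain X where X: "X \<in> Pow A0 \<times> Pow B0" and min: "\<forall>Y\<in>Pow A0 \<times> Pow B0. f X \<le> f Y" by blast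
  obtain A B where AB: "X = (A, B)" by (cases X)
  have sub: "A \<subseteq> A0" "B \<subseteq> B0" using X AB by auto
  have finAB: "finite A" "finite B" using sub fin finite_subset by blast+
  have min': "h * (real (card A) + real (card B)) - acount E A B
      \<le> h * (real (card A') + real (card B')) - acount E A' B'" if "A' \<subseteq> A0" "B' \<subseteq> B0" for A' B'
    using min that AB unfolding f_def by auto
  have degA: "h \<le> real (card {v \<in> B. (u, v) \<in> E})" if u: "u \<in> A" for u
  proof -
    have "A = (A - {u}) \<union> {u}" using u by auto
    then have eq: "acount E A B = acount E (A - {u}) B + acount E {u} B"
      using acount_Un_left[of "A - {u}" "{u}" B E] finAB by auto
    have cu: "real (card (A - {u})) = real (card A) - 1"
      using card_Suc_Diff1[OF finAB(1) u] by linarith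
    have "A - {u} \<subseteq> A0" using sub by auto
    from min'[OF this sub(2)] show ?thesis unfolding cu eq acount_singleton_left by (simp add: algebra_simps)
  qed
  have degB: "h \<le> real (card {u \<in> A. (u, v) \<in> E})" if v: "v \<in> B" for v
  proof -
    have "B = (B - {v}) \<union> {v}" using v by auto
    then have eq: "acount E A B = acount E A (B - {v}) + acount E A {v}"
      using acount_Un_right[of A "{v}" "B - {v}" E] finAB by auto
    have cv: "real (card (B - {v})) = real (card B) - 1"
      using card_Suc_Diff1[OF finAB(2) v] by linarith
    have "B - {v} \<subseteq> B0" using sub by auto
    from min'[OF sub(1) this] show ?thesis unfolding cv eq acount_singleton_right by (simp add: algebra_simps)
  qed
  have compl: "real (card (A0 - A)) = real (card A0) - real (card A)"
    "real (card (B0 - B)) = real (card B0) - real (card B)"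
    using sub finAB fin by (simp_all add: card_Diff_subset of_nat_diff card_mono)
  have eqA: "A \<union> (A0 - A) = A0" and eqB: "B \<union> (B0 - B) = B0" using sub by auto
  have hle: "h * (real (card A0) - real (card A) + (real (card B0) - real (card B)))
      \<le> h * (real (card A0) + real (card B0))"
    "h * (real (card A0) - real (card A)) \<le> h * (real (card A0) + real (card B0))"
    "h * (real (card B0) - real (card B)) \<le> h * (real (card A0) + real (card B0))"
    using h by (intro mult_left_mono; simp)+
  have notboth: "\<not> (real (card A) < a \<and> real (card B) < a)"
  proof
    assume "real (card A) < a \<and> real (card B) < a"
    then have "h * (real (card A0) + real (card B0)) < acount E (A0 - A) (B0 - B)"
      using big compl by (intro dense) auto
    moreover have "acount E A B + acount E (A0 - A) (B0 - B) \<le> acount E A0 B0"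
    proof -
      have "acount E A0 B0 = acount E A B0 + acount E (A0 - A) B0"
        using acount_Un_left[of A "A0 - A" B0 E] fin finAB eqA by auto
      moreover have "acount E A B \<le> acount E A B0" "acount E (A0 - A) (B0 - B) \<le> acount E (A0 - A) B0"
        using fin finAB sub by (intro acount_mono; auto)+
      ultimately show ?thesis by linarith
    qed
    ultimately show False using min'[of A0 B0] hle(1) by (simp add: algebra_simps)
  qed
  have sA: "a \<le> real (card A)"
  proof (rule ccontr)
    assume A: "\<not> ?thesis"
    then have "h * (real (card A0) + real (card B0)) < acount E (A0 - A) B"
      using notboth big compl sub by (intro dense) auto
    moreover have "acount E A0 B = acount E A B + acount E (A0 - A) B"
      using acount_Un_left[of A "A0 - A" B E] fin finAB eqA by auto
    ultimately show False using min'[of A0 B] sub hle(2) by (simp add: algebra_simps)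
  qed
  have sB: "a \<le> real (card B)"
  proof (rule ccontr)
    assume B: "\<not> ?thesis"
    then have "h * (real (card A0) + real (card B0)) < acount E A (B0 - B)"
      using notboth big compl sub by (intro dense) auto
    moreover have "acount E A B0 = acount E A B + acount E A (B0 - B)"
      using acount_Un_right[of A "B0 - B" B E] fin finAB eqB by auto
    ultimately show False using min'[of A B0] sub hle(3) by (simp add: algebra_simps)
  qed
  show ?thesis
    by (rule exI[of _ A], intro conjI sub(1), rule exI[of _ B]) (use sub(2) sA sB degA degB in simp)
qed

text \<open>
  The part \<open>Mn j s\<close> of a side of pair \<open>j\<close> accommodates the bulk of the pieces assigned to \<open>j\<close>; the
  linking vertices \<open>Lk j s\<close> and the reservoir \<open>R\<close> only serve to reach it. A vertex of layer \<open>0\<close> has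
  many linking neighbours, and one of layer \<open>l + 1\<close> has many neighbours in the reservoir that belong
  to layer \<open>l\<close>.
\<close>

locale linkage =
  fixes V :: "'a set" and E :: "('a \<times> 'a) set" and C :: "('a \<times> bool) set" and J :: "nat set"
    and Mn Lk :: "nat \<Rightarrow> bool \<Rightarrow> 'a set" and R :: "'a set"
    and lay :: "nat \<Rightarrow> nat \<Rightarrow> ('a \<times> bool) set" and Lm M K W :: nat and e :: "nat \<Rightarrow> real" and h :: real
  assumes finV: "finite V" and EV: "E \<subseteq> V \<times> V" and CV: "C \<subseteq> V \<times> UNIV"
    and MnC: "\<And>j s. j \<in> J \<Longrightarrow> Mn j s \<times> {s} \<subseteq> C" and LkC: "\<And>j s. j \<in> J \<Longrightarrow> Lk j s \<times> {s} \<subseteq> C"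
    and disjM: "\<And>i j s s'. i \<in> J \<Longrightarrow> j \<in> J \<Longrightarrow> (i, s) \<noteq> (j, s') \<Longrightarrow> Mn i s \<inter> Mn j s' = {}"
    and disjLM: "\<And>i j s s'. i \<in> J \<Longrightarrow> j \<in> J \<Longrightarrow> Lk i s \<inter> Mn j s' = {}"
    and disjRM: "\<And>j s. j \<in> J \<Longrightarrow> R \<inter> Mn j s = {}"
    and layC: "\<And>j l. j \<in> J \<Longrightarrow> lay j l \<subseteq> C"
    and lay0: "\<And>j x. j \<in> J \<Longrightarrow> x \<in> lay j 0 \<Longrightarrow> 2 * e j \<le> real (card (nb E x \<inter> {y. fst y \<in> Lk j (snd y)}))"
    and laySuc: "\<And>j l x. j \<in> J \<Longrightarrow> x \<in> lay j (Suc l) \<Longrightarrow> x \<notin> lay j l \<Longrightarrow>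
       M \<le> card (nb E x \<inter> lay j l \<inter> {y. fst y \<in> R})"
    and layL: "\<And>j. j \<in> J \<Longrightarrow> lay j Lm = C"
    and dense: "\<And>j A B. j \<in> J \<Longrightarrow> A \<subseteq> Mn j True \<union> Lk j True \<Longrightarrow> B \<subseteq> Mn j False \<union> Lk j False \<Longrightarrow>
       e j \<le> real (card A) \<Longrightarrow> e j \<le> real (card B) \<Longrightarrow> 2 * h * real (card V) < acount E A B"
    and K: "real K \<le> h" "W + K \<le> M" "\<And>j. j \<in> J \<Longrightarrow> real W + real K \<le> e j"
begin

abbreviation "Mall \<equiv> \<Union>j\<in>J. \<Union>s. Mn j s"

lemma MnV: "j \<in> J \<Longrightarrow> Mn j s \<subseteq> V" and LkV: "j \<in> J \<Longrightarrow> Lk j s \<subseteq> V"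
  using MnC LkC CV by blast+

lemma finM: "j \<in> J \<Longrightarrow> finite (Mn j s)" and finL: "j \<in> J \<Longrightarrow> finite (Lk j s)"
  using MnV LkV finV finite_subset by metis+

lemma finnb: "finite (nb E x)"
  using nb_subset[OF EV, of x] finV finite_subset by fastforce

text \<open>Candidates outside the main sets can only be blocked by images outside the main sets,
  and there are at most \<open>W\<close> of these.\<close>

lemma card_avoiding:
  assumes X: "finite X" "inj_on fst X" and U: "finite Used"
    and in_U: "\<And>y. y \<in> X \<Longrightarrow> fst y \<in> Used \<Longrightarrow> fst y \<in> Used - Mall" and W: "card (Used - Mall) \<le> W"
  shows "card X \<le> card {y \<in> X. fst y \<notin> Used} + W"
proof -
  have "card {y \<in> X. fst y \<in> Used} = card (fst ` {y \<in> X. fst y \<in> Used})"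
    by (rule card_image[symmetric]) (rule inj_on_subset[OF X(2)], auto)
  also have "\<dots> \<le> card (Used - Mall)" using U in_U by (intro card_mono) auto
  finally have "card {y \<in> X. fst y \<in> Used} \<le> W" using W by linarith
  moreover have "card X = card ({y \<in> X. fst y \<notin> Used} \<union> {y \<in> X. fst y \<in> Used})"
    by (rule arg_cong[where f = card]) auto
  ultimately show ?thesis
    using card_Un_le[of "{y \<in> X. fst y \<notin> Used}" "{y \<in> X. fst y \<in> Used}"] by linarith
qed

text \<open>
  The rank of a vertex bounds its distance to a pair of sets inside the free part of the main sets in
  which all degrees are large: rank 0 is this pair, rank 1 the linking vertices with many neighbours
  in it, and rank \<open>l + 2\<close> the layer \<open>l\<close>.
\<close>

lemma route:
  assumes j: "j \<in> J" and U: "finite Used" "card (Used - Mall) \<le> W"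
    and free: "\<And>s. 2 * e j \<le> real (card (Mn j s - Used))"
  shows "\<exists>nxt rk. (\<forall>x\<in>C. nxt x \<subseteq> nb E x \<inter> C \<and> K \<le> card {y \<in> nxt x. fst y \<notin> Used}) \<and> (\<forall>x. nxt x \<subseteq> nb E x) \<and>
     (\<forall>x\<in>C. \<forall>y\<in>nxt x. (rk y < rk x \<or> rk y = 0) \<and> (if rk y = 0 then fst y \<in> Mn j (snd y) else fst y \<notin> Mall)) \<and>
     (\<forall>x\<in>C. rk x \<le> Lm + 2)"
proof -
  have h0: "0 \<le> h" using K(1) by linarith
  let ?F = "\<lambda>s. Mn j s - Used"
  have finF: "finite (?F s)" for s using finM[OF j] by auto
  have cF: "real (card (?F s)) \<le> real (card V)" for s using MnV[OF j, of s] finV by (auto intro!: card_mono)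
  have dense': "h * (real (card (?F True)) + real (card (?F False))) < acount E A B"
    if "A \<subseteq> ?F True" "B \<subseteq> ?F False" "e j \<le> real (card A)" "e j \<le> real (card B)" for A B
  proof -
    have "h * (real (card (?F True)) + real (card (?F False))) \<le> h * (real (card V) + real (card V))"
      using cF h0 by (intro mult_left_mono add_mono) auto
    moreover have "2 * h * real (card V) < acount E A B" using that by (intro dense[OF j]) auto
    ultimately show ?thesis by simp
  qed
  have core: "\<exists>A\<subseteq>?F True. \<exists>B\<subseteq>?F False. e j \<le> real (card A) \<and> e j \<le> real (card B) \<and>
     (\<forall>u\<in>A. h \<le> real (card {v \<in> B. (u, v) \<in> E})) \<and> (\<forall>v\<in>B. h \<le> real (card {u \<in> A. (u, v) \<in> E}))"
    by (rule min_degree_core[OF finF finF h0 _ free free]) (rule dense'; assumption)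
  from core obtain A B where AB: "A \<subseteq> ?F True" "B \<subseteq> ?F False" "e j \<le> real (card A)" "e j \<le> real (card B)"
    "\<forall>u\<in>A. h \<le> real (card {v \<in> B. (u, v) \<in> E})" "\<forall>v\<in>B. h \<le> real (card {u \<in> A. (u, v) \<in> E})"
    by (elim exE conjE) (rule that; assumption)
  have finAB: "finite A" "finite B" using AB(1,2) finF finite_subset by blast+
  define Ks where "Ks = A \<times> {True} \<union> B \<times> {False}"
  have KsM: "fst y \<in> Mn j (snd y)" "fst y \<notin> Used" if "y \<in> Ks" for y
    using that AB(1,2) unfolding Ks_def by auto
  have KsC: "Ks \<subseteq> C" using AB(1,2) MnC[OF j, of True] MnC[OF j, of False] unfolding Ks_def by blast
  have nbT: "card (nb E (u, True) \<inter> Ks) = card {v \<in> B. (u, v) \<in> E}" for u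
  proof -
    have "nb E (u, True) \<inter> Ks = (\<lambda>v. (v, False)) ` {v \<in> B. (u, v) \<in> E}" unfolding Ks_def nb_def by auto
    then show ?thesis by (simp add: card_image inj_on_def)
  qed
  have nbF: "card (nb E (v, False) \<inter> Ks) = card {u \<in> A. (u, v) \<in> E}" for v
  proof -
    have "nb E (v, False) \<inter> Ks = (\<lambda>u. (u, True)) ` {u \<in> A. (u, v) \<in> E}" unfolding Ks_def nb_def by auto
    then show ?thesis by (simp add: card_image inj_on_def)
  qed
  have degK: "K \<le> card (nb E x \<inter> Ks)" if "x \<in> Ks" for x
    using that AB(5,6) K(1) nbT nbF unfolding Ks_def by fastforce
  define LL where "LL = {y. fst y \<in> Lk j (snd y)}"
  define Lg where "Lg = {y \<in> LL. K \<le> card (nb E y \<inter> Ks)}"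
  \<comment> \<open>Fewer than \<open>e j\<close> linking vertices on each side are bad: a larger
    set of them would form a dense pair with \<open>A\<close> or \<open>B\<close>, but fewer than
    \<open>K \<le> h\<close> arcs at each of its vertices are too few for that.\<close>
  define bad where "bad s = {u \<in> Lk j s. card (nb E (u, s) \<inter> Ks) < K}" for s
  have badL: "bad s \<subseteq> Lk j s" and finbad: "finite (bad s)" for s
    unfolding bad_def using finL[OF j, of s] by auto
  have cbad: "real (card (bad s)) * h \<le> h * real (card V)" for s
  proof -
    have "card (bad s) \<le> card V" using badL[of s] LkV[OF j, of s] by (intro card_mono[OF finV]) auto
    then show ?thesis using mult_right_mono[of "real (card (bad s))" "real (card V)" h] h0 by (simp add: mult.commute)
  qed
  have bad: "real (card (bad s)) < e j" for s
  proof (rule ccontr)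
    assume ge: "\<not> ?thesis"
    show False
    proof (cases s)
      case True
      have "2 * h * real (card V) < acount E (bad True) B"
        using ge True by (intro dense[OF j] le_supI2[OF badL] le_supI1[OF order_trans[OF AB(2) Diff_subset]] AB(4)) simp
      also have "\<dots> = (\<Sum>u\<in>bad True. real (card {v \<in> B. (u, v) \<in> E}))"
        using acount_eq_sum[OF finAB(2) finbad, of "E\<inverse>" True] by (simp add: acount_converse)
      also have "\<dots> \<le> (\<Sum>u\<in>bad True. h)"
        using K(1) unfolding bad_def nbT by (intro sum_mono) auto
      also have "\<dots> \<le> h * real (card V)" using cbad[of True] by simp
      finally show False using h0 by (simp add: mult_less_0_iff)
    next
      case False
      have "2 * h * real (card V) < acount E A (bad False)"
        using ge False by (intro dense[OF j] le_supI2[OF badL] le_supI1[OF order_trans[OF AB(1) Diff_subset]] AB(3)) simp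
      also have "\<dots> = (\<Sum>v\<in>bad False. real (card {u \<in> A. (u, v) \<in> E}))"
        by (rule acount_eq_sum[OF finAB(1) finbad])
      also have "\<dots> \<le> (\<Sum>v\<in>bad False. h)"
        using K(1) unfolding bad_def nbF by (intro sum_mono) auto
      also have "\<dots> \<le> h * real (card V)" using cbad[of False] by simp
      finally show False using h0 by (simp add: mult_less_0_iff)
    qed
  qed
  define lv where "lv x = (LEAST l. x \<in> lay j l)" for x
  have lv: "x \<in> lay j (lv x)" "lv x \<le> Lm" if "x \<in> C" for x
  proof -
    have "x \<in> lay j Lm" using that layL[OF j] by simp
    then show "x \<in> lay j (lv x)" "lv x \<le> Lm" unfolding lv_def by (rule LeastI) (use \<open>x \<in> lay j Lm\<close> in \<open>rule Least_le\<close>)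
  qed
  have lv_le: "lv x \<le> l" if "x \<in> lay j l" for x l unfolding lv_def using that by (rule Least_le)
  \<comment> \<open>The offset 2 reserves the ranks 0 and 1 for \<open>Ks\<close> and
    \<open>Lg\<close>, whatever layers their vertices also belong to.\<close>
  define rk where "rk x = (if x \<in> Ks then 0 else if x \<in> Lg then 1 else lv x + 2)" for x
  define nxt where "nxt x = (if x \<in> Ks \<union> Lg then nb E x \<inter> Ks else if lv x = 0 then nb E x \<inter> Lg
      else nb E x \<inter> lay j (lv x - 1) \<inter> {y. fst y \<in> R})" for x
  have LLM: "fst y \<notin> Mall" if "y \<in> LL" for y using that disjLM[OF j] unfolding LL_def by blast
  have LgC: "Lg \<subseteq> C"
  proof
    fix y assume "y \<in> Lg"
    then have "y \<in> Lk j (snd y) \<times> {snd y}" unfolding Lg_def LL_def by (cases y) auto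
    then show "y \<in> C" by (rule subsetD[OF LkC[OF j]])
  qed
  have RM: "fst y \<notin> Mall" if "fst y \<in> R" for y :: "'a \<times> bool" using that disjRM by blast
  have injS: "inj_on fst (nb E x \<inter> S)" for x S by (rule inj_on_subset[OF inj_on_fst_nb]) auto
  have room: "K \<le> card {y \<in> nxt x. fst y \<notin> Used}" if x: "x \<in> C" for x
  proof -
    consider "x \<in> Ks \<union> Lg" | "x \<notin> Ks \<union> Lg" "lv x = 0" | "x \<notin> Ks \<union> Lg" "lv x \<noteq> 0" by auto
    then show ?thesis
    proof cases
      case 1
      \<comment> \<open>\<open>Ks\<close> lies in the free part of the main sets, so nothing is lost
        to \<open>Used\<close> here.\<close>
      then have "{y \<in> nxt x. fst y \<notin> Used} = nb E x \<inter> Ks" unfolding nxt_def using KsM(2) by auto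
      then show ?thesis using 1 degK[of x] unfolding Lg_def by auto
    next
      case 2
      then have nx: "nxt x = nb E x \<inter> Lg" unfolding nxt_def by simp
      have "x \<in> lay j 0" using lv(1)[OF x] 2 by simp
      \<comment> \<open>Of \<open>2 * e j\<close> linking neighbours fewer than \<open>e j\<close>
        are bad and at most \<open>W\<close> are used, which leaves at least
        \<open>K\<close>.\<close>
      from lay0[OF j this] have big: "2 * e j \<le> real (card (nb E x \<inter> LL))" unfolding LL_def .
      have "nb E x \<inter> LL \<subseteq> (nb E x \<inter> Lg) \<union> (\<lambda>u. (u, \<not> snd x)) ` bad (\<not> snd x)"
      proof
        fix y assume y: "y \<in> nb E x \<inter> LL"
        then have "snd y = (\<not> snd x)" using nb_snd[of y E x] by auto
        then show "y \<in> (nb E x \<inter> Lg) \<union> (\<lambda>u. (u, \<not> snd x)) ` bad (\<not> snd x)"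
          using y unfolding Lg_def bad_def LL_def by (cases y) (auto simp: image_iff)
      qed
      then have "card (nb E x \<inter> LL) \<le> card ((nb E x \<inter> Lg) \<union> (\<lambda>u. (u, \<not> snd x)) ` bad (\<not> snd x))"
        using finnb finbad by (intro card_mono) auto
      also have "\<dots> \<le> card (nb E x \<inter> Lg) + card (bad (\<not> snd x))"
        using card_Un_le card_image_le[OF finbad] by (meson add_le_mono order_refl order_trans)
      finally have "e j \<le> real (card (nxt x))" using big bad[of "\<not> snd x"] unfolding nx by linarith
      moreover have "card (nxt x) \<le> card {y \<in> nxt x. fst y \<notin> Used} + W"
        unfolding nx using finnb LLM U Lg_def by (intro card_avoiding injS) auto
      ultimately show ?thesis using K(3)[OF j] by linarith
    next
      case 3
      then have nx: "nxt x = nb E x \<inter> (lay j (lv x - 1) \<inter> {y. fst y \<in> R})" unfolding nxt_def by auto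
      have "x \<in> lay j (Suc (lv x - 1))" using lv(1)[OF x] 3 by simp
      moreover have "x \<notin> lay j (lv x - 1)" using lv_le[of x "lv x - 1"] 3 by auto
      ultimately have "M \<le> card (nxt x)" using laySuc[OF j] unfolding nx by (simp add: Int_assoc)
      moreover have "card (nxt x) \<le> card {y \<in> nxt x. fst y \<notin> Used} + W"
        unfolding nx using finnb RM U by (intro card_avoiding injS) auto
      ultimately show ?thesis using K(2) by linarith
    qed
  qed
  have sub: "nxt x \<subseteq> nb E x \<inter> C" for x
    unfolding nxt_def using KsC LgC layC[OF j] by auto
  have rank: "(rk y < rk x \<or> rk y = 0) \<and> (if rk y = 0 then fst y \<in> Mn j (snd y) else fst y \<notin> Mall)"
    if x: "x \<in> C" and y: "y \<in> nxt x" for x y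
  proof (cases "y \<in> Ks")
    case True
    then show ?thesis using KsM unfolding rk_def by auto
  next
    case False
    consider "x \<in> Ks \<union> Lg" | "x \<notin> Ks \<union> Lg" "lv x = 0" | "x \<notin> Ks \<union> Lg" "lv x \<noteq> 0" by auto
    then show ?thesis
    proof cases
      case 1
      then show ?thesis using y False unfolding nxt_def by auto
    next
      case 2
      then have "y \<in> Lg" using y unfolding nxt_def by auto
      then show ?thesis using 2 False LLM unfolding rk_def Lg_def by auto
    next
      case 3
      then have "y \<in> lay j (lv x - 1)" "fst y \<in> R" using y unfolding nxt_def by auto
      then show ?thesis using 3 False lv_le[of y "lv x - 1"] RM[of y] unfolding rk_def by auto
    qed
  qed
  have rkH: "rk x \<le> Lm + 2" if "x \<in> C" for x using lv(2)[OF that] unfolding rk_def by auto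
  have sub': "nxt x \<subseteq> nb E x" for x using sub[of x] by simp
  show ?thesis
    by (intro exI[of _ nxt] exI[of _ rk] conjI ballI allI sub sub' room rkH
        rank[THEN conjunct1] rank[THEN conjunct2]) assumption+
qed

text \<open>The induction maintains that after \<open>i\<close> pieces at most
  \<open>i * (\<Delta> + 2) ^ (Lm + 2)\<close> images lie outside the main sets, and that
  \<open>Mn j s\<close> holds at most as many images as the pieces assigned to \<open>j\<close> have
  vertices of class \<open>s\<close>. By \<open>W\<close> and \<open>load\<close>,
  \<open>route\<close> then has room for the next piece, whichever pair it is assigned to and
  wherever the parent of its root was placed.\<close>

lemma embed_pieces:
  fixes ps :: "'b list list" and a :: "nat \<Rightarrow> nat" and cl :: "'b \<Rightarrow> bool"
  assumes ps: "piece_order par ps" "\<forall>p\<in>set ps. length p \<le> K"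
    and a: "\<And>i. i < length ps \<Longrightarrow> a i \<in> J"
    and ch: "\<And>u. card {v \<in> set (concat ps). v \<noteq> hd (hd ps) \<and> par v = u} \<le> \<Delta>"
    and cl: "\<And>v. v \<in> set (concat ps) \<Longrightarrow> v \<noteq> hd (hd ps) \<Longrightarrow> cl v = (\<not> cl (par v))"
    and W: "length ps * (\<Delta> + 2) ^ (Lm + 2) \<le> W"
    and load: "\<And>j s. j \<in> J \<Longrightarrow> (\<Sum>i\<in>{i. i < length ps \<and> a i = j}. real (card {v \<in> set (ps ! i). cl v = s})) + 2 * e j
       \<le> real (card (Mn j s))"
    and Cside: "\<And>s. \<exists>x\<in>C. snd x = s"
  shows "\<exists>\<phi>. (\<forall>v\<in>set (concat ps). \<phi> v \<in> C \<and> snd (\<phi> v) = cl v) \<and>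
    (\<forall>v\<in>set (concat ps). v \<noteq> hd (hd ps) \<longrightarrow> \<phi> v \<in> nb E (\<phi> (par v))) \<and> inj_on (fst \<circ> \<phi>) (set (concat ps))"
proof -
  let ?w = "(\<Delta> + 2) ^ (Lm + 2)"
  let ?D = "\<lambda>i. set (concat (take i ps))"
  have dist: "distinct (concat ps)" using ps(1) unfolding piece_order_def by simp
  have "i \<le> length ps \<longrightarrow> (\<exists>\<phi>. (\<forall>v\<in>?D i. \<phi> v \<in> C \<and> snd (\<phi> v) = cl v) \<and>
     (\<forall>v\<in>?D i. v \<noteq> hd (hd ps) \<longrightarrow> \<phi> v \<in> nb E (\<phi> (par v))) \<and> inj_on (fst \<circ> \<phi>) (?D i) \<and>
     card ((fst \<circ> \<phi>) ` ?D i - Mall) \<le> i * ?w \<and>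
     (\<forall>j\<in>J. \<forall>s. card ((fst \<circ> \<phi>) ` ?D i \<inter> Mn j s)
        \<le> (\<Sum>i'\<in>{i'. i' < i \<and> a i' = j}. card {v \<in> set (ps ! i'). cl v = s})))" for i
  proof (induction i)
    case 0
    then show ?case by simp
  next
    case (Suc i)
    show ?case
    proof
      assume il: "Suc i \<le> length ps"
      then have "i \<le> length ps" by simp
      from Suc[rule_format, OF this] obtain \<phi> where \<phi>: "\<forall>v\<in>?D i. \<phi> v \<in> C \<and> snd (\<phi> v) = cl v"
        "\<forall>v\<in>?D i. v \<noteq> hd (hd ps) \<longrightarrow> \<phi> v \<in> nb E (\<phi> (par v))" "inj_on (fst \<circ> \<phi>) (?D i)"
        "card ((fst \<circ> \<phi>) ` ?D i - Mall) \<le> i * ?w"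
        "\<forall>j\<in>J. \<forall>s. card ((fst \<circ> \<phi>) ` ?D i \<inter> Mn j s)
          \<le> (\<Sum>i'\<in>{i'. i' < i \<and> a i' = j}. card {v \<in> set (ps ! i'). cl v = s})"
        by (elim exE conjE) (rule that; assumption)
      define p where "p = ps ! i"
      define j where "j = a i"
      have jJ: "j \<in> J" unfolding j_def using a il by auto
      have split: "ps = take i ps @ p # drop (Suc i) ps"
        unfolding p_def using il by (simp add: id_take_nth_drop)
      have DSuc: "?D (Suc i) = ?D i \<union> set p"
        unfolding p_def using il by (simp add: take_Suc_conv_app_nth)
      have pmem: "p \<in> set ps" unfolding p_def using il by simp
      then have p: "p \<noteq> []" "parent_order par p" "length p \<le> K"
        using ps unfolding piece_order_def by auto
      have subp: "set p \<subseteq> set (concat ps)" using pmem by auto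
      have disj: "?D i \<inter> set p = {}"
      proof -
        have "distinct (concat (take i ps) @ p @ concat (drop (Suc i) ps))"
          using dist by (subst (asm) split) simp
        then show ?thesis by auto
      qed
      have hd_in: "hd (hd ps) \<in> ?D i" if "i \<noteq> 0"
      proof -
        have "ps \<noteq> []" using il by auto
        then obtain q qs where q: "ps = q # qs" by (cases ps) auto
        then have "q \<noteq> []" using ps(1) unfolding piece_order_def by auto
        then show ?thesis using q that by (cases i) auto
      qed
      have root: "v \<noteq> hd (hd ps)" if "v \<in> set p" "i \<noteq> 0 \<or> v \<in> set (tl p)" for v
      proof (cases "i = 0")
        case True
        then have "hd (hd ps) = hd p" unfolding p_def using il by (cases ps) auto
        moreover have "distinct p" using p(2) unfolding parent_order_def by simp
        ultimately show ?thesis using that True p(1) by (cases p) auto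
      next
        case False
        then show ?thesis using hd_in disj that by auto
      qed
      define Used where "Used = (fst \<circ> \<phi>) ` ?D i"
      have finU: "finite Used" unfolding Used_def by simp
      have "i * ?w \<le> length ps * ?w" using il by (intro mult_right_mono) auto
      then have UW: "card (Used - Mall) \<le> W" using \<phi>(4) W unfolding Used_def by linarith
      have free: "2 * e j \<le> real (card (Mn j s - Used))" for s
      proof -
        have "(\<Sum>i'\<in>{i'. i' < i \<and> a i' = j}. card {v \<in> set (ps ! i'). cl v = s})
           \<le> (\<Sum>i'\<in>{i'. i' < length ps \<and> a i' = j}. card {v \<in> set (ps ! i'). cl v = s})"
          using il by (intro sum_mono2) auto
        then have "card (Used \<inter> Mn j s) \<le> (\<Sum>i'\<in>{i'. i' < length ps \<and> a i' = j}. card {v \<in> set (ps ! i'). cl v = s})"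
          using \<phi>(5) jJ unfolding Used_def by (meson order_trans)
        then have "real (card (Used \<inter> Mn j s))
           \<le> (\<Sum>i'\<in>{i'. i' < length ps \<and> a i' = j}. real (card {v \<in> set (ps ! i'). cl v = s}))"
          by (simp flip: of_nat_sum)
        moreover have "card (Mn j s) \<le> card (Mn j s - Used) + card (Used \<inter> Mn j s)"
        proof -
          have "card (Mn j s) = card ((Mn j s - Used) \<union> (Used \<inter> Mn j s))"
            by (rule arg_cong[where f = card]) auto
          then show ?thesis using card_Un_le[of "Mn j s - Used" "Used \<inter> Mn j s"] by linarith
        qed
        ultimately show ?thesis using load[OF jJ, of s] by linarith
      qed
      obtain nxt rk where nxt: "\<forall>x\<in>C. nxt x \<subseteq> nb E x \<inter> C \<and> K \<le> card {y \<in> nxt x. fst y \<notin> Used}"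
        "\<forall>x. nxt x \<subseteq> nb E x"
        "\<forall>x\<in>C. \<forall>y\<in>nxt x. (rk y < rk x \<or> rk y = (0::nat)) \<and> (if rk y = 0 then fst y \<in> Mn j (snd y) else fst y \<notin> Mall)"
        "\<forall>x\<in>C. rk x \<le> Lm + 2"
        using route[OF jJ finU UW free] by (elim exE conjE) (rule that; assumption)
      \<comment> \<open>The root of the first piece has no parent; any core vertex on the opposite
        side stands in for the image of one.\<close>
      obtain x0 where x0: "x0 \<in> C" "snd x0 = (\<not> cl (hd p))" "i \<noteq> 0 \<Longrightarrow> x0 = \<phi> (par (hd p)) \<and> par (hd p) \<in> ?D i"
      proof (cases "i = 0")
        case True
        then show ?thesis using that Cside[of "\<not> cl (hd p)"] by blast
      next
        case False
        then have "take i ps \<noteq> []" using il by auto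
        then have "par (hd p) \<in> ?D i" using ps(1) split unfolding piece_order_def by blast
        moreover have hdp: "hd p \<in> set p" using p(1) by simp
        have "cl (hd p) = (\<not> cl (par (hd p)))"
          by (rule cl[OF subsetD[OF subp hdp] root[OF hdp]]) (use False in simp)
        ultimately show ?thesis using that[of "\<phi> (par (hd p))"] \<phi>(1) by simp
      qed
      have injn: "inj_on fst (nxt x)" and finn: "finite (nxt x)" for x
        using nxt(2) inj_on_subset[OF inj_on_fst_nb] finite_subset[OF _ finnb] by metis+
      obtain \<psi> where \<psi>: "\<psi> (hd p) \<in> nxt x0" "\<forall>v\<in>set (tl p). \<psi> v \<in> nxt (\<psi> (par v))"
        "inj_on (fst \<circ> \<psi>) (set p)" "\<forall>v\<in>set p. \<psi> v \<in> C \<and> fst (\<psi> v) \<notin> Used"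
      proof -
        have nx: "nxt x \<subseteq> C" "K \<le> card {y \<in> nxt x. fst y \<notin> Used}" if "x \<in> C" for x
          using nxt(1) that by simp_all
        from embed_piece[where nxt = nxt and C = C and Used = Used, OF x0(1) nx(1) injn finn nx(2) p(2,1,3), simplified]
        show ?thesis unfolding o_def by (elim exE conjE) (rule that; simp add: o_def)
      qed
      have nxtD: "y \<in> nb E x" if "y \<in> nxt x" for x y using nxt(2)[rule_format] that by (rule subsetD)
      have from_nxt: "\<exists>x\<in>C. \<psi> v \<in> nxt x" if "v \<in> set p" for v
      proof (cases "v = hd p")
        case True
        then show ?thesis using \<psi>(1) x0(1) by auto
      next
        case False
        then have "v \<in> set (tl p)" using that by (cases p) auto
        then have "\<psi> v \<in> nxt (\<psi> (par v))" "\<psi> (par v) \<in> C"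
          using \<psi>(2,4) parent_order_in(1)[OF p(2)] by simp_all
        then show ?thesis by (intro bexI)
      qed
      have side: "snd (\<psi> v) = cl v" if "v \<in> set p" for v
        using hd_ancestor[OF p(2) that]
      proof (induction rule: rtrancl_induct)
        case base
        have "\<psi> (hd p) \<in> nb E x0" by (rule nxtD[OF \<psi>(1)])
        then have "snd (\<psi> (hd p)) = (\<not> snd x0)" by (rule nb_snd)
        then show ?case using x0(2) by simp
      next
        case (step y z)
        then have z: "y = par z" "z \<in> set (tl p)" unfolding child_rel_def by auto
        then have "\<psi> z \<in> nb E (\<psi> y)" using nxtD[of "\<psi> z" "\<psi> y"] \<psi>(2) by simp
        then have "snd (\<psi> z) = (\<not> snd (\<psi> y))" by (rule nb_snd)
        moreover have "z \<in> set p" using parent_order_in(2)[OF p(2) z(2)] .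
        then have "cl z = (\<not> cl (par z))" using cl[OF subsetD[OF subp] root] z(2) by simp
        ultimately show ?case using step.IH z(1) by simp
      qed
      define \<phi>' where "\<phi>' v = (if v \<in> set p then \<psi> v else \<phi> v)" for v
      have new: "\<phi>' v = \<psi> v" if "v \<in> set p" for v using that unfolding \<phi>'_def by simp
      have old: "\<phi>' v = \<phi> v" if "v \<in> ?D i" for v using that disj unfolding \<phi>'_def by auto
      have img: "(fst \<circ> \<phi>') ` ?D (Suc i) = Used \<union> (fst \<circ> \<psi>) ` set p"
        unfolding DSuc image_Un Used_def using new old by (intro arg_cong2[where f = "(\<union>)"] image_cong) auto
      have par_old: "par v \<in> ?D i" if "v \<in> ?D i" "v \<noteq> hd (hd ps)" for v
      proof -
        obtain q where q: "q \<in> set (take i ps)" "v \<in> set q" using \<open>v \<in> ?D i\<close> by auto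
        then obtain qs rs where qs: "take i ps = qs @ q # rs" by (meson split_list)
        have eq: "ps = qs @ q # (rs @ drop i ps)"
          using append_take_drop_id[of i ps] qs by simp
        have "q \<in> set ps" using q(1) by (rule in_set_takeD)
        then have qq: "q \<noteq> []" "parent_order par q" using ps(1) unfolding piece_order_def by auto
        show ?thesis
        proof (cases "v = hd q")
          case True
          have "hd ps = q" if "qs = []" using arg_cong[OF eq, of hd] that by simp
          then have "qs \<noteq> []" using that(2) True by auto
          then have "par v \<in> set (concat qs)" using ps(1) eq True unfolding piece_order_def by blast
          then show ?thesis using qs by auto
        next
          case False
          then have "v \<in> set (tl q)" using q(2) by (cases q) auto
          then show ?thesis using parent_order_in(1)[OF qq(2)] q(1) by auto
        qed
      qed
      have 1: "\<forall>v\<in>?D (Suc i). \<phi>' v \<in> C \<and> snd (\<phi>' v) = cl v"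
        unfolding DSuc ball_Un using \<phi>(1) \<psi>(4) side new old by simp
      have 2: "\<forall>v\<in>?D (Suc i). v \<noteq> hd (hd ps) \<longrightarrow> \<phi>' v \<in> nb E (\<phi>' (par v))"
      proof (intro ballI impI)
        fix v assume v: "v \<in> ?D (Suc i)" "v \<noteq> hd (hd ps)"
        show "\<phi>' v \<in> nb E (\<phi>' (par v))"
        proof (cases "v \<in> ?D i")
          case True
          show ?thesis
            unfolding old[OF True] old[OF par_old[OF True v(2)]] using \<phi>(2) True v(2) by blast
        next
          case False
          then have vp: "v \<in> set p" using v(1) DSuc by auto
          show ?thesis
          proof (cases "v = hd p")
            case True
            have "i \<noteq> 0"
            proof
              assume "i = 0"
              then have "hd (hd ps) = hd p" unfolding p_def using il by (cases ps) auto
              then show False using v(2) True by simp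
            qed
            then show ?thesis
              using x0(3) nxtD[OF \<psi>(1)] True new[OF vp] old[of "par v"] by simp
          next
            case False
            then have "v \<in> set (tl p)" using vp by (cases p) auto
            then show ?thesis
              using nxtD[of "\<psi> v" "\<psi> (par v)"] \<psi>(2) new[OF vp] new[OF parent_order_in(1)[OF p(2)]] by simp
          qed
        qed
      qed
      have 3: "inj_on (fst \<circ> \<phi>') (?D (Suc i))"
        unfolding DSuc inj_on_Un
      proof (intro conjI)
        show "inj_on (fst \<circ> \<phi>') (?D i)" using \<phi>(3) old by (simp cong: inj_on_cong del: set_concat)
        show "inj_on (fst \<circ> \<phi>') (set p)" using \<psi>(3) new by (simp cong: inj_on_cong)
        have "(fst \<circ> \<phi>') ` ?D i = Used" unfolding Used_def using old by (intro image_cong) auto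
        moreover have "(fst \<circ> \<phi>') ` set p \<inter> Used = {}" using \<psi>(4) new by auto
        ultimately show "(fst \<circ> \<phi>') ` (?D i - set p) \<inter> (fst \<circ> \<phi>') ` (set p - ?D i) = {}" by blast
      qed
      have rk_main: "if rk (\<psi> v) = 0 then fst (\<psi> v) \<in> Mn j (snd (\<psi> v)) else fst (\<psi> v) \<notin> Mall"
        if v: "v \<in> set p" for v
      proof -
        obtain x where x: "x \<in> C" "\<psi> v \<in> nxt x" using from_nxt[OF v] by blast
        show ?thesis by (rule conjunct2[OF bspec[OF bspec[OF nxt(3) x(1)] x(2)]])
      qed
      have zero: "fst (\<psi> v) \<in> Mn j (snd (\<psi> v))" if "v \<in> set p" "rk (\<psi> v) = 0" for v
        using rk_main[OF that(1)] unfolding that(2) by (simp only: if_True)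
      have pos: "fst (\<psi> v) \<notin> Mall" if "v \<in> set p" "rk (\<psi> v) \<noteq> 0" for v
        using rk_main[OF that(1)] unfolding if_not_P[OF that(2)] .
      have "card {v \<in> set p. 1 \<le> rk (\<psi> v)} \<le> ?w"
      proof (rule card_positive_rank[where nxt = nxt and C = C, OF p(2) \<psi>(2)])
        show "\<forall>v\<in>set p. \<psi> v \<in> C" using \<psi>(4) by simp
        show "rk y < rk x \<or> rk y = 0" if "x \<in> C" "y \<in> nxt x" for x y
          by (rule conjunct1[OF bspec[OF bspec[OF nxt(3) that(1)] that(2)]])
        show "rk x \<le> Lm + 2" if "x \<in> C" for x using nxt(4) that by simp
        fix u
        have "{v \<in> set (tl p). par v = u} \<subseteq> {v \<in> set (concat ps). v \<noteq> hd (hd ps) \<and> par v = u}"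
        proof
          fix v assume v: "v \<in> {v \<in> set (tl p). par v = u}"
          then have "v \<in> set p" using parent_order_in(2)[OF p(2)] by auto
          then show "v \<in> {v \<in> set (concat ps). v \<noteq> hd (hd ps) \<and> par v = u}" using root[of v] v subp by auto
        qed
        then have "card {v \<in> set (tl p). par v = u} \<le> card {v \<in> set (concat ps). v \<noteq> hd (hd ps) \<and> par v = u}"
          by (intro card_mono) auto
        then show "card {v \<in> set (tl p). par v = u} \<le> \<Delta>" using ch[of u] by linarith
      qed
      moreover have "(Used \<union> (fst \<circ> \<psi>) ` set p) - Mall \<subseteq> (Used - Mall) \<union> (fst \<circ> \<psi>) ` {v \<in> set p. 1 \<le> rk (\<psi> v)}"
      proof
        fix u assume u: "u \<in> (Used \<union> (fst \<circ> \<psi>) ` set p) - Mall"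
        show "u \<in> (Used - Mall) \<union> (fst \<circ> \<psi>) ` {v \<in> set p. 1 \<le> rk (\<psi> v)}"
        proof (cases "u \<in> Used")
          case True
          then show ?thesis using u by auto
        next
          case False
          then obtain v where v: "v \<in> set p" "u = fst (\<psi> v)" using u by auto
          have "rk (\<psi> v) \<noteq> 0"
          proof
            assume "rk (\<psi> v) = 0"
            then have "u \<in> Mn j (snd (\<psi> v))" using zero[OF v(1)] v(2) by simp
            then have "u \<in> Mall" using jJ by blast
            then show False using u by simp
          qed
          then have "(fst \<circ> \<psi>) v \<in> (fst \<circ> \<psi>) ` {v \<in> set p. 1 \<le> rk (\<psi> v)}"
            using v(1) by (intro imageI) simp
          then show ?thesis using v(2) by simp
        qed
      qed
      then have "card ((Used \<union> (fst \<circ> \<psi>) ` set p) - Mall)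
          \<le> card ((Used - Mall) \<union> (fst \<circ> \<psi>) ` {v \<in> set p. 1 \<le> rk (\<psi> v)})"
        using finU by (intro card_mono) auto
      then have "card ((Used \<union> (fst \<circ> \<psi>) ` set p) - Mall) \<le> card (Used - Mall) + card {v \<in> set p. 1 \<le> rk (\<psi> v)}"
        using card_Un_le[of "Used - Mall" "(fst \<circ> \<psi>) ` {v \<in> set p. 1 \<le> rk (\<psi> v)}"]
          card_image_le[of "{v \<in> set p. 1 \<le> rk (\<psi> v)}" "fst \<circ> \<psi>"] by simp
      ultimately have 4: "card ((fst \<circ> \<phi>') ` ?D (Suc i) - Mall) \<le> Suc i * ?w"
        unfolding img using \<phi>(4) unfolding Used_def by simp
      have 5: "card ((fst \<circ> \<phi>') ` ?D (Suc i) \<inter> Mn j' s)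
          \<le> (\<Sum>i'\<in>{i'. i' < Suc i \<and> a i' = j'}. card {v \<in> set (ps ! i'). cl v = s})" if j': "j' \<in> J" for j' s
      proof -
        \<comment> \<open>An image in a main set has rank 0, so it lies in the main set of
          \<open>j\<close> on its own side; disjointness leaves no other main set.\<close>
        have key: "j' = j \<and> cl v = s" if "v \<in> set p" "fst (\<psi> v) \<in> Mn j' s" for v
        proof -
          have "rk (\<psi> v) = 0" using pos[OF that(1)] that(2) j' by blast
          then have "fst (\<psi> v) \<in> Mn j (cl v)" using zero[OF that(1)] side[OF that(1)] by simp
          then have "(j, cl v) = (j', s)" using disjM[OF jJ j', of "cl v" s] that(2) by blast
          then show ?thesis by simp
        qed
        have u5: "card (Used \<inter> Mn j' s) \<le> (\<Sum>i'\<in>{i'. i' < i \<and> a i' = j'}. card {v \<in> set (ps ! i'). cl v = s})"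
          using \<phi>(5) j' unfolding Used_def by blast
        show ?thesis
        proof (cases "j' = j")
          case True
          have "(Used \<union> (fst \<circ> \<psi>) ` set p) \<inter> Mn j' s \<subseteq> (Used \<inter> Mn j' s) \<union> (fst \<circ> \<psi>) ` {v \<in> set p. cl v = s}"
            using key by auto
          then have "card ((Used \<union> (fst \<circ> \<psi>) ` set p) \<inter> Mn j' s)
              \<le> card ((Used \<inter> Mn j' s) \<union> (fst \<circ> \<psi>) ` {v \<in> set p. cl v = s})"
            using finU by (intro card_mono) auto
          also have "\<dots> \<le> card (Used \<inter> Mn j' s) + card {v \<in> set p. cl v = s}"
            using card_Un_le[of "Used \<inter> Mn j' s" "(fst \<circ> \<psi>) ` {v \<in> set p. cl v = s}"]
              card_image_le[of "{v \<in> set p. cl v = s}" "fst \<circ> \<psi>"] by simp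
          also have "{i'. i' < Suc i \<and> a i' = j'} = insert i {i'. i' < i \<and> a i' = j'}"
            using True j_def by (auto simp: less_Suc_eq)
          then have "card (Used \<inter> Mn j' s) + card {v \<in> set p. cl v = s}
              \<le> (\<Sum>i'\<in>{i'. i' < Suc i \<and> a i' = j'}. card {v \<in> set (ps ! i'). cl v = s})"
            using u5 unfolding p_def by simp
          finally show ?thesis unfolding img .
        next
          case False
          have "(Used \<union> (fst \<circ> \<psi>) ` set p) \<inter> Mn j' s = Used \<inter> Mn j' s" using key False by auto
          moreover have "{i'. i' < Suc i \<and> a i' = j'} = {i'. i' < i \<and> a i' = j'}"
            using False j_def by (auto simp: less_Suc_eq)
          ultimately show ?thesis using u5 unfolding img by simp
        qed
      qed
      show "\<exists>\<phi>. (\<forall>v\<in>?D (Suc i). \<phi> v \<in> C \<and> snd (\<phi> v) = cl v) \<and>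
        (\<forall>v\<in>?D (Suc i). v \<noteq> hd (hd ps) \<longrightarrow> \<phi> v \<in> nb E (\<phi> (par v))) \<and> inj_on (fst \<circ> \<phi>) (?D (Suc i)) \<and>
        card ((fst \<circ> \<phi>) ` ?D (Suc i) - Mall) \<le> Suc i * ?w \<and>
        (\<forall>j\<in>J. \<forall>s. card ((fst \<circ> \<phi>) ` ?D (Suc i) \<inter> Mn j s)
          \<le> (\<Sum>i'\<in>{i'. i' < Suc i \<and> a i' = j}. card {v \<in> set (ps ! i'). cl v = s}))"
      proof (rule exI[of _ \<phi>'], intro conjI)
        show "\<forall>j\<in>J. \<forall>s. card ((fst \<circ> \<phi>') ` ?D (Suc i) \<inter> Mn j s)
          \<le> (\<Sum>i'\<in>{i'. i' < Suc i \<and> a i' = j}. card {v \<in> set (ps ! i'). cl v = s})"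
          using 5 by (intro ballI allI)
      qed (fact 1 2 3 4)+
    qed
  qed
  from this[of "length ps"] obtain \<phi> where "\<forall>v\<in>?D (length ps). \<phi> v \<in> C \<and> snd (\<phi> v) = cl v"
    "\<forall>v\<in>?D (length ps). v \<noteq> hd (hd ps) \<longrightarrow> \<phi> v \<in> nb E (\<phi> (par v))"
    "inj_on (fst \<circ> \<phi>) (?D (length ps))"
    by (elim impE[OF _ order.refl] exE conjE) (rule that; assumption)
  then show ?thesis unfolding take_all[OF order.refl] by (intro exI conjI)
qed

end

section \<open>Linking vertices and reservoir of a host\<close>

context host
begin

lemma finC: "finite C" using CV finV finite_subset by fastforce

lemma PV: "j \<in> J \<Longrightarrow> P j \<subseteq> V" and QV: "j \<in> J \<Longrightarrow> Q j \<subseteq> V"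
  using PC QC CV by blast+

lemma finP: "j \<in> J \<Longrightarrow> finite (P j)" and finQ: "j \<in> J \<Longrightarrow> finite (Q j)"
  using PV QV finV finite_subset by metis+

lemma sum_card_P: "(\<Sum>j\<in>J. real (card (P j))) \<le> real (card V)"
proof -
  have "(\<Sum>j\<in>J. card (P j)) = card (\<Union>j\<in>J. P j)"
    by (rule card_UN_disjoint[symmetric]) (use finJ finP disjP in \<open>auto simp: disjoint_family_on_def\<close>)
  also have "\<dots> \<le> card V" using PV finV by (intro card_mono) auto
  finally show ?thesis by (metis of_nat_le_iff of_nat_sum)
qed

text \<open>Double counting between \<open>C\<close> and the \<open>2 * r\<close> linking vertices:
  these have at least \<open>r * d\<close> edges into \<open>C\<close>, while a vertex of
  \<open>C\<close> sees at most the \<open>r\<close> on the opposite side. Vertices with few linking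
  neighbours absorb at most \<open>\<alpha> * n / 2 * r\<close> edges, so at least
  \<open>\<alpha> * n / 4\<close> vertices have many, and \<open>layer_reaches\<close> starts from
  them.\<close>

lemma linking_layers:
  fixes Lk :: "nat \<Rightarrow> bool \<Rightarrow> 'a set"
  assumes \<alpha>: "0 < \<alpha>" "\<alpha> \<le> 1" and \<epsilon>: "\<epsilon> = \<alpha>\<^sup>2 / 64" and V: "V \<noteq> {}" and j: "j \<in> J"
    and Lk: "Lk j True \<subseteq> P j" "Lk j False \<subseteq> Q j" "card (Lk j True) = r" "card (Lk j False) = r"
    and r: "0 < r" "\<alpha> / 8 * real (card (P j)) \<le> real r"
    and Lm: "32768 / \<alpha> ^ 3 < real Lm"
  shows "layer (nb E) C (\<alpha> ^ 3 / 16384 * real (card V))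
     {x \<in> C. 2 * (\<epsilon> * real (card (P j))) \<le> real (card (nb E x \<inter> {y. fst y \<in> Lk j (snd y)}))} Lm = C"
proof -
  let ?n = "real (card V)"
  define LL where "LL = {y. fst y \<in> Lk j (snd y)}"
  define A where "A = {x \<in> C. 2 * (\<epsilon> * real (card (P j))) \<le> real (card (nb E x \<inter> LL))}"
  have n0: "0 < ?n" using V finV by (simp add: card_gt_0_iff)
  have LLeq: "LL = Lk j True \<times> {True} \<union> Lk j False \<times> {False}"
  proof (rule set_eqI)
    fix y :: "'a \<times> bool"
    show "y \<in> LL \<longleftrightarrow> y \<in> Lk j True \<times> {True} \<union> Lk j False \<times> {False}"
      unfolding LL_def by (cases y; cases "snd y") auto
  qed
  have finL: "finite (Lk j True)" "finite (Lk j False)"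
    using Lk(1,2) finP[OF j] finQ[OF j] finite_subset by blast+
  have finL': "finite (Lk j s)" and cardL: "card (Lk j s) = r" for s
    using finL Lk(3,4) by (cases s; simp)+
  have finLL: "finite LL" unfolding LLeq using finL by auto
  have cLL: "card LL = 2 * r"
    unfolding LLeq by (subst card_Un_disjoint) (use finL Lk(3,4) in \<open>auto simp: card_cartesian_product\<close>)
  have LLC: "LL \<subseteq> C" unfolding LLeq using Lk(1,2) PC[OF j] QC[OF j] by blast
  have side: "card (nb E x \<inter> LL) \<le> r" for x
  proof -
    have "card (nb E x \<inter> LL) = card (fst ` (nb E x \<inter> LL))"
      by (rule card_image[symmetric]) (rule inj_on_subset[OF inj_on_fst_nb], auto)
    also have "\<dots> \<le> card (Lk j (\<not> snd x))"
      unfolding LL_def using finL' nb_snd[of _ E x] by (intro card_mono) auto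
    finally show ?thesis using cardL by simp
  qed
  have cC: "real (card C) \<le> 2 * ?n"
  proof -
    have "card C \<le> card (V \<times> (UNIV :: bool set))" using CV finV by (intro card_mono) auto
    then show ?thesis by (simp add: card_cartesian_product)
  qed
  have "real r * d = (\<Sum>y\<in>LL. d / 2)" using cLL by simp
  also have "\<dots> \<le> ecount (nb E) LL C" unfolding ecount_def using inner LLC by (intro sum_mono) auto
  also have "\<dots> = ecount (nb E) C LL" by (rule ecount_commute[OF finLL finC nb_sym])
  also have "\<dots> \<le> (\<Sum>x\<in>C. 2 * (\<epsilon> * real (card (P j))) + (if x \<in> A then real r else 0))"
    unfolding ecount_def
  proof (rule sum_mono)
    fix x assume x: "x \<in> C"
    have "0 \<le> 2 * (\<epsilon> * real (card (P j)))" unfolding \<epsilon> by simp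
    moreover have "real (card (nb E x \<inter> LL)) \<le> real r" using side[of x] by simp
    moreover have "real (card (nb E x \<inter> LL)) \<le> 2 * (\<epsilon> * real (card (P j)))" if "x \<notin> A"
      using that x unfolding A_def by simp
    ultimately show "real (card (nb E x \<inter> LL)) \<le> 2 * (\<epsilon> * real (card (P j))) + (if x \<in> A then real r else 0)"
      by (cases "x \<in> A") auto
  qed
  also have "\<dots> = real (card C) * (2 * (\<epsilon> * real (card (P j)))) + real (card A) * real r"
  proof -
    have "C \<inter> {x. x \<in> A} = A" unfolding A_def by auto
    then show ?thesis using finC by (simp add: sum.distrib sum.If_cases)
  qed
  finally have up: "real r * d \<le> real (card C) * (2 * (\<epsilon> * real (card (P j)))) + real (card A) * real r" .
  have "real (card C) * (2 * (\<epsilon> * real (card (P j)))) \<le> 2 * ?n * (2 * (\<epsilon> * real (card (P j))))"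
    using cC unfolding \<epsilon> by (intro mult_right_mono) auto
  also have "\<dots> = \<alpha> * ?n / 2 * (\<alpha> / 8 * real (card (P j)))" unfolding \<epsilon> by (simp add: power2_eq_square)
  also have "\<dots> \<le> \<alpha> * ?n / 2 * real r" using r(2) \<alpha> by (intro mult_left_mono) auto
  finally have "real r * d \<le> (\<alpha> * ?n / 2 + real (card A)) * real r" using up by (simp only: distrib_right)
  then have "d * real r \<le> (\<alpha> * ?n / 2 + real (card A)) * real r" by (simp only: mult.commute)
  then have "d \<le> \<alpha> * ?n / 2 + real (card A)" using r(1) by (simp only: mult_le_cancel_right_pos of_nat_0_less_iff)
  then have cA: "\<alpha> * ?n / 4 \<le> real (card A)" using d(1) mult_pos_pos[OF \<alpha>(1) n0] by linarith
  have AC: "A \<subseteq> C" unfolding A_def by auto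
  \<comment> \<open>Chosen so that \<open>2 * t * card C\<close>, with
    \<open>card C \<le> 2 * n\<close>, is at most the expansion of a set of size
    \<open>\<alpha> * n / 4\<close>. The quotient \<open>2 * n / t\<close> is the lower bound on
    \<open>Lm\<close>.\<close>
  let ?t = "\<alpha> ^ 3 / 16384 * ?n"
  have \<alpha>3: "0 < \<alpha> ^ 3" "\<alpha> ^ 3 \<le> \<alpha>" using \<alpha> power_decreasing[of 1 3 \<alpha>] by auto
  have t0: "0 < ?t" using \<alpha>3 n0 by simp
  have "?t \<le> \<alpha> / 4 * ?n" using \<alpha>3 \<alpha> n0 by (intro mult_right_mono) auto
  then have t4: "?t \<le> d / 4" using d(1) by linarith
  have t: "2 * ?t * real (card C) \<le> \<alpha>\<^sup>2 / 1024 * ?n * min (\<alpha> * ?n / 4) (d / 4)"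
  proof -
    have "2 * ?t * real (card C) \<le> 2 * ?t * (2 * ?n)" using cC t0 by (intro mult_left_mono) linarith+
    also have "\<dots> = \<alpha>\<^sup>2 / 1024 * ?n * (\<alpha> * ?n / 4)" by (simp add: power2_eq_square power3_eq_cube)
    also have "\<alpha> * ?n / 4 = min (\<alpha> * ?n / 4) (d / 4)" using d(1) by (simp add: min_def)
    finally show ?thesis .
  qed
  have "2 * ?n = 32768 / \<alpha> ^ 3 * ?t" using \<alpha>3 by simp
  also have "\<dots> < real Lm * ?t" using Lm t0 by (intro mult_strict_right_mono)
  finally have l: "real (card C) < real Lm * ?t" using cC by linarith
  show ?thesis
    using layer_reaches[OF finC nb_sym inner expand _ AC cA t0 t4 t l] unfolding A_def LL_def by simp
qed

text \<open>Each side of a pair is split into linking vertices, a share of the reservoir and the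
  main set. The first two are small enough for the main sets to hold the balanced loads, and the
  hypotheses \<open>num\<close> are what the error terms require.\<close>

lemma embed_tree:
  fixes par :: "'b \<Rightarrow> 'b" and cl :: "'b \<Rightarrow> bool" and K W r Lm \<Delta> s0 m :: nat
  assumes \<alpha>: "0 < \<alpha>" "\<alpha> \<le> 1" and \<epsilon>: "\<epsilon> = \<alpha>\<^sup>2 / 64" and \<zeta>: "0 < \<zeta>" and \<gamma>: "0 < \<gamma>" and V: "V \<noteq> {}"
    and Lm: "32768 / \<alpha> ^ 3 < real Lm" and K_eq: "K = (\<Delta> + 1) * s0"
    and W: "W = (2 * s0 + 1) * (\<Delta> + 2) ^ (Lm + 2)" and s0: "1 \<le> s0" "card V \<le> s0\<^sup>2"
    and num: "real K \<le> \<gamma> * real (card V) / 4" "real (W + K) \<le> \<epsilon> * \<zeta> * real (card V)"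
      "real ((W + K) * r) \<le> \<alpha> ^ 3 / 32768 * real (card V)"
      "sqrt (2 * real K * real (card V)) + 1 + real ((W + K) * r) \<le> \<alpha> * \<zeta> * real (card V) / 4"
      "2 * real (card V) / \<zeta> * real Lm < exp (\<alpha> ^ 3 / 32768) ^ r"
    and vs: "parent_order par vs" "vs \<noteq> []" "\<And>u. card {v \<in> set (tl vs). par v = u} \<le> \<Delta>"
      "\<And>v. v \<in> set (tl vs) \<Longrightarrow> cl v = (\<not> cl (par v))"
    and m: "\<And>s. card {v \<in> set vs. cl v = s} = m" "real m \<le> d - \<alpha> * real (card V)"
  shows "\<exists>\<phi>. (\<forall>v\<in>set vs. \<phi> v \<in> C \<and> snd (\<phi> v) = cl v) \<and>
     (\<forall>v\<in>set (tl vs). \<phi> v \<in> nb E (\<phi> (par v))) \<and> inj_on (fst \<circ> \<phi>) (set vs)"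
proof -
  let ?n = "real (card V)"
  have n0: "0 < ?n" using V finV by (simp add: card_gt_0_iff)
  define side where "side j s = (if s then P j else Q j)" for j s
  have cside: "card (side j s) = card (P j)" if "j \<in> J" for j s using cardQ[OF that] unfolding side_def by simp
  have finside: "finite (side j s)" if "j \<in> J" for j s using finP[OF that] finQ[OF that] unfolding side_def by simp
  have sideV: "side j s \<subseteq> V" if "j \<in> J" for j s using PV[OF that] QV[OF that] unfolding side_def by simp
  have sideC: "side j s \<times> {s} \<subseteq> C" if "j \<in> J" for j s
    using PC[OF that] QC[OF that] unfolding side_def by (cases s) auto
  have disj: "side i s \<inter> side j s' = {}" if "i \<in> J" "j \<in> J" "(i, s) \<noteq> (j, s')" for i j s s'
    using that disjP disjQ disjPQ[of i j] disjPQ[of j i] unfolding side_def disjoint_family_on_def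
    by (cases s; cases s') auto
  have cpos: "0 < real (card (P j))" if "j \<in> J" for j
    using size[OF that] mult_pos_pos[OF \<zeta> n0] by linarith
  \<comment> \<open>A proportion \<open>\<alpha> / 8\<close> of each side is set aside for linking;
    the ceiling causes the summand 1 in \<open>num(4)\<close>.\<close>
  define rj where "rj j = nat \<lceil>\<alpha> / 8 * real (card (P j))\<rceil>" for j
  have rj: "\<alpha> / 8 * real (card (P j)) \<le> real (rj j)" "real (rj j) \<le> \<alpha> / 8 * real (card (P j)) + 1" "0 < rj j"
    if "j \<in> J" for j
  proof -
    have "0 < \<alpha> / 8 * real (card (P j))" using \<alpha> cpos[OF that] by simp
    then show "\<alpha> / 8 * real (card (P j)) \<le> real (rj j)" "real (rj j) \<le> \<alpha> / 8 * real (card (P j)) + 1" "0 < rj j"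
      unfolding rj_def by linarith+
  qed
  have rjc: "rj j \<le> card (side j s)" if j: "j \<in> J" for j s
  proof -
    have "\<alpha> / 8 * real (card (P j)) \<le> 1 * real (card (P j))" using \<alpha> by (intro mult_right_mono) auto
    then show ?thesis unfolding rj_def cside[OF j] by linarith
  qed
  have "\<forall>j s. \<exists>L. j \<in> J \<longrightarrow> L \<subseteq> side j s \<and> card L = rj j" using rjc by (meson obtain_subset_with_card_n)
  then obtain Lk where Lk: "\<And>j s. j \<in> J \<Longrightarrow> Lk j s \<subseteq> side j s" "\<And>j s. j \<in> J \<Longrightarrow> card (Lk j s) = rj j" by metis
  define t where "t = \<alpha> ^ 3 / 16384 * ?n"
  have \<alpha>3: "0 < \<alpha> ^ 3" using \<alpha> by simp
  have t0: "0 < t" unfolding t_def using \<alpha>3 n0 by simp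
  define A1 where "A1 j = {x \<in> C. 2 * (\<epsilon> * real (card (P j))) \<le> real (card (nb E x \<inter> {y. fst y \<in> Lk j (snd y)}))}" for j
  define lay where "lay j = layer (nb E) C t (A1 j)" for j
  have layL: "lay j Lm = C" if j: "j \<in> J" for j
    unfolding lay_def t_def A1_def
    by (rule linking_layers[where Lk = Lk and r = "rj j", OF \<alpha> \<epsilon> V j _ _ Lk(2)[OF j] Lk(2)[OF j] rj(3,1)[OF j] Lm])
      (use Lk(1)[OF j, of True] Lk(1)[OF j, of False] side_def in auto)
  have layC: "lay j l \<subseteq> C" for j l unfolding lay_def by (rule layer_subset) (auto simp: A1_def)
  have finnb: "finite (nb E x)" for x using nb_subset[OF EV, of x] finV finite_subset by fastforce
  have injS: "inj_on fst (nb E x \<inter> S)" for x S by (rule inj_on_subset[OF inj_on_fst_nb]) auto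
  \<comment> \<open>The neighbourhoods that must meet the reservoir often, projected to
    \<open>V\<close>. A vertex enters a new layer through at least \<open>t\<close> neighbours, so
    only sets of this size matter.\<close>
  define \<F> where "\<F> = {F \<in> (\<lambda>(x, j, l). fst ` (nb E x \<inter> lay j l)) ` (C \<times> J \<times> {..<Lm}). t \<le> real (card F)}"
  have fin\<F>: "finite \<F>" unfolding \<F>_def using finC finJ by auto
  have cJ: "real (card J) * \<zeta> \<le> 1"
  proof -
    have "real (card J) * (\<zeta> * ?n) = (\<Sum>j\<in>J. \<zeta> * ?n)" by simp
    also have "\<dots> \<le> (\<Sum>j\<in>J. real (card (P j)))" using size by (intro sum_mono) auto
    also have "\<dots> \<le> ?n" by (rule sum_card_P)
    finally have "real (card J) * \<zeta> * ?n \<le> 1 * ?n" by (simp add: mult.assoc)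
    then show ?thesis using n0 by (simp only: mult_le_cancel_right_pos)
  qed
  have c\<F>: "real (card \<F>) < exp (\<alpha> ^ 3 / 32768) ^ r"
  proof -
    have "card \<F> \<le> card ((\<lambda>(x, j, l). fst ` (nb E x \<inter> lay j l)) ` (C \<times> J \<times> {..<Lm}))"
      unfolding \<F>_def using finC finJ by (intro card_mono) auto
    also have "\<dots> \<le> card (C \<times> J \<times> {..<Lm})" using finC finJ by (intro card_image_le) auto
    also have "\<dots> = card C * (card J * Lm)" by (simp add: card_cartesian_product)
    finally have "real (card \<F>) \<le> real (card C) * (real (card J) * real Lm)" by (simp flip: of_nat_mult)
    also have "\<dots> \<le> (2 * ?n) * ((1 / \<zeta>) * real Lm)"
    proof (intro mult_mono)
      have "card C \<le> card (V \<times> (UNIV :: bool set))" using CV finV by (intro card_mono) auto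
      then show "real (card C) \<le> 2 * ?n" by (simp add: card_cartesian_product)
      show "real (card J) \<le> 1 / \<zeta>" using cJ \<zeta> by (simp add: field_simps)
    qed (use \<zeta> in auto)
    finally show ?thesis using num(5) by simp
  qed
  have "\<exists>R\<subseteq>V. card R \<le> (W + K) * r \<and> (\<forall>F\<in>\<F>. W + K \<le> card (F \<inter> R))"
  \<comment> \<open>Half of each set may be used up by earlier rounds; hence \<open>t / 2\<close>,
    and 32768 in place of 16384 in \<open>num\<close>.\<close>
  proof (rule multiple_hitting[OF finV V fin\<F>, of "t / 2"])
    show "F \<subseteq> V \<and> 2 * (t / 2) \<le> real (card F)" if "F \<in> \<F>" for F
      using that nb_subset[OF EV] unfolding \<F>_def by fastforce
    show "0 < t / 2" using t0 by simp
    show "real (card \<F>) < exp (t / 2 / real (card V)) ^ r" using c\<F> n0 unfolding t_def by simp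
    show "real ((W + K) * r) \<le> t / 2" using num(3) unfolding t_def by simp
  qed
  then obtain R where R: "R \<subseteq> V" "card R \<le> (W + K) * r" "\<And>F. F \<in> \<F> \<Longrightarrow> W + K \<le> card (F \<inter> R)" by blast
  have finR: "finite R" using R(1) finV finite_subset by auto
  define Mn where "Mn j s = side j s - Lk j s - R" for j s
  have finL: "finite (Lk j s)" if "j \<in> J" for j s using Lk(1)[OF that] finside[OF that] finite_subset by metis
  interpret linkage V E C J Mn Lk R lay Lm "W + K" K W "\<lambda>j. \<epsilon> * real (card (P j))" "\<gamma> * ?n / 4"
  proof
    show "finite V" "E \<subseteq> V \<times> V" "C \<subseteq> V \<times> UNIV" by (rule finV, rule EV, rule CV)
    show "Mn j s \<times> {s} \<subseteq> C" if "j \<in> J" for j s using sideC[OF that, of s] unfolding Mn_def by auto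
    show "Lk j s \<times> {s} \<subseteq> C" if "j \<in> J" for j s using sideC[OF that, of s] Lk(1)[OF that, of s] by auto
    show "Mn i s \<inter> Mn j s' = {}" if "i \<in> J" "j \<in> J" "(i, s) \<noteq> (j, s')" for i j s s'
      using disj[OF that] unfolding Mn_def by auto
    show "Lk i s \<inter> Mn j s' = {}" if "i \<in> J" "j \<in> J" for i j s s'
    proof (cases "(i, s) = (j, s')")
      case True
      then show ?thesis unfolding Mn_def by auto
    next
      case False
      then show ?thesis using disj[OF that False] Lk(1)[OF that(1), of s] unfolding Mn_def by auto
    qed
    show "R \<inter> Mn j s = {}" if "j \<in> J" for j s unfolding Mn_def by auto
    show "lay j l \<subseteq> C" if "j \<in> J" for j l by (rule layC)
    show "2 * (\<epsilon> * real (card (P j))) \<le> real (card (nb E x \<inter> {y. fst y \<in> Lk j (snd y)}))"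
      if "j \<in> J" "x \<in> lay j 0" for j x using that unfolding lay_def A1_def by simp
    show "W + K \<le> card (nb E x \<inter> lay j l \<inter> {y. fst y \<in> R})"
      if x: "j \<in> J" "x \<in> lay j (Suc l)" "x \<notin> lay j l" for j l x
    proof -
      have xC: "x \<in> C" and tx: "t \<le> real (card (nb E x \<inter> lay j l))" using x unfolding lay_def by auto
      have "l < Lm"
      proof (rule ccontr)
        assume "\<not> l < Lm"
        then have "C \<subseteq> lay j l" using layL[OF x(1)] layer_mono[of Lm l "nb E" C t "A1 j"] unfolding lay_def by simp
        then show False using xC x(3) by auto
      qed
      moreover have "card (fst ` (nb E x \<inter> lay j l)) = card (nb E x \<inter> lay j l)" by (rule card_image[OF injS])
      ultimately have "fst ` (nb E x \<inter> lay j l) \<in> \<F>"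
        unfolding \<F>_def using xC x(1) tx by (auto intro!: image_eqI[of _ _ "(x, j, l)"])
      then have "W + K \<le> card (fst ` (nb E x \<inter> lay j l) \<inter> R)" by (rule R(3))
      also have "fst ` (nb E x \<inter> lay j l) \<inter> R = fst ` (nb E x \<inter> (lay j l \<inter> {y. fst y \<in> R}))" by auto
      also have "card \<dots> = card (nb E x \<inter> (lay j l \<inter> {y. fst y \<in> R}))" by (rule card_image[OF injS])
      finally show ?thesis by (simp only: Int_assoc)
    qed
    show "lay j Lm = C" if "j \<in> J" for j by (rule layL[OF that])
    show "2 * (\<gamma> * ?n / 4) * ?n < acount E A B"
      if j: "j \<in> J" and AB: "A \<subseteq> Mn j True \<union> Lk j True" "B \<subseteq> Mn j False \<union> Lk j False"
        "\<epsilon> * real (card (P j)) \<le> real (card A)" "\<epsilon> * real (card (P j)) \<le> real (card B)" for j A B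
    proof -
      have "Mn j s \<union> Lk j s \<subseteq> side j s" for s using Lk(1)[OF j, of s] unfolding Mn_def by auto
      from this[of True] this[of False] have "A \<subseteq> P j" "B \<subseteq> Q j"
        using AB(1,2) unfolding side_def by auto
      from reg[OF j this AB(3,4)] have "\<gamma> * ?n\<^sup>2 \<le> acount E A B" .
      moreover have "0 < \<gamma> * ?n\<^sup>2" using \<gamma> n0 by simp
      ultimately show ?thesis by (simp add: power2_eq_square)
    qed
    show "real K \<le> \<gamma> * ?n / 4" by (rule num(1))
    show "W + K \<le> W + K" by simp
    show "real W + real K \<le> \<epsilon> * real (card (P j))" if "j \<in> J" for j
    proof -
      have "\<epsilon> * (\<zeta> * ?n) \<le> \<epsilon> * real (card (P j))" using size[OF that] unfolding \<epsilon> by (intro mult_left_mono) auto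
      then show ?thesis using num(2) by (simp add: mult.assoc)
    qed
  qed
  obtain ps where ps: "piece_order par ps" "set (concat ps) = set vs" "ps \<noteq> []" "hd (hd ps) = hd vs"
    "\<forall>p\<in>set ps. length p \<le> (\<Delta> + 1) * s0" "s0 * length ps \<le> length vs + s0"
    using cut_tree[OF vs(1,2,3) s0(1)] by auto
  have distvs: "distinct vs" using vs(1) unfolding parent_order_def by simp
  have distps: "distinct (concat ps)" "[] \<notin> set ps" using ps(1) unfolding piece_order_def by auto
  then have distinct: "distinct ps" unfolding distinct_concat_iff by (simp add: removeAll_id)
  have tlvs: "set (tl vs) = {v \<in> set vs. v \<noteq> hd vs}" using vs(2) distvs by (cases vs) auto
  have lenvs: "length vs = 2 * m"
  proof -
    have "length vs = card (set vs)" using distvs by (simp add: distinct_card)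
    also have "\<dots> = card ({v \<in> set vs. cl v = True} \<union> {v \<in> set vs. cl v = False})"
      by (rule arg_cong[where f = card]) auto
    also have "\<dots> = card {v \<in> set vs. cl v = True} + card {v \<in> set vs. cl v = False}"
      by (rule card_Un_disjoint) auto
    finally show ?thesis by (simp only: m(1) mult_2)
  qed
  have mn: "real m \<le> ?n" using m(2) d(2) mult_pos_pos[OF \<alpha>(1) n0] by linarith
  \<comment> \<open>The tree has at most \<open>2 * n\<close> vertices and
    \<open>n \<le> s0\<^sup>2\<close>, so pieces of size about \<open>s0\<close> number at most
    \<open>2 * s0\<close>, plus one for the root.\<close>
  have "length ps \<le> 2 * s0 + 1"
  proof -
    have "s0 * length ps \<le> 2 * card V + s0" using ps(6) lenvs mn by simp
    also have "\<dots> \<le> s0 * (2 * s0 + 1)" using s0(2) by (simp add: power2_eq_square algebra_simps)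
    finally show ?thesis using s0(1) by (simp only: mult_le_cancel1)
  qed
  then have lenW: "length ps * (\<Delta> + 2) ^ (Lm + 2) \<le> W" unfolding W by (intro mult_right_mono) auto
  define x where "x s i = real (card {v \<in> set (ps ! i). cl v = s})" for s i
  define c where "c = (\<Sum>j\<in>J. real (card (P j)))"
  define \<omega> where "\<omega> j = real (card (P j)) / c" for j
  have c: "real m + \<alpha> * ?n / 2 \<le> c" "c \<le> ?n" unfolding c_def using total m(2) sum_card_P by linarith+
  have c0: "0 < c" using c(1) mult_pos_pos[OF \<alpha>(1) n0] by linarith
  have \<omega>: "\<And>j. j \<in> J \<Longrightarrow> 0 < \<omega> j" "(\<Sum>j\<in>J. \<omega> j) = 1"
    unfolding \<omega>_def using cpos c0 by (simp_all add: sum_divide_distrib[symmetric] c_def[symmetric])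
  have sumx: "(\<Sum>i<length ps. x s i) = real m" for s
  proof -
    have "card {v \<in> set vs. cl v = s} = (\<Sum>i<length ps. card {v \<in> set (ps ! i). cl v = s})"
    proof -
      have "{v \<in> set vs. cl v = s} = (\<Union>i\<in>{..<length ps}. {v \<in> set (ps ! i). cl v = s})"
        unfolding ps(2)[symmetric] set_concat set_conv_nth[of ps] by auto
      also have "card \<dots> = (\<Sum>i<length ps. card {v \<in> set (ps ! i). cl v = s})"
      proof (rule card_UN_disjoint)
        show "\<forall>i\<in>{..<length ps}. \<forall>j\<in>{..<length ps}. i \<noteq> j \<longrightarrow>
            {v \<in> set (ps ! i). cl v = s} \<inter> {v \<in> set (ps ! j). cl v = s} = {}"
        proof (intro ballI impI)
          fix i j assume ij: "i \<in> {..<length ps}" "j \<in> {..<length ps}" "i \<noteq> j"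
          have "set (ps ! i) \<inter> set (ps ! j) = {}"
            using distps(1) distinct ij nth_eq_iff_index_eq[of ps i j] unfolding distinct_concat_iff by simp
          then show "{v \<in> set (ps ! i). cl v = s} \<inter> {v \<in> set (ps ! j). cl v = s} = {}" by auto
        qed
      qed auto
      finally show ?thesis .
    qed
    then show ?thesis unfolding x_def using m(1)[of s] by (simp flip: of_nat_sum)
  qed
  obtain a where a: "\<forall>i<length ps. a i \<in> J" and
    dev: "(\<Sum>j\<in>J. ((\<Sum>i\<in>{i. i < length ps \<and> a i = j}. x True i) - \<omega> j * (\<Sum>i<length ps. x True i))\<^sup>2
           + ((\<Sum>i\<in>{i. i < length ps \<and> a i = j}. x False i) - \<omega> j * (\<Sum>i<length ps. x False i))\<^sup>2)
     \<le> (\<Sum>i<length ps. (x True i)\<^sup>2 + (x False i)\<^sup>2)"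
    using balanced_assignment[OF finJ \<omega>, of "length ps" "x True" "x False"] by blast
  \<comment> \<open>No piece has more than \<open>K\<close> vertices, so the sum of squares is at
    most \<open>K\<close> times the number of vertices in both classes. The deviation of each load
    is then at most \<open>sqrt (2 * K * n)\<close>.\<close>
  have sq: "(\<Sum>i<length ps. (x True i)\<^sup>2 + (x False i)\<^sup>2) \<le> 2 * real K * ?n"
  proof -
    have xK: "x s i \<le> real K" if "i < length ps" for s i
    proof -
      have "card {v \<in> set (ps ! i). cl v = s} \<le> card (set (ps ! i))" by (intro card_mono) auto
      also have "\<dots> \<le> length (ps ! i)" by (rule card_length)
      also have "\<dots> \<le> K" using ps(5) that unfolding K_eq by simp
      finally show ?thesis unfolding x_def by simp
    qed
    have "(\<Sum>i<length ps. (x True i)\<^sup>2 + (x False i)\<^sup>2) \<le> (\<Sum>i<length ps. real K * x True i + real K * x False i)"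
    proof (intro sum_mono add_mono)
      fix i assume "i \<in> {..<length ps}"
      then have "x s i * x s i \<le> real K * x s i" for s using xK[of i s] by (intro mult_right_mono) (auto simp: x_def)
      then show "(x True i)\<^sup>2 \<le> real K * x True i" "(x False i)\<^sup>2 \<le> real K * x False i"
        by (simp_all add: power2_eq_square)
    qed
    also have "\<dots> = real K * real m + real K * real m"
      by (simp only: sum.distrib sum_distrib_left[symmetric] sumx)
    also have "\<dots> \<le> real K * ?n + real K * ?n" using mn by (intro add_mono mult_left_mono) auto
    finally show ?thesis by simp
  qed
  \<comment> \<open>In units of \<open>\<alpha> / 8\<close> times the pair size, the slack is four:
    one unit pays for the linking vertices, one for the term with \<open>\<epsilon>\<close>, and
    two, by \<open>num(4)\<close>, for the deviation, the rounding and the reservoir.\<close>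
  have load: "(\<Sum>i\<in>{i. i < length ps \<and> a i = j}. real (card {v \<in> set (ps ! i). cl v = s}))
      + 2 * (\<epsilon> * real (card (P j))) \<le> real (card (Mn j s))" if j: "j \<in> J" for j s
  proof -
    define D where "D s j = (\<Sum>i\<in>{i. i < length ps \<and> a i = j}. x s i) - \<omega> j * real m" for s j
    have "(\<Sum>j\<in>J. (D True j)\<^sup>2 + (D False j)\<^sup>2) \<le> 2 * real K * ?n"
      using dev sq unfolding D_def sumx by linarith
    moreover have "(D True j)\<^sup>2 + (D False j)\<^sup>2 \<le> (\<Sum>j\<in>J. (D True j)\<^sup>2 + (D False j)\<^sup>2)"
      by (rule member_le_sum[OF j _ finJ]) simp
    moreover have "(D s j)\<^sup>2 \<le> (D True j)\<^sup>2 + (D False j)\<^sup>2" by (cases s) auto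
    ultimately have "(D s j)\<^sup>2 \<le> 2 * real K * ?n" by linarith
    then have "D s j \<le> sqrt (2 * real K * ?n)" by (rule real_le_rsqrt)
    then have L: "(\<Sum>i\<in>{i. i < length ps \<and> a i = j}. x s i) \<le> \<omega> j * real m + sqrt (2 * real K * ?n)"
      unfolding D_def by linarith
    let ?c = "real (card (P j))"
    have "\<omega> j * real m \<le> ?c * (1 - \<alpha> / 2)"
    proof -
      have "real m \<le> c - \<alpha> * ?n / 2" using c(1) by linarith
      also have "\<dots> \<le> c - \<alpha> * c / 2" using c(2) \<alpha> by (simp add: mult_left_mono)
      finally have "real m \<le> c * (1 - \<alpha> / 2)" by (simp add: algebra_simps)
      then have "?c * real m \<le> ?c * (c * (1 - \<alpha> / 2))" by (intro mult_left_mono) auto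
      then show ?thesis unfolding \<omega>_def using c0 by (simp add: field_simps)
    qed
    moreover have "real (card (Mn j s)) \<ge> ?c - real (rj j) - real (card R)"
    proof -
      have "card (side j s - Lk j s) = card (side j s) - card (Lk j s)"
        using Lk(1)[OF j] finL[OF j] by (intro card_Diff_subset) auto
      moreover have "card (side j s - Lk j s) - card R \<le> card (Mn j s)"
        unfolding Mn_def by (rule diff_card_le_card_Diff[OF finR])
      ultimately show ?thesis using cside[OF j] Lk(2)[OF j] by simp
    qed
    moreover have "real (card R) \<le> real ((W + K) * r)" using R(2) by (simp only: of_nat_le_iff)
    moreover have "\<alpha> * \<zeta> * ?n / 4 \<le> \<alpha> / 4 * ?c"
      using mult_left_mono[OF size[OF j], of "\<alpha> / 4"] \<alpha> by (simp add: algebra_simps)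
    moreover have "2 * (\<epsilon> * ?c) \<le> \<alpha> / 8 * ?c"
    proof -
      have "\<alpha>\<^sup>2 \<le> \<alpha>" using \<alpha> power_decreasing[of 1 2 \<alpha>] by simp
      then have "2 * \<epsilon> \<le> \<alpha> / 8" unfolding \<epsilon> using \<alpha> by linarith
      then have "2 * \<epsilon> * ?c \<le> \<alpha> / 8 * ?c" by (intro mult_right_mono) auto
      then show ?thesis by simp
    qed
    moreover have "?c * (1 - \<alpha> / 2) = ?c - 4 * (\<alpha> / 8 * ?c)" "\<alpha> / 4 * ?c = 2 * (\<alpha> / 8 * ?c)"
      by (simp_all add: algebra_simps)
    ultimately have "(\<Sum>i\<in>{i. i < length ps \<and> a i = j}. x s i) + 2 * (\<epsilon> * ?c) \<le> real (card (Mn j s))"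
      using L num(4) rj(2)[OF j] by linarith
    then show ?thesis unfolding x_def .
  qed
  have "J \<noteq> {}" using \<omega>(2) by auto
  then obtain j0 where j0: "j0 \<in> J" by auto
  have Cside: "\<exists>x\<in>C. snd x = s" for s
  proof -
    have "side j0 s \<noteq> {}" using cside[OF j0, of s] cpos[OF j0] by auto
    then obtain u where "u \<in> side j0 s" by auto
    then show ?thesis using sideC[OF j0, of s] by force
  qed
  have "\<exists>\<phi>. (\<forall>v\<in>set (concat ps). \<phi> v \<in> C \<and> snd (\<phi> v) = cl v) \<and>
    (\<forall>v\<in>set (concat ps). v \<noteq> hd (hd ps) \<longrightarrow> \<phi> v \<in> nb E (\<phi> (par v))) \<and> inj_on (fst \<circ> \<phi>) (set (concat ps))"
  proof (rule embed_pieces[where a = a and \<Delta> = \<Delta>, OF ps(1) _ _ _ _ lenW load Cside])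
    show "\<forall>p\<in>set ps. length p \<le> K" using ps(5) unfolding K_eq .
    show "a i \<in> J" if "i < length ps" for i using a that by simp
    show "card {v \<in> set (concat ps). v \<noteq> hd (hd ps) \<and> par v = u} \<le> \<Delta>" for u
    proof -
      have "{v \<in> set (concat ps). v \<noteq> hd (hd ps) \<and> par v = u} = {v \<in> set (tl vs). par v = u}"
        unfolding ps(2,4) tlvs by auto
      then show ?thesis using vs(3) by simp
    qed
    show "cl v = (\<not> cl (par v))" if "v \<in> set (concat ps)" "v \<noteq> hd (hd ps)" for v
      using vs(4)[of v] that unfolding ps(2,4) tlvs by simp
  qed
  then show ?thesis unfolding ps(2,4) tlvs by auto
qed

end

section \<open>The choice of parameters\<close>

lemma polylog_le_sqrt:
  fixes A :: real
  shows "\<exists>n0. \<forall>n\<ge>n0. A * ln (real n) ^ k \<le> sqrt (real n)"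
proof -
  have "filterlim (\<lambda>n. ln (real n) / 2) at_top sequentially" by real_asymp
  from filterlim_compose[OF tendsto_power_div_exp_0 this]
  have lim: "(\<lambda>n. (ln (real n) / 2) ^ k / exp (ln (real n) / 2)) \<longlonglongrightarrow> 0" .
  define c where "c = 1 / (\<bar>A\<bar> * 2 ^ k + 1)"
  have A1: "0 < \<bar>A\<bar> * 2 ^ k + 1" by (simp add: add_nonneg_pos)
  then have c0: "0 < c" unfolding c_def by simp
  have "eventually (\<lambda>n. (ln (real n) / 2) ^ k / exp (ln (real n) / 2) < c) sequentially"
    by (rule order_tendstoD(2)[OF lim c0])
  then obtain n0 where n0: "\<forall>n\<ge>n0. (ln (real n) / 2) ^ k / exp (ln (real n) / 2) < c"
    by (auto simp: eventually_sequentially)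
  have "A * ln (real n) ^ k \<le> sqrt (real n)" if n: "n \<ge> max n0 1" for n
  proof -
    have n1: "1 \<le> real n" using n by simp
    have L0: "0 \<le> ln (real n)" using n1 by simp
    have "exp (ln (real n) / 2) = exp (ln (sqrt (real n)))" using n1 by (simp add: ln_sqrt)
    then have e: "exp (ln (real n) / 2) = sqrt (real n)" using n1 by simp
    have s0: "0 < sqrt (real n)" using n1 by simp
    have "(ln (real n) / 2) ^ k / sqrt (real n) < c" using n0 n e by auto
    then have "(ln (real n) / 2) ^ k < c * sqrt (real n)" using s0 by (simp add: pos_divide_less_eq)
    then have "ln (real n) ^ k < 2 ^ k * (c * sqrt (real n))" by (simp add: power_divide divide_less_eq mult.commute)
    then have "\<bar>A\<bar> * ln (real n) ^ k \<le> \<bar>A\<bar> * (2 ^ k * (c * sqrt (real n)))"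
      by (intro mult_left_mono) auto
    also have "\<dots> = (\<bar>A\<bar> * 2 ^ k * c) * sqrt (real n)" by simp
    also have "\<dots> \<le> 1 * sqrt (real n)"
    proof (rule mult_right_mono)
      show "\<bar>A\<bar> * 2 ^ k * c \<le> 1" unfolding c_def using A1 by (simp add: divide_le_eq)
    qed (use s0 in auto)
    finally have "\<bar>A\<bar> * ln (real n) ^ k \<le> sqrt (real n)" by simp
    moreover have "A * ln (real n) ^ k \<le> \<bar>A\<bar> * ln (real n) ^ k" using L0 by (intro mult_right_mono) auto
    ultimately show ?thesis by linarith
  qed
  then show ?thesis by blast
qed

text \<open>\<open>Lm\<close> depends on \<open>\<alpha>\<close> only, so
  \<open>(\<Delta> + 2) ^ (Lm + 2)\<close> stays polylogarithmic; this is where the degree bound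
  enters. With \<open>s0\<close> about \<open>sqrt n\<close> and \<open>r\<close> logarithmic,
  \<open>(W + K) * r\<close> is \<open>sqrt n\<close> times a power of the logarithm, hence below
  any fixed proportion of \<open>n\<close>.\<close>

lemma embedding_parameters:
  fixes \<alpha> \<epsilon> \<zeta> \<gamma> :: real
  assumes \<alpha>: "0 < \<alpha>" "\<alpha> \<le> 1" and pos: "0 < \<epsilon>" "0 < \<zeta>" "0 < \<gamma>"
  shows "\<exists>n1. \<forall>n\<ge>n1. \<forall>\<Delta> :: nat. real \<Delta> \<le> ln (real n) ^ c \<longrightarrow> (\<exists>Lm K W r s0 :: nat.
     32768 / \<alpha> ^ 3 < real Lm \<and> K = (\<Delta> + 1) * s0 \<and> W = (2 * s0 + 1) * (\<Delta> + 2) ^ (Lm + 2) \<and>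
     1 \<le> s0 \<and> n \<le> s0\<^sup>2 \<and> real K \<le> \<gamma> * real n / 4 \<and> real (W + K) \<le> \<epsilon> * \<zeta> * real n \<and>
     real ((W + K) * r) \<le> \<alpha> ^ 3 / 32768 * real n \<and>
     sqrt (2 * real K * real n) + 1 + real ((W + K) * r) \<le> \<alpha> * \<zeta> * real n / 4 \<and>
     2 * real n / \<zeta> * real Lm < exp (\<alpha> ^ 3 / 32768) ^ r)"
proof -
  have \<alpha>3: "0 < \<alpha> ^ 3" using \<alpha> by simp
  define Lm where "Lm = nat \<lceil>32768 / \<alpha> ^ 3\<rceil> + 1"
  have Lm: "32768 / \<alpha> ^ 3 < real Lm" unfolding Lm_def by linarith
  define H where "H = Lm + 2"
  \<comment> \<open>Makes \<open>\<alpha> ^ 3 / 32768 * (A0 * ln n) = 2 * ln n\<close>, so that the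
    exponential beats \<open>n * n\<close>, which exceeds the number of sets to be hit.\<close>
  define A0 where "A0 = 65536 / \<alpha> ^ 3"
  have A0: "0 < A0" unfolding A0_def using \<alpha>3 by simp
  \<comment> \<open>The first four entries are proportions of \<open>n\<close> asked for in the
    conclusion. The last one gives \<open>sqrt (2 * K * n) \<le> \<alpha> * \<zeta> / 16 * n\<close>
    from \<open>K \<le> \<theta> * n\<close>.\<close>
  define \<theta> where "\<theta> = Min {\<gamma> / 4, \<epsilon> * \<zeta>, \<alpha> ^ 3 / 32768, \<alpha> * \<zeta> / 16, (\<alpha> * \<zeta>)\<^sup>2 / 512}"
  have \<theta>: "\<theta> \<le> \<gamma> / 4" "\<theta> \<le> \<epsilon> * \<zeta>" "\<theta> \<le> \<alpha> ^ 3 / 32768" "\<theta> \<le> \<alpha> * \<zeta> / 16" "\<theta> \<le> (\<alpha> * \<zeta>)\<^sup>2 / 512"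
    unfolding \<theta>_def by (intro Min_le; simp)+
  have \<theta>0: "0 < \<theta>" unfolding \<theta>_def using \<alpha> pos \<alpha>3 by simp
  \<comment> \<open>\<open>(\<Delta> + 2) ^ H\<close> contributes the exponent
    \<open>(c + 2) * H\<close>, and the factor \<open>r\<close> one more.\<close>
  define k where "k = (c + 2) * H + 1"
  obtain n2 where n2: "\<forall>n\<ge>n2. 8 * (A0 + 1) / \<theta> * ln (real n) ^ k \<le> sqrt (real n)"
    using polylog_le_sqrt by blast
  define n1 where "n1 = n2 + nat \<lceil>exp 2 :: real\<rceil> + nat \<lceil>2 * real Lm / \<zeta>\<rceil> + nat \<lceil>16 / (\<alpha> * \<zeta>)\<rceil> + 2"
  show ?thesis
  proof (rule exI[of _ n1], intro allI impI)
    fix n \<Delta> :: nat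
    assume n: "n1 \<le> n" and \<Delta>: "real \<Delta> \<le> ln (real n) ^ c"
    have nn: "n2 \<le> n" "exp 2 \<le> real n" "2 * real Lm / \<zeta> < real n" "16 / (\<alpha> * \<zeta>) \<le> real n" "1 \<le> n"
      using n unfolding n1_def by linarith+
    define L where "L = ln (real n)"
    have n0: "0 < real n" using nn(5) by simp
    have L2: "2 \<le> L" unfolding L_def using nn(2) n0 by (simp add: ln_ge_iff)
    have sqn: "1 \<le> sqrt (real n)" using nn(5) by simp
    define s0 where "s0 = nat \<lceil>sqrt (real n)\<rceil>"
    have s0: "sqrt (real n) \<le> real s0" "real s0 \<le> sqrt (real n) + 1" unfolding s0_def using sqn by linarith+
    have s01: "1 \<le> s0" using s0 sqn by linarith
    have "(sqrt (real n))\<^sup>2 \<le> (real s0)\<^sup>2" using s0 sqn by (intro power_mono) auto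
    then have "real n \<le> real (s0\<^sup>2)" using n0 by simp
    then have ns: "n \<le> s0\<^sup>2" by (simp only: of_nat_le_iff)
    have s0n: "real s0 \<le> 2 * sqrt (real n)" using s0 sqn by linarith
    define K where "K = (\<Delta> + 1) * s0"
    define W where "W = (2 * s0 + 1) * (\<Delta> + 2) ^ (Lm + 2)"
    define r where "r = nat \<lceil>A0 * L\<rceil>"
    have AL: "0 < A0 * L" using A0 L2 by simp
    have r: "A0 * L \<le> real r" "real r \<le> A0 * L + 1" "1 \<le> r" unfolding r_def using AL by linarith+
    have "A0 * L + 1 \<le> (A0 + 1) * L" using L2 by (simp add: algebra_simps)
    then have rL: "real r \<le> (A0 + 1) * L" using r(2) by linarith
    have \<Delta>2: "real (\<Delta> + 2) \<le> L ^ (c + 2)"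
    proof -
      have "1 \<le> L ^ c" using L2 by (intro one_le_power) auto
      moreover have "4 \<le> L ^ 2" using power_mono[OF L2, of 2] by simp
      then have "4 * L ^ c \<le> L ^ 2 * L ^ c" using L2 by (intro mult_right_mono) auto
      then have "4 * L ^ c \<le> L ^ (c + 2)" by (simp only: power_add mult.commute)
      moreover have "real (\<Delta> + 2) = real \<Delta> + 2" by simp
      ultimately show ?thesis using \<Delta>[folded L_def] by linarith
    qed
    have WK: "real (W + K) \<le> 8 * sqrt (real n) * L ^ ((c + 2) * H)"
    proof -
      have "\<Delta> + 1 \<le> (\<Delta> + 2) ^ 1" by simp
      also have "\<dots> \<le> (\<Delta> + 2) ^ H" unfolding H_def by (intro power_increasing) auto
      finally have "K \<le> (\<Delta> + 2) ^ H * s0" unfolding K_def by (intro mult_right_mono) auto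
      moreover have "W \<le> (3 * s0) * (\<Delta> + 2) ^ H"
        unfolding W_def H_def using s01 by (intro mult_right_mono) auto
      ultimately have "W + K \<le> 4 * s0 * (\<Delta> + 2) ^ H" by (simp add: algebra_simps)
      then have "real (W + K) \<le> real (4 * s0 * (\<Delta> + 2) ^ H)" by (simp only: of_nat_le_iff)
      also have "\<dots> = 4 * real s0 * real (\<Delta> + 2) ^ H" by simp
      also have "\<dots> \<le> (8 * sqrt (real n)) * (L ^ (c + 2)) ^ H"
      proof (rule mult_mono)
        show "real (\<Delta> + 2) ^ H \<le> (L ^ (c + 2)) ^ H" using \<Delta>2 by (rule power_mono) simp
      qed (use s0n sqn in auto)
      finally show ?thesis by (simp only: power_mult)
    qed
    have X: "real ((W + K) * r) \<le> \<theta> * real n"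
    proof -
      have "real ((W + K) * r) = real (W + K) * real r" by simp
      also have "\<dots> \<le> (8 * sqrt (real n) * L ^ ((c + 2) * H)) * ((A0 + 1) * L)"
        using WK rL L2 n0 by (intro mult_mono) auto
      also have "\<dots> = \<theta> * sqrt (real n) * (8 * (A0 + 1) / \<theta> * L ^ k)"
        unfolding k_def using \<theta>0 by (simp add: field_simps)
      also have "\<dots> \<le> \<theta> * sqrt (real n) * sqrt (real n)"
        using n2 nn(1) \<theta>0 n0 unfolding L_def by (intro mult_left_mono) auto
      also have "\<dots> = \<theta> * real n" using n0 by simp
      finally show ?thesis .
    qed
    have "(W + K) * 1 \<le> (W + K) * r" using r(3) by (intro mult_left_mono) auto
    then have "real (W + K) \<le> real ((W + K) * r)" by (simp only: of_nat_le_iff mult_1_right)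
    then have WKX: "real (W + K) \<le> \<theta> * real n" using X by linarith
    then have KX: "real K \<le> \<theta> * real n" by simp
    have up: "\<theta> * real n \<le> y * real n" if "\<theta> \<le> y" for y using that n0 by (intro mult_right_mono) auto
    have 1: "real K \<le> \<gamma> * real n / 4" using KX up[OF \<theta>(1)] by simp
    have 2: "real (W + K) \<le> \<epsilon> * \<zeta> * real n" using WKX up[OF \<theta>(2)] by linarith
    have 3: "real ((W + K) * r) \<le> \<alpha> ^ 3 / 32768 * real n" using X up[OF \<theta>(3)] by linarith
    have 4: "sqrt (2 * real K * real n) + 1 + real ((W + K) * r) \<le> \<alpha> * \<zeta> * real n / 4"
    proof -
      have "2 * real K * real n \<le> 2 * (\<theta> * real n) * real n" using KX n0 by (intro mult_right_mono mult_left_mono) auto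
      also have "\<dots> \<le> 2 * ((\<alpha> * \<zeta>)\<^sup>2 / 512 * real n) * real n"
        using up[OF \<theta>(5)] n0 by (intro mult_right_mono mult_left_mono) auto
      also have "\<dots> = (\<alpha> * \<zeta> / 16 * real n)\<^sup>2" by (simp add: power2_eq_square)
      finally have "sqrt (2 * real K * real n) \<le> \<alpha> * \<zeta> / 16 * real n"
        using \<alpha> pos n0 by (intro real_le_lsqrt) auto
      moreover have "1 \<le> \<alpha> * \<zeta> / 16 * real n" using nn(4) \<alpha> pos by (simp add: field_simps)
      moreover have "real ((W + K) * r) \<le> \<alpha> * \<zeta> / 16 * real n" using X up[OF \<theta>(4)] by linarith
      moreover have "0 < \<alpha> * \<zeta> * real n" using \<alpha> pos n0 by simp
      moreover have "\<alpha> * \<zeta> / 16 * real n = \<alpha> * \<zeta> * real n / 16" by simp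
      ultimately show ?thesis by linarith
    qed
    have 5: "2 * real n / \<zeta> * real Lm < exp (\<alpha> ^ 3 / 32768) ^ r"
    proof -
      have "2 * real n / \<zeta> * real Lm = real n * (2 * real Lm / \<zeta>)" by simp
      also have "\<dots> < real n * real n" using nn(3) n0 by (intro mult_strict_left_mono)
      also have "\<dots> = exp (L + L)" unfolding L_def exp_add using n0 by simp
      also have "\<dots> \<le> exp (\<alpha> ^ 3 / 32768 * real r)"
      proof -
        have "L + L = \<alpha> ^ 3 / 32768 * (A0 * L)" unfolding A0_def using \<alpha>3 by simp
        also have "\<dots> \<le> \<alpha> ^ 3 / 32768 * real r" using r(1) \<alpha>3 by (intro mult_left_mono) auto
        finally show ?thesis by simp
      qed
      also have "\<dots> = exp (\<alpha> ^ 3 / 32768) ^ r" by (simp add: exp_of_nat_mult[symmetric] mult.commute)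
      finally show ?thesis .
    qed
    show "\<exists>Lm K W r s0 :: nat.
     32768 / \<alpha> ^ 3 < real Lm \<and> K = (\<Delta> + 1) * s0 \<and> W = (2 * s0 + 1) * (\<Delta> + 2) ^ (Lm + 2) \<and>
     1 \<le> s0 \<and> n \<le> s0\<^sup>2 \<and> real K \<le> \<gamma> * real n / 4 \<and> real (W + K) \<le> \<epsilon> * \<zeta> * real n \<and>
     real ((W + K) * r) \<le> \<alpha> ^ 3 / 32768 * real n \<and>
     sqrt (2 * real K * real n) + 1 + real ((W + K) * r) \<le> \<alpha> * \<zeta> * real n / 4 \<and>
     2 * real n / \<zeta> * real Lm < exp (\<alpha> ^ 3 / 32768) ^ r"
      by (rule exI[of _ Lm], rule exI[of _ K], rule exI[of _ W], rule exI[of _ r], rule exI[of _ s0])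
        (intro conjI Lm K_def W_def s01 ns 1 2 3 4 5)
  qed
qed

lemma (in pair_fin_digraph) min_pseudo_semidegree_le:
  assumes "parcs G \<noteq> {}" "nb (parcs G) x \<noteq> {}"
  shows "min_pseudo_semidegree G \<le> card (nb (parcs G) x)"
proof -
  define S where "S = {d. \<forall>v \<in> pverts G.
             out_degree (with_proj G) v \<in> {0} \<union> {d..} \<and> in_degree (with_proj G) v \<in> {0} \<union> {d..}}"
  have out: "card (nb (parcs G) (u, True)) = out_degree (with_proj G) u" for u
  proof -
    have "out_arcs (with_proj G) u = (\<lambda>w. (u, w)) ` {w. (u, w) \<in> parcs G}" by (auto simp: image_iff)
    then show ?thesis unfolding out_degree_def nb_def by (simp add: card_image inj_on_def)
  qed
  have inn: "card (nb (parcs G) (u, False)) = in_degree (with_proj G) u" for u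
  proof -
    have "in_arcs (with_proj G) u = (\<lambda>w. (w, u)) ` {w. (w, u) \<in> parcs G}" by (auto simp: image_iff)
    then show ?thesis unfolding in_degree_def nb_def by (simp add: card_image inj_on_def)
  qed
  have fin: "finite (nb (parcs G) y)" for y
  proof -
    have "nb (parcs G) y \<subseteq> pverts G \<times> UNIV" using in_arcsD1 in_arcsD2 by (intro nb_subset) auto
    then show ?thesis using pair_finite_verts finite_subset by fastforce
  qed
  obtain u v where uv: "(u, v) \<in> parcs G" using assms(1) by auto
  have "(v, False) \<in> nb (parcs G) (u, True)" using uv by simp
  then have "0 < out_degree (with_proj G) u" unfolding out[symmetric] using fin card_gt_0_iff by blast
  then have "S \<subseteq> {..out_degree (with_proj G) u}" unfolding S_def using in_arcsD1[OF uv] by auto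
  then have "finite S" using finite_subset by blast
  moreover have "0 \<in> S" unfolding S_def by auto
  ultimately have "Max S \<in> S" by (intro Max_in) auto
  then have mem: "min_pseudo_semidegree G \<in> S" unfolding min_pseudo_semidegree_def S_def[symmetric] using assms(1) by simp
  have pos: "0 < card (nb (parcs G) x)" using assms(2) fin card_gt_0_iff by blast
  obtain w s where x: "x = (w, s)" by (cases x)
  have "w \<in> pverts G" using assms(2) in_arcsD1 in_arcsD2 unfolding x nb_def by (auto split: if_splits)
  then have "out_degree (with_proj G) w \<in> {0} \<union> {min_pseudo_semidegree G..}"
    "in_degree (with_proj G) w \<in> {0} \<union> {min_pseudo_semidegree G..}" using mem unfolding S_def by auto
  then show ?thesis using pos out[of w] inn[of w] unfolding x by (cases s) auto
qed

theorem theorem39: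
  fixes \<eta> :: real and c :: nat
  assumes "0 < \<eta>" and "\<eta> < 1"
  shows "\<exists>n0 :: nat. \<forall>n \<ge> n0. \<forall>k :: nat. \<eta> * real n \<le> real k \<longrightarrow>
    (\<forall>D :: 'a pair_pre_digraph.
       oriented_graph D \<and> card (pverts D) = n \<and>
       (1 + \<eta>) * real k / 2 < real (min_pseudo_semidegree D) \<longrightarrow>
       (\<forall>T :: 'b pair_pre_digraph.
          oriented_tree T \<and> antidirected T \<and> balanced T \<and> card (parcs T) = k \<and>
          real (max_total_degree T) \<le> ln (real n) ^ c \<longrightarrow>
          contains_copy D T))"
proof -
  \<comment> \<open>A class of the tree has at most \<open>(k + 1) / 2\<close> vertices, and
    \<open>k \<ge> \<eta> * n\<close>, so \<open>d\<close> exceeds it by at least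
    \<open>(\<eta>\<^sup>2 * n - 1) / 2\<close>. Once \<open>\<eta>\<^sup>2 * n \<ge> 2\<close>,
    this is at least \<open>\<alpha> * n\<close>.\<close>
  define \<alpha> where "\<alpha> = \<eta>\<^sup>2 / 4"
  \<comment> \<open>The value for which the loss in \<open>linking_layers\<close>,
    \<open>4 * \<epsilon> * n\<close> times the pair size, equals \<open>\<alpha> * n / 2\<close>
    times the proportion \<open>\<alpha> / 8\<close> of linking vertices.\<close>
  define \<epsilon> where "\<epsilon> = \<alpha>\<^sup>2 / 64"
  have \<eta>2: "\<eta>\<^sup>2 \<le> \<eta>" using assms power_decreasing[of 1 2 \<eta>] by simp
  have \<alpha>: "0 < \<alpha>" "\<alpha> \<le> 1" "\<alpha> \<le> \<eta> / 4" unfolding \<alpha>_def using assms \<eta>2 by auto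
  have \<epsilon>: "0 < \<epsilon>" "\<epsilon> \<le> 1/4" unfolding \<epsilon>_def using \<alpha> power_le_one[of \<alpha> 2] by auto
  obtain \<zeta> \<gamma> n0 where pos: "0 < \<zeta>" "0 < \<gamma>" and host: "\<And>(V :: 'a set) E d. finite V \<Longrightarrow> E \<subseteq> V \<times> V \<Longrightarrow> E \<noteq> {} \<Longrightarrow>
     (\<forall>u v. (u, v) \<in> E \<longrightarrow> (v, u) \<notin> E) \<Longrightarrow> n0 \<le> card V \<Longrightarrow> \<alpha> * real (card V) \<le> d \<Longrightarrow>
     (\<forall>x. nb E x \<noteq> {} \<longrightarrow> d \<le> real (card (nb E x))) \<Longrightarrow> \<exists>C J P Q. host V E C J P Q d \<alpha> \<epsilon> \<zeta> \<gamma>"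
    using host_structure[OF \<alpha>(1,2) \<epsilon>, where ?'a = 'a] by metis
  obtain n1 where par: "\<And>n \<Delta>. n1 \<le> n \<Longrightarrow> real \<Delta> \<le> ln (real n) ^ c \<Longrightarrow> \<exists>Lm K W r s0 :: nat.
     32768 / \<alpha> ^ 3 < real Lm \<and> K = (\<Delta> + 1) * s0 \<and> W = (2 * s0 + 1) * (\<Delta> + 2) ^ (Lm + 2) \<and>
     1 \<le> s0 \<and> n \<le> s0\<^sup>2 \<and> real K \<le> \<gamma> * real n / 4 \<and> real (W + K) \<le> \<epsilon> * \<zeta> * real n \<and>
     real ((W + K) * r) \<le> \<alpha> ^ 3 / 32768 * real n \<and>
     sqrt (2 * real K * real n) + 1 + real ((W + K) * r) \<le> \<alpha> * \<zeta> * real n / 4 \<and>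
     2 * real n / \<zeta> * real Lm < exp (\<alpha> ^ 3 / 32768) ^ r"
    using embedding_parameters[where c = c, OF \<alpha>(1,2) \<epsilon>(1) pos]
    by (elim exE) (rule that, drule spec, drule (1) mp, drule spec, drule (1) mp, assumption)
  show ?thesis
  proof (intro exI[of _ "n0 + n1 + nat \<lceil>2 / \<eta>\<^sup>2\<rceil> + 1"] allI impI, elim conjE)
    fix n k :: nat and D :: "'a pair_pre_digraph" and T :: "'b pair_pre_digraph"
    assume n: "n0 + n1 + nat \<lceil>2 / \<eta>\<^sup>2\<rceil> + 1 \<le> n" and k: "\<eta> * real n \<le> real k"
      and D: "oriented_graph D" "card (pverts D) = n" "(1 + \<eta>) * real k / 2 < real (min_pseudo_semidegree D)"
      and T: "oriented_tree T" "antidirected T" "balanced T" "card (parcs T) = k"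
        "real (max_total_degree T) \<le> ln (real n) ^ c"
    interpret D: oriented_graph D by (rule D(1))
    interpret T: oriented_tree T by (rule T(1))
    have nn: "n0 \<le> n" "n1 \<le> n" "2 / \<eta>\<^sup>2 \<le> real n" "0 < n" using n by linarith+
    have n2: "2 \<le> \<eta>\<^sup>2 * real n" using nn(3) assms by (simp add: field_simps)
    have "0 < \<eta> * real n" using assms(1) nn(4) by simp
    then have k0: "0 < real k" using k by linarith
    then have k1: "1 \<le> card (parcs T)" using T(4) by simp
    define d where "d = real (min_pseudo_semidegree D)"
    have "0 < (1 + \<eta>) * real k / 2" using assms k0 by simp
    then have "min_pseudo_semidegree D \<noteq> 0" using D(3) by auto
    then have ne: "parcs D \<noteq> {}" unfolding min_pseudo_semidegree_def by (auto split: if_splits)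
    have dk: "real k / 2 + \<eta> * real k / 2 < d" using D(3) unfolding d_def by (simp add: algebra_simps)
    have \<eta>k: "\<eta>\<^sup>2 * real n \<le> \<eta> * real k" using mult_left_mono[OF k, of \<eta>] assms(1) by (simp add: power2_eq_square mult.assoc)
    have \<alpha>n: "\<alpha> * real n = \<eta>\<^sup>2 * real n / 4" unfolding \<alpha>_def by simp
    have "\<alpha> * real (card (pverts D)) \<le> d" unfolding D(2) using dk \<eta>k \<alpha>n k0 n2 by linarith
    moreover have "\<forall>x. nb (parcs D) x \<noteq> {} \<longrightarrow> d \<le> real (card (nb (parcs D) x))"
      unfolding d_def using D.min_pseudo_semidegree_le[OF ne] by simp
    moreover have "parcs D \<subseteq> pverts D \<times> pverts D" using D.in_arcsD1 D.in_arcsD2 by auto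
    moreover have "\<forall>u v. (u, v) \<in> parcs D \<longrightarrow> (v, u) \<notin> parcs D" using D.no_antiparallel by blast
    ultimately obtain C J P Q where "host (pverts D) (parcs D) C J P Q d \<alpha> \<epsilon> \<zeta> \<gamma>"
      using host[OF D.pair_finite_verts _ ne, of d] nn(1) D(2) by blast
    then interpret host "pverts D" "parcs D" C J P Q d \<alpha> \<epsilon> \<zeta> \<gamma> .
    obtain par vs cl m where vs: "parent_order par vs" "vs \<noteq> []" "set vs = pverts T"
      "\<And>v. v \<in> set (tl vs) \<Longrightarrow> cl v = (\<not> cl (par v))"
      and arcs: "\<And>u v. (u, v) \<in> parcs T \<Longrightarrow> cl u \<and> \<not> cl v \<and>
        ((v \<in> set (tl vs) \<and> u = par v) \<or> (u \<in> set (tl vs) \<and> v = par u))"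
      and m: "\<And>s. card {v \<in> set vs. cl v = s} = m" "2 * m \<le> card (parcs T) + 1"
      and ch: "\<And>u. card {v \<in> set (tl vs). par v = u} \<le> max_total_degree T"
      using antidirected_tree_order[OF T(1-3) k1] by blast
    have "2 * real m \<le> real k + 1" using m(2) T(4) by linarith
    then have md: "real m \<le> d - \<alpha> * real (card (pverts D))" unfolding D(2) using dk \<eta>k \<alpha>n n2 by linarith
    have Vne: "pverts D \<noteq> {}" using D(2) nn(4) by auto
    obtain Lm K W r s0 where num: "32768 / \<alpha> ^ 3 < real Lm" "K = (max_total_degree T + 1) * s0"
      "W = (2 * s0 + 1) * (max_total_degree T + 2) ^ (Lm + 2)" "1 \<le> s0" "n \<le> s0\<^sup>2"
      "real K \<le> \<gamma> * real n / 4" "real (W + K) \<le> \<epsilon> * \<zeta> * real n"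
      "real ((W + K) * r) \<le> \<alpha> ^ 3 / 32768 * real n"
      "sqrt (2 * real K * real n) + 1 + real ((W + K) * r) \<le> \<alpha> * \<zeta> * real n / 4"
      "2 * real n / \<zeta> * real Lm < exp (\<alpha> ^ 3 / 32768) ^ r"
      using par[OF nn(2) T(5)] by (elim exE conjE) (rule that; assumption)
    obtain \<phi> where \<phi>: "\<forall>v\<in>set vs. \<phi> v \<in> C \<and> snd (\<phi> v) = cl v"
      "\<forall>v\<in>set (tl vs). \<phi> v \<in> nb (parcs D) (\<phi> (par v))" "inj_on (fst \<circ> \<phi>) (set vs)"
      using embed_tree[OF \<alpha>(1,2) \<epsilon>_def pos Vne num(1-4) num(5-10)[folded D(2)] vs(1,2) ch vs(4) m(1) md] by blast
    show "contains_copy D T"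
    proof (rule contains_copyI[of D T "fst \<circ> \<phi>"])
      show "pair_wf_digraph D" "pair_wf_digraph T" by unfold_locales
      show "inj_on (fst \<circ> \<phi>) (pverts T)" using \<phi>(3) vs(3) by simp
      show "(fst \<circ> \<phi>) ` pverts T \<subseteq> pverts D" using \<phi>(1) CV vs(3) by fastforce
      fix u v assume uv: "(u, v) \<in> parcs T"
      have in_vs: "u \<in> set vs" "v \<in> set vs" using T.in_arcsD1[OF uv] T.in_arcsD2[OF uv] vs(3) by auto
      note a = arcs[OF uv]
      have snds: "snd (\<phi> u) = True" "snd (\<phi> v) = False" using \<phi>(1) in_vs a by auto
      then have eqs: "\<phi> u = (fst (\<phi> u), True)" "\<phi> v = (fst (\<phi> v), False)" by (metis prod.collapse)+
      from a consider "v \<in> set (tl vs)" "u = par v" | "u \<in> set (tl vs)" "v = par u" by blast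
      then have "(fst (\<phi> u), fst (\<phi> v)) \<in> parcs D"
      proof cases
        case 1
        then have "\<phi> v \<in> nb (parcs D) (\<phi> u)" using \<phi>(2) by blast
        then show ?thesis by (metis eqs nb_True)
      next
        case 2
        then have "\<phi> u \<in> nb (parcs D) (\<phi> v)" using \<phi>(2) by blast
        then show ?thesis by (metis eqs nb_False)
      qed
      then show "((fst \<circ> \<phi>) u, (fst \<circ> \<phi>) v) \<in> parcs D" by simp
    qed
  qed
qed

end
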